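(* Let $(A,m)$ be an $A_\infty$-algebra over a field $K$ of characteristic zero, and let $H_0(A)=H_0(A,m_1)=A_0/m_1(A_1)$, regarded as an ordinary associative algebra with the product induced by $m_2$. Then the natural projection $A\to H_0(A)$ (the quotient map on $A_0$ and zero on $A_i$, $i\ge1$) induces an isomorphism $HP_\bullet(A,m)\cong HP_\bullet(H_0(A))$, where on the right $HP_\bullet$ is the ordinary periodic cyclic homology of the associative algebra $H_0(A)$.
   Context: $A=\bigoplus_{i\ge0}A_i$ nonnegatively graded, $A[1]_i=A_{i-1}$, Koszul signs. An $A_\infty$-algebra $(A,m)$ is a family $m_n:A^{\otimes n}\to A$ ($n\ge1$) of degree $n-2$ such that the unique degree $-1$ coderivation $b'_m$ of the tensor coalgebra $T^cA[1]=\bigoplus_{n\ge0}A[1]^{\otimes n}$ (deconcatenation coproduct) with $b'_m(1)=0$ and corestriction $\sum_nm_n$ satisfies $(b'_m)^2=0$. The product $m_2$ induces an associative product on $H_\bullet(A,m_1)$, in particular on $H_0(A,m_1)$. An ordinary associative algebra is viewed as an $A_\infty$-algebra concentrated in degree $0$ with $m_2$ its product and $m_n=0$ for $n\ne2$; for it the construction below gives ordinary periodic cyclic homology. Periodic cyclic homology of $(A,m)$: $C_n(A)=A[1]^{\otimes(n+1)}$, $\lambda(a_0,\dots,a_n)=(-1)^{\varepsilon}(a_n,a_0,\dots,a_{n-1})$, $\varepsilon=(|a_n|+1)(\sum_{i<n}|a_i|+n)$, $N=1+\lambda+\dots+\lambda^n$; $b'_m$ is the bar codifferential and $b_m=b'_m+$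 (terms where some $m_i$ is applied to a cyclically consecutive block wrapping around from $a_n$ to $a_0$, result placed in position $0$, with Koszul sign). $CC(A,m)$ is the double complex with column $p\in\mathbb Z$ equal to $(C_\bullet(A),b_m)$ for $p$ even and $(C_\bullet(A),-b'_m)$ for $p$ odd, horizontal maps $1-\lambda$ (odd to even) and $N$ (even to odd); it is the X-complex of the DG coalgebra $(T^cA[1],b'_m)$. $HP_\bullet(A,m)$ is the homology of the direct-product total complex of $CC(A,m)$. *)

theory Defs
  imports Complex_Main "HOL-Library.Function_Algebras"
begin

text \<open>
  Conventions.  The ground field is a type 'k of class field_char_0.  The underlying
  vector space of A is a type 'a with scalar multiplication sc (a vector_space).
  The grading is G :: nat => 'a set (G i = A_i).  Tensor powers are modelled as the
  free 'k-vector space on lists of homogeneous elements (degree, element) modulo the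
  subspace spanned by the multilinearity relations (and, for presented quotients
  A/N, by pure tensors having a factor in N).  Free vectors are functions
  hlist => 'k (only finitely supported ones occur).
\<close>

type_synonym 'a hlist = "(nat \<times> 'a) list"
type_synonym ('k,'a) fv = "'a hlist \<Rightarrow> 'k"

definition gen :: "'a hlist \<Rightarrow> ('k::field,'a) fv" where
  "gen xs = (\<lambda>ys. if ys = xs then 1 else 0)"

definition fsupp :: "('k::zero,'a) fv \<Rightarrow> 'a hlist set" where
  "fsupp x = {g. x g \<noteq> 0}"

definition fscale :: "'k::field \<Rightarrow> ('k,'a) fv \<Rightarrow> ('k,'a) fv" where
  "fscale c x = (\<lambda>g. c * x g)"

definition lin :: "('a hlist \<Rightarrow> ('k::field,'a) fv) \<Rightarrow> ('k,'a) fv \<Rightarrow> ('k,'a) fv" where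
  "lin f x = (\<Sum>g\<in>fsupp x. fscale (x g) (f g))"

definition fspan :: "('k::field,'a) fv set \<Rightarrow> ('k,'a) fv set" where
  "fspan S = {x. \<exists>(k::nat) c v. (\<forall>i<k. v i \<in> S) \<and> x = (\<Sum>i<k. fscale (c i) (v i))}"

definition valid :: "(nat \<Rightarrow> 'a set) \<Rightarrow> 'a hlist \<Rightarrow> bool" where
  "valid G xs = (\<forall>(d,a)\<in>set xs. a \<in> G d)"

text \<open>Degree in T^c A[1] of a pure tensor of homogeneous elements.\<close>
definition sdeg :: "'a hlist \<Rightarrow> nat" where
  "sdeg xs = (\<Sum>p\<leftarrow>xs. fst p + 1)"

text \<open>Apply m_j to a block (j = its length); result has degree (sum of degrees) + j - 2
  (when this is negative, m_j vanishes by the grading hypothesis).\<close>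
definition mapp :: "(nat \<Rightarrow> 'a list \<Rightarrow> 'a) \<Rightarrow> 'a hlist \<Rightarrow> nat \<times> 'a" where
  "mapp m ys = (sum_list (map fst ys) + length ys - 2, m (length ys) (map snd ys))"

definition bpgen :: "(nat \<Rightarrow> 'a list \<Rightarrow> 'a) \<Rightarrow> 'a hlist \<Rightarrow> ('k::field,'a) fv" where
  "bpgen m xs = (\<Sum>i<length xs. \<Sum>j\<in>{1..length xs - i}.
      fscale ((-1) ^ sdeg (take i xs))
        (gen (take i xs @ [mapp m (take j (drop i xs))] @ drop (i + j) xs)))"

text \<open>Cyclic rotation moving the last s entries to the front, with its Koszul sign
  (lambda^s).\<close>
definition rot :: "nat \<Rightarrow> 'a hlist \<Rightarrow> 'a hlist" where
  "rot s xs = drop (length xs - s) xs @ take (length xs - s) xs"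

definition rotsign :: "nat \<Rightarrow> 'a hlist \<Rightarrow> 'k::field" where
  "rotsign s xs = (-1) ^ (sdeg (drop (length xs - s) xs) * sdeg (take (length xs - s) xs))"

definition lamgen :: "nat \<Rightarrow> 'a hlist \<Rightarrow> ('k::field,'a) fv" where
  "lamgen s xs = fscale (rotsign s xs) (gen (rot s xs))"

definition Ngen :: "'a hlist \<Rightarrow> ('k::field,'a) fv" where
  "Ngen xs = (\<Sum>s<length xs. lamgen s xs)"

text \<open>Cyclic Hochschild differential b_m = b'_m + wrap-around terms
  (m_j applied to a cyclically consecutive block containing a_n and a_0, placed in
  position 0).\<close>
definition bgen :: "(nat \<Rightarrow> 'a list \<Rightarrow> 'a) \<Rightarrow> 'a hlist \<Rightarrow> ('k::field,'a) fv" where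
  "bgen m xs = bpgen m xs +
     (\<Sum>s\<in>{1..<length xs}. \<Sum>j\<in>{s+1..length xs}.
        fscale (rotsign s xs) (gen (mapp m (take j (rot s xs)) # drop j (rot s xs))))"

text \<open>Relations defining the tensor powers of the graded space A/N (N = {0} for A).\<close>
definition relgens :: "('k::field \<Rightarrow> 'a::ab_group_add \<Rightarrow> 'a) \<Rightarrow> (nat \<Rightarrow> 'a set) \<Rightarrow> 'a set
    \<Rightarrow> ('k,'a) fv set" where
  "relgens sc G N =
     {gen (xs @ [(d, sc c a + b)] @ ys) - fscale c (gen (xs @ [(d, a)] @ ys))
        - gen (xs @ [(d, b)] @ ys) | xs ys d a b c.
        valid G xs \<and> valid G ys \<and> a \<in> G d \<and> b \<in> G d}
   \<union> {gen (xs @ [(d, a)] @ ys) | xs ys d a. valid G xs \<and> valid G ys \<and> a \<in> G d \<and> a \<in> N}"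

text \<open>Elements of degree n of the direct-product total complex of CC: families over the
  columns p of finite chains of internal degree n - p, built from C_k, k >= 0.\<close>
definition tot :: "(nat \<Rightarrow> 'a set) \<Rightarrow> int \<Rightarrow> (int \<Rightarrow> ('k::field,'a) fv) \<Rightarrow> bool" where
  "tot G n x = (\<forall>p. finite (fsupp (x p)) \<and>
      (\<forall>g\<in>fsupp (x p). valid G g \<and> g \<noteq> [] \<and> int (sdeg g) = n - p))"

definition Dtot :: "(nat \<Rightarrow> 'a list \<Rightarrow> 'a) \<Rightarrow> (int \<Rightarrow> ('k::field,'a) fv) \<Rightarrow> (int \<Rightarrow> ('k,'a) fv)" where
  "Dtot m x = (\<lambda>p.
      (if even p then lin (bgen m) (x p) else - lin (bpgen m) (x p)) +
      (if odd (p + 1) then x (p + 1) - lin (lamgen 1) (x (p + 1)) else lin Ngen (x (p + 1))))"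

definition modeq :: "('k::field,'a) fv set \<Rightarrow> (int \<Rightarrow> ('k,'a) fv) \<Rightarrow> (int \<Rightarrow> ('k,'a) fv) \<Rightarrow> bool" where
  "modeq R x y = (\<forall>p. x p - y p \<in> fspan R)"

definition graded_vs :: "('k::field \<Rightarrow> 'a::ab_group_add \<Rightarrow> 'a) \<Rightarrow> (nat \<Rightarrow> 'a set) \<Rightarrow> bool" where
  "graded_vs sc G =
     ((\<forall>i. 0 \<in> G i \<and> (\<forall>a\<in>G i. \<forall>b\<in>G i. a + b \<in> G i) \<and> (\<forall>c. \<forall>a\<in>G i. sc c a \<in> G i)) \<and>
      (\<forall>x. \<exists>!c. finite {i. c i \<noteq> 0} \<and> (\<forall>i. c i \<in> G i) \<and> x = (\<Sum>i\<in>{i. c i \<noteq> 0}. c i)))"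

definition ainf_alg :: "('k::field \<Rightarrow> 'a::ab_group_add \<Rightarrow> 'a) \<Rightarrow> (nat \<Rightarrow> 'a set)
    \<Rightarrow> (nat \<Rightarrow> 'a list \<Rightarrow> 'a) \<Rightarrow> bool" where
  "ainf_alg sc G m =
     (vector_space sc \<and> graded_vs sc G \<and>
      (\<forall>n xs ys a b c. length xs + length ys + 1 = n \<longrightarrow>
          m n (xs @ [sc c a + b] @ ys) = sc c (m n (xs @ [a] @ ys)) + m n (xs @ [b] @ ys)) \<and>
      (\<forall>xs. valid G xs \<and> xs \<noteq> [] \<longrightarrow>
          (if sdeg xs \<ge> 2 then m (length xs) (map snd xs) \<in> G (sdeg xs - 2)
           else m (length xs) (map snd xs) = 0)) \<and>
      (\<forall>xs. valid G xs \<longrightarrow> lin (bpgen m) (bpgen m xs) \<in> fspan (relgens sc G {0})))"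

text \<open>H_0(A) = A_0 / m_1(A_1), concentrated in degree 0, as an ordinary algebra with
  product induced by m_2 (and no other operations).\<close>
definition G0 :: "(nat \<Rightarrow> 'a::zero set) \<Rightarrow> nat \<Rightarrow> 'a set" where
  "G0 G = (\<lambda>i. if i = 0 then G 0 else {0})"

definition N0 :: "(nat \<Rightarrow> 'a list \<Rightarrow> 'a) \<Rightarrow> (nat \<Rightarrow> 'a set) \<Rightarrow> 'a set" where
  "N0 m G = (\<lambda>a. m 1 [a]) ` G 1"

definition m0 :: "(nat \<Rightarrow> 'a list \<Rightarrow> 'a) \<Rightarrow> nat \<Rightarrow> 'a list \<Rightarrow> 'a::zero" where
  "m0 m = (\<lambda>n as. if n = 2 then m 2 as else 0)"

definition pigen :: "'a hlist \<Rightarrow> ('k::field,'a) fv" where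
  "pigen xs = (if (\<forall>p\<in>set xs. fst p = 0) then gen xs else 0)"

definition pitot :: "(int \<Rightarrow> ('k::field,'a) fv) \<Rightarrow> (int \<Rightarrow> ('k,'a) fv)" where
  "pitot x = (\<lambda>p. lin pigen (x p))"

definition quasi_iso ::
  "('k::field,'a) fv set \<Rightarrow> (int \<Rightarrow> (int \<Rightarrow> ('k,'a) fv) \<Rightarrow> bool) \<Rightarrow> ((int \<Rightarrow> ('k,'a) fv) \<Rightarrow> (int \<Rightarrow> ('k,'a) fv))
   \<Rightarrow> ('k,'a) fv set \<Rightarrow> (int \<Rightarrow> (int \<Rightarrow> ('k,'a) fv) \<Rightarrow> bool) \<Rightarrow> ((int \<Rightarrow> ('k,'a) fv) \<Rightarrow> (int \<Rightarrow> ('k,'a) fv))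
   \<Rightarrow> ((int \<Rightarrow> ('k,'a) fv) \<Rightarrow> (int \<Rightarrow> ('k,'a) fv)) \<Rightarrow> bool" where
  "quasi_iso RA TA DA RB TB DB f =
     (\<forall>n. (\<forall>y. TB n y \<and> modeq RB (DB y) 0 \<longrightarrow>
              (\<exists>x z. TA n x \<and> modeq RA (DA x) 0 \<and> TB (n + 1) z \<and> modeq RB (f x - y) (DB z))) \<and>
          (\<forall>x. TA n x \<and> modeq RA (DA x) 0 \<and> (\<exists>z. TB (n + 1) z \<and> modeq RB (f x) (DB z)) \<longrightarrow>
              (\<exists>w. TA (n + 1) w \<and> modeq RA x (DA w))))"

definition HP_proj_iso :: "('k::field \<Rightarrow> 'a::ab_group_add \<Rightarrow> 'a) \<Rightarrow> (nat \<Rightarrow> 'a set)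
    \<Rightarrow> (nat \<Rightarrow> 'a list \<Rightarrow> 'a) \<Rightarrow> bool" where
  "HP_proj_iso sc G m =
     quasi_iso (relgens sc G {0}) (tot G) (Dtot m)
               (relgens sc (G0 G) (N0 m G)) (tot (G0 G)) (Dtot (m0 m))
               pitot"

end

theory Submission
  imports Defs "HOL-Library.Poly_Mapping"
begin

text \<open>Filter \<open>CC(A)\<close> by the weight, that is, the sum of the degrees of the entries of a tensor. The operation
  \<open>m\<^sub>j\<close> changes the weight by \<open>j - 2\<close>, so the part lowering it most is \<open>m\<^sub>1\<close>, and over a field the
  \<open>m\<^sub>1\<close>-homology of tensors consists of tensors over \<open>H(A)\<close>. The next page is the periodic complex of the
  graded associative algebra \<open>H(A)\<close>. By Goodwillie's argument for the derivation multiplying by the degree, its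
  part of weight \<open>f > 0\<close> is acyclic: multiplication by \<open>f\<close> is homotopic to an operator of square zero.
  Its part of weight \<open>0\<close> is \<open>CC(H\<^sub>0(A))\<close>. A cycle whose weight \<open>0\<close> component dies on this page is therefore
  a boundary: one corrects it weight by weight, and the infinitely many corrections add up in the product total
  complex because each column receives only finitely many of them.\<close>

section \<open>Goodwillie's homotopy\<close>

text \<open>No spectral sequence is constructed: the pages are replaced by statements about one
  chain and its leading weight, so no convergence theorem enters. The page over \<open>H(A)\<close>
  is reached through a chain map on tensors, homotopic to the identity, that has values in tensors
  of cycles and kills boundaries. It stands in for the Kuenneth isomorphism, and in weight
  \<open>0\<close> it expresses that a class dies. Characteristic zero enters in three places:
  division by the tensor length contracts the rows, averaging over rotations reduces
  \<open>b\<^sup>2 = 0\<close> to invariant tensors, and division by the square of the weight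
  inverts what Goodwillie's homotopy yields. Two obstacles shape the encoding. Koszul signs would
  swamp every identity, so all operations are generated by one rotation and by application at the
  front. Tensor powers are formal sums modulo relations, so identities are stated for operators
  compatible with a fixed linear choice of representatives, and chains must at times be exchanged
  for equivalent ones supported on lists of the correct degree.\<close>

text \<open>In the application \<open>q\<close> projects onto the tensors, \<open>la\<close> is \<open>\<lambda>\<close>, \<open>M\<close> divides by the tensor length,
  \<open>b\<close> and \<open>bp\<close> come from \<open>m\<^sub>2\<close>, \<open>F\<close> multiplies by the total degree and \<open>be\<close> by the degree of the first entry,
  and \<open>sg\<close> contracts the rows \<open>1 - \<lambda>\<close>, \<open>N\<close>.\<close>

locale periodic_ops =
  fixes q la N M sg b bp be F :: "'v::ab_group_add \<Rightarrow> 'v"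
  assumes add: "q (x + y) = q x + q y" "la (x + y) = la x + la y" "N (x + y) = N x + N y"
      "M (x + y) = M x + M y" "sg (x + y) = sg x + sg y" "b (x + y) = b x + b y"
      "bp (x + y) = bp x + bp y" "be (x + y) = be x + be y" "F (x + y) = F x + F y"
    and q_left: "q (la x) = la x" "q (N x) = N x" "q (M x) = M x" "q (sg x) = sg x"
      "q (b x) = b x" "q (bp x) = bp x" "q (be x) = be x" "q (F x) = F x"
    and q_right: "la (q x) = la x" "N (q x) = N x" "M (q x) = M x" "sg (q x) = sg x"
      "b (q x) = b x" "bp (q x) = bp x" "be (q x) = be x" "F (q x) = F x"
    and F_comm: "la (F x) = F (la x)" "N (F x) = F (N x)" "M (F x) = F (M x)"
      "sg (F x) = F (sg x)" "b (F x) = F (b x)" "bp (F x) = F (bp x)" "be (F x) = F (be x)"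
    and la_N: "la (N x) = N x" and N_la: "N (la x) = N x"
    and la_sg: "la (sg x) = sg x - q x + N (M x)"
    and sg_la: "sg (la x) = sg x - q x + N (M x)"
    and M_la: "M (la x) = la (M x)" and M_N: "M (N x) = N (M x)" and N_N_M: "N (N (M x)) = N x"
    and b_la: "b (la x) = b x - bp x + la (bp x)"
    and bp_N: "bp (N x) = N (b x)"
    and bp_bp: "bp (bp x) = 0" and b_b: "b (b x) = 0"
    and N_be_N: "N (be (N x)) = F (N x)"
    and b_be_N: "b (be (N x)) = be (N (b x))"
begin

lemma zero: "q 0 = 0" "la 0 = 0" "N 0 = 0" "M 0 = 0" "sg 0 = 0" "b 0 = 0" "bp 0 = 0" "be 0 = 0" "F 0 = 0"
  using add[of 0 0] by auto

lemma minus: "q (- x) = - q x" "la (- x) = - la x" "N (- x) = - N x" "M (- x) = - M x"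
  "sg (- x) = - sg x" "b (- x) = - b x" "bp (- x) = - bp x" "be (- x) = - be x" "F (- x) = - F x"
  using add[of x "- x"] zero by (simp_all add: eq_neg_iff_add_eq_0 add.commute)

lemma diff: "q (x - y) = q x - q y" "la (x - y) = la x - la y" "N (x - y) = N x - N y"
  "M (x - y) = M x - M y" "sg (x - y) = sg x - sg y" "b (x - y) = b x - b y"
  "bp (x - y) = bp x - bp y" "be (x - y) = be x - be y" "F (x - y) = F x - F y"
  using add[of x "- y"] minus[of y] by simp_all

lemmas lin = add zero minus diff q_left q_right

text \<open>Designed to solve \<open>(1 - \<lambda>) al = F - be N\<close> and
  \<open>al (1 - \<lambda>) = F - N be\<close> at once. \<open>sg\<close> inverts
  \<open>1 - \<lambda>\<close> on elements killed by \<open>N\<close>, and \<open>F - be N\<close>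
  takes values there because \<open>N be N = F N\<close>; the summand with \<open>be sg\<close>
  serves the second equation.\<close>

definition al where "al x = sg (F x - be (N x)) + F (N (M x)) - N (be (sg x))"

text \<open>A provisional solution of \<open>ga (1 - \<lambda>) = be bp - b be\<close>:
  \<open>sg (1 - \<lambda>)\<close> is the identity up to averaging, and the right-hand side
  vanishes on averages.\<close>

definition ga where "ga x = be (bp (sg x)) - b (be (sg x))"

text \<open>The failure of \<open>ga\<close> in the remaining equation
  \<open>N ga = bp al - al b\<close>. It is unchanged by \<open>\<lambda>\<close> on either side, so
  \<open>N M\<close> fixes its values, and subtracting \<open>M rr\<close> repairs this equation
  without disturbing the previous one.\<close>

definition rr where "rr x = al (b x) - bp (al x) + N (ga x)"

definition gam where "gam x = ga x - M (rr x)"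

definition ww where "ww x = b (gam x) + gam (b x)"

lemma N_M_be_N: "N (M (be (N x))) = F (N (M x))"
  using M_N[of "be (N x)"] by (simp add: N_be_N F_comm M_N)

lemma al_la: "al x - al (la x) = F x - N (be x)"
  unfolding al_def by (simp add: lin F_comm la_N N_la la_sg sg_la M_la M_N N_N_M N_be_N N_M_be_N algebra_simps)

lemma la_al: "al x - la (al x) = F x - be (N x)"
  unfolding al_def by (simp add: lin F_comm la_N N_la la_sg sg_la M_la M_N N_N_M N_be_N N_M_be_N algebra_simps)

lemma ga_la: "ga x - ga (la x) = be (bp x) - b (be x)"
  unfolding ga_def
  by (simp add: lin F_comm la_N N_la la_sg sg_la M_N N_N_M N_be_N bp_N b_be_N algebra_simps)

lemma op_lin: "al (x + y) = al x + al y" "al (x - y) = al x - al y"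
  "ga (x + y) = ga x + ga y" "ga (x - y) = ga x - ga y"
  unfolding al_def ga_def by (simp_all add: lin)

lemma q_op: "q (al x) = al x" "q (ga x) = ga x" "al (q x) = al x" "ga (q x) = ga x"
  unfolding al_def ga_def by (simp_all add: lin)

lemma F_op: "al (F x) = F (al x)" "ga (F x) = F (ga x)"
  unfolding al_def ga_def by (simp_all add: lin F_comm)

lemma rr_la: "rr x = rr (la x)"
proof -
  have "rr x - rr (la x) = (al (bp x) - al (la (bp x))) - bp (al x - al (la x)) + N (ga x - ga (la x))"
    unfolding rr_def by (simp add: b_la op_lin lin)
  also have "\<dots> = 0"
    unfolding al_la ga_la by (simp add: lin F_comm bp_N algebra_simps)
  finally show ?thesis by simp
qed

lemma la_rr: "la (rr x) = rr x"
proof -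
  have "b (al x) - b (la (al x)) = bp (al x) - la (bp (al x))" by (simp add: b_la)
  then have "rr x - la (rr x) = (al (b x) - la (al (b x))) - b (al x - la (al x))"
    unfolding rr_def by (simp add: lin la_N)
  also have "\<dots> = 0"
    unfolding la_al by (simp add: lin F_comm b_be_N)
  finally show ?thesis by simp
qed

lemma q_rr: "q (rr x) = rr x" "rr (x + y) = rr x + rr y" "rr (x - y) = rr x - rr y" "rr (F x) = F (rr x)"
  "rr (q x) = rr x"
  unfolding rr_def by (simp_all add: lin op_lin q_op F_op F_comm)

lemma N_M_rr: "N (M (rr x)) = rr x"
  using la_sg[of "rr x"] sg_la[of "rr x"] by (simp add: la_rr q_rr)

lemma gam_la: "gam x - gam (la x) = be (bp x) - b (be x)"
  unfolding gam_def using ga_la[of x] by (simp add: rr_la[symmetric])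

lemma N_gam: "N (gam x) = bp (al x) - al (b x)"
  unfolding gam_def by (simp add: lin N_M_rr) (simp add: rr_def)

lemma gam_lin: "gam (x + y) = gam x + gam y" "gam (x - y) = gam x - gam y" "gam (F x) = F (gam x)"
  "q (gam x) = gam x" "gam (q x) = gam x"
  unfolding gam_def by (simp_all add: lin op_lin q_rr F_op F_comm q_op)

lemma gam_zero: "gam 0 = 0" "al 0 = 0"
  using gam_lin(1)[of 0 0] op_lin(1)[of 0 0] by auto

lemma ww_lin: "ww (x + y) = ww x + ww y" "ww (x - y) = ww x - ww y" "ww (F x) = F (ww x)"
  "q (ww x) = ww x" "ww (q x) = ww x"
  unfolding ww_def by (simp_all add: lin gam_lin F_comm)

lemma ww_la: "ww x = ww (la x)"
proof -
  have "ww x - ww (la x) = b (gam x - gam (la x)) + (gam (bp x) - gam (la (bp x)))"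
    unfolding ww_def by (simp add: b_la lin gam_lin)
  also have "\<dots> = 0"
    unfolding gam_la by (simp add: lin b_b bp_bp)
  finally show ?thesis by simp
qed

lemma N_ww: "N (ww x) = 0"
proof -
  have "N (ww x) = bp (N (gam x)) + N (gam (b x))"
    unfolding ww_def by (simp add: lin bp_N)
  then show ?thesis by (simp add: N_gam lin bp_bp b_b gam_zero)
qed

text \<open>\<open>ww\<close> vanishes on the image of \<open>1 - \<lambda>\<close>, and its own
  values lie in that image because \<open>N\<close> kills them.\<close>

lemma ww_ww: "ww (ww x) = 0"
proof -
  have "ww x = sg (ww x) - la (sg (ww x))"
    by (simp add: la_sg ww_lin)
      (metis M_N N_ww zero(4))
  then have "ww (ww x) = ww (sg (ww x)) - ww (la (sg (ww x)))" by (metis ww_lin(2))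
  then show ?thesis using ww_la by simp
qed

text \<open>Goodwillie's homotopy formula: \<^term>\<open>be\<close>, \<^term>\<open>al\<close> and \<^term>\<open>gam\<close> are the components of a
  homotopy between \<^term>\<open>F\<close> and minus the square-zero operator \<^term>\<open>ww\<close>.\<close>

definition dd :: "(int \<Rightarrow> 'v) \<Rightarrow> int \<Rightarrow> 'v" where
  "dd x p = (if even p then b (x p) + (x (p + 1) - la (x (p + 1))) else - bp (x p) + N (x (p + 1)))"

definition hh :: "(int \<Rightarrow> 'v) \<Rightarrow> int \<Rightarrow> 'v" where
  "hh x p = (if even p then be (x (p - 1)) + gam (x (p - 2)) else al (x (p - 1)))"

text \<open>Restricting to cycles lets the cycle equations replace \<open>b\<close> and
  \<open>bp\<close> of one column by horizontal maps of the next, so that the composite of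
  \<open>hh\<close> after \<open>dd\<close> never has to be written down.\<close>

lemma dd_hh:
  assumes cyc: "\<And>p. dd x p = 0"
  shows "dd (hh x) p = F (x p) + (if even p then ww (x (p - 2)) else 0)"
proof -
  have ev: "b (x r) = la (x (r + 1)) - x (r + 1)" if "even r" for r
    using cyc[of r] that by (simp add: dd_def add_eq_0_iff algebra_simps)
  have od: "bp (x r) = N (x (r + 1))" if "odd r" for r
    using cyc[of r] that by (simp add: dd_def add_eq_0_iff)
  show ?thesis
  proof (cases "even p")
    case True
    have 1: "bp (x (p - 1)) = N (x p)" using od[of "p - 1"] True by simp
    have 2: "b (x (p - 2)) = la (x (p - 1)) - x (p - 1)" using ev[of "p - 2"] True by simp
    have "dd (hh x) p = b (be (x (p - 1))) + b (gam (x (p - 2))) + (al (x p) - la (al (x p)))"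
      using True by (simp add: dd_def hh_def lin)
    also have "\<dots> = b (be (x (p - 1))) + b (gam (x (p - 2))) + F (x p) - be (bp (x (p - 1)))"
      by (simp add: la_al 1)
    also have "\<dots> = F (x p) + b (gam (x (p - 2))) - (gam (x (p - 1)) - gam (la (x (p - 1))))"
      by (simp add: gam_la)
    also have "\<dots> = F (x p) + ww (x (p - 2))"
      unfolding ww_def 2 by (simp add: gam_lin)
    finally show ?thesis using True by simp
  next
    case False
    have 2: "b (x (p - 1)) = la (x p) - x p" using ev[of "p - 1"] False by simp
    have "dd (hh x) p = - bp (al (x (p - 1))) + N (be (x p)) + N (gam (x (p - 1)))"
      using False by (simp add: dd_def hh_def lin)
    also have "\<dots> = N (be (x p)) - al (b (x (p - 1)))"
      by (simp add: N_gam)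
    also have "\<dots> = N (be (x p)) + (al (x p) - al (la (x p)))"
      unfolding 2 by (simp add: op_lin)
    also have "\<dots> = F (x p)" by (simp add: al_la)
    finally show ?thesis using False by simp
  qed
qed

text \<open>Together with \<open>N_ww\<close> this makes \<open>ww\<close> of the even columns,
  extended by zero to the odd ones, a cycle, so that the homotopy can be applied to it a second
  time.\<close>

lemma b_ww:
  assumes cyc: "\<And>p. dd x p = 0" and p: "even p"
  shows "b (ww (x p)) = 0"
proof -
  have 1: "b (x p) = la (x (p + 1)) - x (p + 1)"
    using cyc[of p] p by (simp add: dd_def add_eq_0_iff algebra_simps)
  have 2: "bp (x (p + 1)) = N (x (p + 2))"
    using cyc[of "p + 1"] p by (simp add: dd_def add_eq_0_iff add.assoc)
  have 3: "b (x (p + 2)) = la (x (p + 3)) - x (p + 3)"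
    using cyc[of "p + 2"] p by (simp add: dd_def add_eq_0_iff algebra_simps)
  have "b (ww (x p)) = - b (gam (x (p + 1)) - gam (la (x (p + 1))))"
    unfolding ww_def 1 by (simp add: lin gam_lin b_b)
  also have "\<dots> = - b (be (N (x (p + 2))))"
    unfolding gam_la by (simp add: lin b_b 2)
  also have "\<dots> = 0" unfolding b_be_N 3 by (simp add: lin N_la)
  finally show ?thesis .
qed

text \<open>The homotopy applied to \<open>F t\<close> overshoots by \<open>F (ww t)\<close>, two
  columns over. Applied to \<open>ww t\<close> it gives exactly that error, as \<open>ww\<close>
  squares to zero, and the difference is \<open>F (F t)\<close>.\<close>

theorem dd_surj:
  assumes cyc: "\<And>p. dd t p = 0"
  shows "\<exists>w. \<forall>p. dd w p = F (F (t p)) \<and> q (w p) = w p"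
proof -
  define v where "v p = (if even p then ww (t (p - 2)) else 0)" for p
  define z where "z p = F (t p)" for p
  have zc: "dd z p = 0" for p
    using arg_cong[OF cyc[of p], of F] by (auto simp: dd_def z_def lin F_comm split: if_splits)
  have vc: "dd v p = 0" for p
    using b_ww[OF cyc, of "p - 2"] N_ww by (auto simp: dd_def v_def lin)
  define w where "w p = hh z p - hh v p" for p
  have "dd w p = dd (hh z) p - dd (hh v) p" for p
    unfolding w_def dd_def by (auto simp: lin)
  then have "dd w p = F (F (t p))" for p
    unfolding dd_hh[OF zc] dd_hh[OF vc] by (auto simp: z_def v_def ww_lin ww_ww lin)
  moreover have "q (w p) = w p" for p
    unfolding w_def hh_def by (auto simp: lin gam_lin q_op)
  ultimately show ?thesis by blast
qed

end

section \<open>Tensor powers of graded vector spaces given by relations\<close>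

type_synonym ('k,'a) ev = "'a hlist \<Rightarrow>\<^sub>0 'k"

abbreviation (input) lookup where "lookup \<equiv> Poly_Mapping.lookup"
abbreviation (input) keys where "keys \<equiv> Poly_Mapping.keys"

definition gn :: "'a hlist \<Rightarrow> ('k::field,'a) ev" where
  "gn xs = Poly_Mapping.single xs 1"

definition scal :: "'k::field \<Rightarrow> ('k,'a) ev \<Rightarrow> ('k,'a) ev" where
  "scal c x = Poly_Mapping.map ((*) c) x"

lemma lookup_scal [simp]: "lookup (scal c x) g = c * lookup x g"
  by (simp add: scal_def Poly_Mapping.map.rep_eq when_def)

lemma lookup_gn: "lookup (gn xs) ys = (if xs = ys then 1 else 0)"
  by (simp add: gn_def lookup_single when_def)

global_interpretation ev: vector_space "scal :: 'k::field \<Rightarrow> ('k,'a) ev \<Rightarrow> _"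
  by unfold_locales (auto intro!: poly_mapping_eqI simp: lookup_add algebra_simps)

global_interpretation evp: vector_space_pair "scal :: 'k::field \<Rightarrow> ('k,'a) ev \<Rightarrow> _" "scal :: 'k::field \<Rightarrow> ('k,'a) ev \<Rightarrow> _"
  ..

definition ext :: "('a hlist \<Rightarrow> ('k::field,'a) ev) \<Rightarrow> ('k,'a) ev \<Rightarrow> ('k,'a) ev" where
  "ext F x = (\<Sum>g\<in>keys x. scal (lookup x g) (F g))"

lemma ext_superset: "finite A \<Longrightarrow> keys x \<subseteq> A \<Longrightarrow> ext F x = (\<Sum>g\<in>A. scal (lookup x g) (F g))"
  unfolding ext_def by (rule sum.mono_neutral_left) (auto simp: in_keys_iff)

lemma ext_gn [simp]: "ext F (gn xs) = F xs"
  by (subst ext_superset[of "{xs}"]) (auto simp: gn_def)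

definition lop :: "(('k::field,'a) ev \<Rightarrow> ('k,'a) ev) \<Rightarrow> bool" where
  "lop A \<longleftrightarrow> (\<forall>x y. A (x + y) = A x + A y) \<and> (\<forall>c x. A (scal c x) = scal c (A x))"

lemma lop_add: "lop A \<Longrightarrow> A (x + y) = A x + A y"
  and lop_scal: "lop A \<Longrightarrow> A (scal c x) = scal c (A x)"
  unfolding lop_def by auto

lemma lop_zero: "lop A \<Longrightarrow> A 0 = 0"
  using lop_scal[of A 0 0] by simp

lemma lop_minus: "lop A \<Longrightarrow> A (- x) = - A x"
  using lop_scal[of A "-1" x] by simp

lemma lop_diff: "lop A \<Longrightarrow> A (x - y) = A x - A y"
  using lop_add[of A x "- y"] lop_minus[of A y] by simp

lemma lop_sum: "lop A \<Longrightarrow> A (sum f I) = (\<Sum>i\<in>I. A (f i))"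
  by (induction I rule: infinite_finite_induct) (auto simp: lop_add lop_zero)

lemmas lop_simps = lop_add lop_scal lop_zero lop_minus lop_diff lop_sum

lemma lop_ext: "lop (ext (F :: 'a hlist \<Rightarrow> ('k::field,'a) ev))"
  unfolding lop_def
proof (intro conjI allI)
  fix x y :: "('k,'a) ev"
  have "keys (x + y) \<subseteq> keys x \<union> keys y" by (rule keys_add)
  then show "ext F (x + y) = ext F x + ext F y"
    by (simp add: ext_superset[of "keys x \<union> keys y"] lookup_add ev.scale_left_distrib sum.distrib)
next
  fix c and x :: "('k,'a) ev"
  have "keys (scal c x) \<subseteq> keys x" by (auto simp: in_keys_iff)
  then show "ext F (scal c x) = scal c (ext F x)"
    by (simp add: ext_superset[of "keys x"] ev.scale_sum_right)
qed

lemmas ext_simps = lop_simps[OF lop_ext]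

lemma lop_comp: "lop A \<Longrightarrow> lop B \<Longrightarrow> lop (\<lambda>x. A (B x))"
  and lop_plus: "lop A \<Longrightarrow> lop B \<Longrightarrow> lop (\<lambda>x. A x + B x)"
  and lop_sub: "lop A \<Longrightarrow> lop B \<Longrightarrow> lop (\<lambda>x. A x - B x)"
  and lop_neg: "lop A \<Longrightarrow> lop (\<lambda>x. - A x)"
  and lop_smult: "lop A \<Longrightarrow> lop (\<lambda>x. scal c (A x))"
  and lop_id: "lop (\<lambda>x. x)"
  and lop_0: "lop (\<lambda>x. 0)"
  unfolding lop_def by (simp_all add: algebra_simps)

lemma lop_Sum: "(\<And>i. i \<in> I \<Longrightarrow> lop (A i)) \<Longrightarrow> lop (\<lambda>x. \<Sum>i\<in>I. A i x)"
  by (induction I rule: infinite_finite_induct) (auto intro: lop_plus lop_0)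

lemma lop_funpow: "lop A \<Longrightarrow> lop (A ^^ n)"
  by (induction n) (auto simp: comp_def id_def intro: lop_comp lop_id)

lemma ev_decomp: "x = (\<Sum>g\<in>keys x. scal (lookup x g) (gn g))"
proof (rule poly_mapping_eqI)
  fix k
  show "lookup x k = lookup (\<Sum>g\<in>keys x. scal (lookup x g) (gn g)) k"
    by (simp add: lookup_sum lookup_gn if_distrib[of "(*) _"] sum.delta in_keys_iff cong: if_cong)
qed

lemma lop_eqI:
  assumes "lop A" "lop B" "\<And>g. g \<in> keys x \<Longrightarrow> A (gn g) = B (gn g)"
  shows "A x = B x"
  by (subst (1 2) ev_decomp[of x]) (simp add: assms lop_sum lop_scal)

lemma keys_ext: "keys (ext F x) \<subseteq> (\<Union>g\<in>keys x. keys (F g))"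
proof
  fix k assume "k \<in> keys (ext F x)"
  then have "(\<Sum>g\<in>keys x. lookup x g * lookup (F g) k) \<noteq> 0"
    by (simp add: ext_def in_keys_iff lookup_sum)
  then obtain g where "g \<in> keys x" "lookup x g * lookup (F g) k \<noteq> 0"
    by (meson sum.neutral)
  then show "k \<in> (\<Union>g\<in>keys x. keys (F g))" by (auto simp: in_keys_iff)
qed

lemma lop_in_subspace:
  assumes "lop A" "ev.subspace S" "\<And>g. g \<in> keys x \<Longrightarrow> A (gn g) \<in> S"
  shows "A x \<in> S"
proof -
  have "A x = (\<Sum>g\<in>keys x. scal (lookup x g) (A (gn g)))"
    by (subst ev_decomp[of x]) (simp add: assms lop_sum lop_scal)
  then show ?thesis using assms by (auto intro!: ev.subspace_sum ev.subspace_scale)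
qed

lemma lop_span:
  assumes "lop A" "ev.subspace S" "\<And>x. x \<in> X \<Longrightarrow> A x \<in> S" "x \<in> ev.span X"
  shows "A x \<in> S"
  using assms(4)
proof (induction rule: ev.span_induct_alt)
  case base then show ?case using assms by (simp add: lop_zero ev.subspace_0)
next
  case (step c x y)
  then show ?case using assms
    by (simp add: lop_add lop_scal ev.subspace_add ev.subspace_scale)
qed

text \<open>A basis of \<open>V\<close> is extended to the whole space and its members are sent to
  zero. The resulting linear choice of representatives turns congruences modulo \<open>V\<close>
  into equations.\<close>

lemma exists_projection:
  assumes V: "ev.subspace (V :: ('k::field,'a) ev set)"
  shows "\<exists>Q. lop Q \<and> (\<forall>x. Q x = 0 \<longleftrightarrow> x \<in> V) \<and> (\<forall>x. x - Q x \<in> V)"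
proof -
  obtain B where B: "B \<subseteq> V" "ev.independent B" "V \<subseteq> ev.span B"
    using ev.maximal_independent_subset[of V] by blast
  have sB: "ev.span B = V" using B V by (metis ev.span_subspace)
  define E where "E = ev.extend_basis B"
  have E: "B \<subseteq> E" "ev.independent E" "ev.span E = UNIV"
    using ev.extend_basis_superset[OF B(2)] ev.independent_extend_basis[OF B(2)]
      ev.span_extend_basis[OF B(2)] by (auto simp: E_def)
  define Q where "Q = evp.construct E (\<lambda>b. if b \<in> B then 0 else b)"
  have L: "Vector_Spaces.linear scal scal Q"
    unfolding Q_def by (rule evp.linear_construct[OF E(2)])
  then have lQ: "lop Q"
    by (simp add: lop_def Vector_Spaces.linear_iff)
  have QE: "b \<in> E \<Longrightarrow> Q b = (if b \<in> B then 0 else b)" for b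
    unfolding Q_def by (rule evp.construct_basis[OF E(2)])
  have 1: "x - Q x \<in> V" for x
  proof -
    have "x \<in> ev.span E" using E by simp
    then show ?thesis
    proof (rule lop_span[of "\<lambda>x. x - Q x", rotated 3])
      show "lop (\<lambda>x. x - Q x)" by (intro lop_sub lop_id lQ)
      show "b - Q b \<in> V" if "b \<in> E" for b
        using QE[OF that] B(1) ev.subspace_0[OF V] by auto
    qed (rule V)
  qed
  have "Q x \<in> {0}" if "x \<in> V" for x
  proof (rule lop_span[OF lQ])
    show "x \<in> ev.span B" using that sB by simp
    show "Q b \<in> {0}" if "b \<in> B" for b using QE[of b] E(1) that by auto
  qed auto
  then show ?thesis using 1 lQ by (metis diff_zero singletonD)
qed

text \<open>Tensors over the quotients \<open>G d / Nd d\<close> are represented by formal sums of lists, and \<open>Q\<close> is a linear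
  projector whose kernel is spanned by the relations. Invalid lists and the empty list are also sent to \<open>0\<close>, so that
  the operators on the quotient, which are those satisfying \<open>wop\<close>, obey their identities unconditionally.\<close>

locale graded_presentation =
  fixes sc :: "'k::field_char_0 \<Rightarrow> 'a::ab_group_add \<Rightarrow> 'a"
    and G :: "nat \<Rightarrow> 'a set"
    and Nd :: "nat \<Rightarrow> 'a set"
  assumes sc: "vector_space sc"
    and G_zero: "0 \<in> G d"
    and G_add: "a \<in> G d \<Longrightarrow> b \<in> G d \<Longrightarrow> a + b \<in> G d"
    and G_scale: "a \<in> G d \<Longrightarrow> sc c a \<in> G d"
begin

sublocale scv: vector_space sc by (rule sc)

definition vl :: "'a hlist \<Rightarrow> bool" where
  "vl xs \<longleftrightarrow> valid G xs \<and> xs \<noteq> []"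

definition RL :: "('k,'a) ev set" where
  "RL = {gn (xs @ (d, sc c a + b) # ys) - scal c (gn (xs @ (d, a) # ys)) - gn (xs @ (d, b) # ys) | xs ys d a b c.
     valid G xs \<and> valid G ys \<and> a \<in> G d \<and> b \<in> G d}"

definition RN :: "('k,'a) ev set" where
  "RN = {gn (xs @ (d, a) # ys) | xs ys d a. valid G xs \<and> valid G ys \<and> a \<in> G d \<and> a \<in> Nd d}"

definition V :: "('k,'a) ev set" where
  "V = ev.span (RL \<union> RN \<union> {gn xs | xs. \<not> vl xs})"

definition Q :: "('k,'a) ev \<Rightarrow> ('k,'a) ev" where
  "Q = (SOME Q. lop Q \<and> (\<forall>x. Q x = 0 \<longleftrightarrow> x \<in> V) \<and> (\<forall>x. x - Q x \<in> V))"

lemma Q_spec: "lop Q \<and> (\<forall>x. Q x = 0 \<longleftrightarrow> x \<in> V) \<and> (\<forall>x. x - Q x \<in> V)"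
  using someI_ex[OF exists_projection[of V]] unfolding Q_def[symmetric] by (simp add: V_def)

lemma lop_Q: "lop Q" and Q_eq_0: "Q x = 0 \<longleftrightarrow> x \<in> V" and Q_diff: "x - Q x \<in> V"
  using Q_spec by auto

lemma Q_Q [simp]: "Q (Q x) = Q x"
  using Q_diff[of x] Q_eq_0[of "x - Q x"] by (simp add: lop_diff[OF lop_Q])

lemma valid_simps [simp]: "valid G []" "valid G (p # xs) \<longleftrightarrow> snd p \<in> G (fst p) \<and> valid G xs"
  "valid G (xs @ ys) \<longleftrightarrow> valid G xs \<and> valid G ys"
  by (auto simp: valid_def)

lemma Q_lin:
  assumes "valid G xs" "valid G ys" "a \<in> G d" "b \<in> G d"
  shows "Q (gn (xs @ (d, sc c a + b) # ys)) = scal c (Q (gn (xs @ (d, a) # ys))) + Q (gn (xs @ (d, b) # ys))"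
proof -
  have "gn (xs @ (d, sc c a + b) # ys) - scal c (gn (xs @ (d, a) # ys)) - gn (xs @ (d, b) # ys) \<in> V"
    unfolding V_def RL_def using assms by (intro ev.span_base UnI1 CollectI) blast
  then show ?thesis unfolding Q_eq_0[symmetric] by (simp add: lop_diff[OF lop_Q] lop_scal[OF lop_Q] diff_eq_eq add.commute)
qed

lemma Q_invalid: "\<not> vl xs \<Longrightarrow> Q (gn xs) = 0"
  unfolding Q_eq_0 V_def by (intro ev.span_base UnI2 CollectI) blast

lemma Q_N:
  "valid G xs \<Longrightarrow> valid G ys \<Longrightarrow> a \<in> G d \<Longrightarrow> a \<in> Nd d \<Longrightarrow> Q (gn (xs @ (d, a) # ys)) = 0"
  unfolding Q_eq_0 V_def RN_def by (intro ev.span_base UnI1 UnI2 CollectI) blast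

lemma Q_add:
  assumes "valid G xs" "valid G ys" "a \<in> G d" "b \<in> G d"
  shows "Q (gn (xs @ (d, a + b) # ys)) = Q (gn (xs @ (d, a) # ys)) + Q (gn (xs @ (d, b) # ys))"
  using Q_lin[OF assms, of 1] by simp

lemma Q_zero: "valid G xs \<Longrightarrow> valid G ys \<Longrightarrow> Q (gn (xs @ (d, 0) # ys)) = 0"
  using Q_add[of xs ys 0 d 0] by (simp add: G_zero)

definition wop :: "(('k,'a) ev \<Rightarrow> ('k,'a) ev) \<Rightarrow> bool" where
  "wop A \<longleftrightarrow> lop A \<and> (\<forall>x. A (Q x) = A x) \<and> (\<forall>x. Q (A x) = A x)"

lemma wop_lop: "wop A \<Longrightarrow> lop A" and wop_Q: "wop A \<Longrightarrow> A (Q x) = A x"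
  and Q_wop: "wop A \<Longrightarrow> Q (A x) = A x"
  unfolding wop_def by auto

lemma wop_id: "wop Q" unfolding wop_def by (simp add: lop_Q)

lemma wop_comp: "wop A \<Longrightarrow> wop B \<Longrightarrow> wop (\<lambda>x. A (B x))"
  and wop_plus: "wop A \<Longrightarrow> wop B \<Longrightarrow> wop (\<lambda>x. A x + B x)"
  and wop_sub: "wop A \<Longrightarrow> wop B \<Longrightarrow> wop (\<lambda>x. A x - B x)"
  and wop_neg: "wop A \<Longrightarrow> wop (\<lambda>x. - A x)"
  and wop_smult: "wop A \<Longrightarrow> wop (\<lambda>x. scal c (A x))"
  and wop_0: "wop (\<lambda>x. 0)"
  unfolding wop_def
  by (auto intro: lop_comp lop_plus lop_sub lop_neg lop_smult lop_0
      simp: lop_add[OF lop_Q] lop_diff[OF lop_Q] lop_scal[OF lop_Q] lop_zero[OF lop_Q] lop_minus[OF lop_Q])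

lemma wop_Sum: "(\<And>i. i \<in> I \<Longrightarrow> wop (A i)) \<Longrightarrow> wop (\<lambda>x. \<Sum>i\<in>I. A i x)"
  by (induction I rule: infinite_finite_induct) (auto intro: wop_plus wop_0)

lemma wop_funpow: "wop A \<Longrightarrow> wop (\<lambda>x. (A ^^ n) (Q x))"
  by (induction n) (auto intro: wop_id wop_comp)

lemma wop_V: "wop A \<Longrightarrow> x \<in> V \<Longrightarrow> A x = 0"
  using wop_Q[of A x] by (simp add: Q_eq_0[symmetric] lop_zero[OF wop_lop])

lemma wop_invalid: "wop A \<Longrightarrow> \<not> vl xs \<Longrightarrow> A (gn xs) = 0"
  by (metis Q_invalid Q_eq_0 wop_V)

lemma wop_eqI:
  assumes "wop A" "wop B" "\<And>xs. vl xs \<Longrightarrow> A (gn xs) = B (gn xs)"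
  shows "A x = B x"
  by (rule lop_eqI) (use assms wop_invalid in \<open>auto simp: wop_lop, metis\<close>)

definition opr :: "('a hlist \<Rightarrow> ('k,'a) ev) \<Rightarrow> ('k,'a) ev \<Rightarrow> ('k,'a) ev" where
  "opr F x = Q (ext (\<lambda>xs. if vl xs then F xs else 0) x)"

lemma opr_gn: "vl xs \<Longrightarrow> opr F (gn xs) = Q (F xs)"
  by (simp add: opr_def)

lemma vl_split: "vl (xs @ (d, a) # ys) \<longleftrightarrow> valid G xs \<and> a \<in> G d \<and> valid G ys"
  by (auto simp: vl_def)

text \<open>The universal property of the tensor powers: it suffices to check linearity in each slot
  and that null entries are killed.\<close>

lemma wop_opr:
  assumes lin: "\<And>xs ys d a b c. valid G xs \<Longrightarrow> valid G ys \<Longrightarrow> a \<in> G d \<Longrightarrow> b \<in> G d \<Longrightarrow>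
      Q (F (xs @ (d, sc c a + b) # ys)) = scal c (Q (F (xs @ (d, a) # ys))) + Q (F (xs @ (d, b) # ys))"
    and nul: "\<And>xs ys d a. valid G xs \<Longrightarrow> valid G ys \<Longrightarrow> a \<in> G d \<Longrightarrow> a \<in> Nd d \<Longrightarrow>
      Q (F (xs @ (d, a) # ys)) = 0"
  shows "wop (opr F)"
proof -
  have l: "lop (opr F)" unfolding opr_def by (intro lop_comp[OF lop_Q] lop_ext)
  have "opr F x = 0" if "x \<in> V" for x
  proof -
    have "opr F x \<in> {0}"
      using that unfolding V_def
    proof (rule lop_span[OF l, rotated 2])
      fix x assume "x \<in> RL \<union> RN \<union> {gn xs |xs. \<not> vl xs}"
      then show "opr F x \<in> {0}"
        unfolding RL_def RN_def
        by (auto simp: lop_diff[OF l] lop_scal[OF l] opr_gn vl_split lin nul G_add G_scale)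
          (auto simp: opr_def lop_zero[OF lop_Q])
    qed auto
    then show ?thesis by simp
  qed
  then have "opr F (Q x) = opr F x" for x
    using Q_diff[of x] by (metis eq_iff_diff_eq_0 lop_diff[OF l])
  then show ?thesis unfolding wop_def using l by (simp add: opr_def)
qed

text \<open>Glues formulas that depend on the tensor length, such as a sum over all rotations, into
  one operator on tensors of every length.\<close>

definition fam :: "(nat \<Rightarrow> ('k,'a) ev \<Rightarrow> ('k,'a) ev) \<Rightarrow> ('k,'a) ev \<Rightarrow> ('k,'a) ev" where
  "fam A = opr (\<lambda>xs. A (length xs) (gn xs))"

lemma fam_gn: "vl xs \<Longrightarrow> (\<And>L. wop (A L)) \<Longrightarrow> fam A (gn xs) = A (length xs) (gn xs)"
  unfolding fam_def by (simp add: opr_gn Q_wop)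

lemma wop_fam: 
  assumes "\<And>L. wop (A L)"
  shows "wop (fam A)"
  unfolding fam_def
proof (rule wop_opr)
  fix xs ys d a b c
  assume *: "valid G xs" "valid G ys" "a \<in> G d" "b \<in> G d"
  let ?L = "length (xs @ (d, sc c a + b) # ys)"
  have A: "lop (A ?L)" using assms by (simp add: wop_lop)
  have "A ?L (gn (xs @ (d, sc c a + b) # ys)) = A ?L (Q (gn (xs @ (d, sc c a + b) # ys)))"
    by (simp add: wop_Q assms)
  also have "\<dots> = scal c (A ?L (gn (xs @ (d, a) # ys))) + A ?L (gn (xs @ (d, b) # ys))"
    by (simp only: Q_lin[OF *] lop_add[OF A] lop_scal[OF A] wop_Q[OF assms])
  finally show "Q (A (length (xs @ (d, sc c a + b) # ys)) (gn (xs @ (d, sc c a + b) # ys))) =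
        scal c (Q (A (length (xs @ (d, a) # ys)) (gn (xs @ (d, a) # ys)))) +
        Q (A (length (xs @ (d, b) # ys)) (gn (xs @ (d, b) # ys)))"
    by (simp add: Q_wop assms lop_add[OF lop_Q] lop_scal[OF lop_Q])
next
  fix xs ys d a
  assume *: "valid G xs" "valid G ys" "a \<in> G d" "a \<in> Nd d"
  show "Q (A (length (xs @ (d, a) # ys)) (gn (xs @ (d, a) # ys))) = 0"
    using wop_Q[OF assms, of "length (xs @ (d, a) # ys)" "gn (xs @ (d, a) # ys)"] Q_N[OF *]
    by (simp add: Q_wop assms lop_zero[OF wop_lop] lop_zero[OF lop_Q])
qed

text \<open>Length, weight and the degree of a single entry all act through such diagonal operators,
  so their commutation rules reduce to identities between functions of degree lists.\<close>

definition dg :: "(nat list \<Rightarrow> 'k) \<Rightarrow> ('k,'a) ev \<Rightarrow> ('k,'a) ev" where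
  "dg \<phi> = opr (\<lambda>xs. scal (\<phi> (map fst xs)) (gn xs))"

lemma dg_gn: "vl xs \<Longrightarrow> dg \<phi> (gn xs) = scal (\<phi> (map fst xs)) (Q (gn xs))"
  unfolding dg_def by (simp add: opr_gn lop_scal[OF lop_Q])

lemma wop_dg: "wop (dg \<phi>)"
  unfolding dg_def
  by (rule wop_opr) (simp_all add: lop_scal[OF lop_Q] Q_lin Q_N ev.scale_right_distrib mult.commute)

lemma dg_Qgn: "vl xs \<Longrightarrow> dg \<phi> (Q (gn xs)) = scal (\<phi> (map fst xs)) (Q (gn xs))"
  by (simp add: wop_Q[OF wop_dg] dg_gn)

lemma dg_dg: "dg \<phi> (dg \<psi> x) = dg (\<lambda>ds. \<phi> ds * \<psi> ds) x"
  by (rule wop_eqI[where A="\<lambda>x. dg \<phi> (dg \<psi> x)"])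
    (auto intro: wop_comp[OF wop_dg wop_dg] wop_dg simp: dg_gn lop_scal[OF wop_lop[OF wop_dg]] dg_Qgn mult.commute)

end

lemma sdeg_simps [simp]: "sdeg [] = 0" "sdeg (p # xs) = fst p + 1 + sdeg xs" "sdeg (xs @ ys) = sdeg xs + sdeg ys"
  by (simp_all add: sdeg_def)

lemma sdeg_eq: "sdeg xs = sum_list (map fst xs) + length xs"
  by (induction xs) auto

lemma mapp_eq: "Defs.mapp m bs = (sdeg bs - 2, m (length bs) (map snd bs))"
  by (simp add: Defs.mapp_def sdeg_eq)

lemma rot_append [simp]: "length vs = s \<Longrightarrow> rot s (us @ vs) = vs @ us"
  by (auto simp: rot_def)

lemma rotsign_append: "length vs = s \<Longrightarrow> rotsign s (us @ vs) = (-1) ^ (sdeg us * sdeg vs)"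
  by (auto simp: rotsign_def mult.commute)

section \<open>Rotations and insertions\<close>

context graded_presentation
begin

definition la :: "('k,'a) ev \<Rightarrow> ('k,'a) ev" where
  "la = opr (\<lambda>xs. scal (rotsign 1 xs) (gn (rot 1 xs)))"

lemma wop_la: "wop la"
  unfolding la_def
proof (rule wop_opr)
  fix xs ys d a b c
  assume *: "valid G xs" "valid G ys" "a \<in> G d" "b \<in> G d"
  show "Q (scal (rotsign 1 (xs @ (d, sc c a + b) # ys)) (gn (rot 1 (xs @ (d, sc c a + b) # ys)))) =
        scal c (Q (scal (rotsign 1 (xs @ (d, a) # ys)) (gn (rot 1 (xs @ (d, a) # ys))))) +
        Q (scal (rotsign 1 (xs @ (d, b) # ys)) (gn (rot 1 (xs @ (d, b) # ys))))"
  proof (cases ys rule: rev_cases)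
    case Nil
    then show ?thesis using Q_lin[of "[]" xs a d b c] *
      by (simp add: rotsign_append lop_scal[OF lop_Q] ev.scale_right_distrib mult.commute)
  next
    case (snoc zs z)
    have "rot 1 (xs @ (d, a) # ys) = z # xs @ (d, a) # zs" for a
      using rot_append[of "[z]" 1 "xs @ (d, a) # zs"] snoc by simp
    moreover have "(rotsign 1 (xs @ (d, a) # ys) :: 'k) = (-1) ^ (sdeg (xs @ (d, a) # zs) * sdeg [z])" for a
      using rotsign_append[of "[z]" 1 "xs @ (d, a) # zs"] snoc by simp
    ultimately show ?thesis using Q_lin[of "z # xs" zs a d b c] * snoc
      by (simp add: lop_scal[OF lop_Q] ev.scale_right_distrib mult.commute del: One_nat_def)
  qed
next
  fix xs ys d a
  assume *: "valid G xs" "valid G ys" "a \<in> G d" "a \<in> Nd d"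
  show "Q (scal (rotsign 1 (xs @ (d, a) # ys)) (gn (rot 1 (xs @ (d, a) # ys)))) = 0"
  proof (cases ys rule: rev_cases)
    case Nil
    then show ?thesis using Q_N[of "[]" xs a d] * by (simp add: lop_scal[OF lop_Q])
  next
    case (snoc zs z)
    have "rot 1 (xs @ (d, a) # ys) = z # xs @ (d, a) # zs"
      using rot_append[of "[z]" 1 "xs @ (d, a) # zs"] snoc by simp
    then show ?thesis using Q_N[of "z # xs" zs a d] * snoc by (simp add: lop_scal[OF lop_Q])
  qed
qed

lemmas lop_la = wop_lop[OF wop_la]
lemmas la_simps = lop_simps[OF lop_la]
lemmas Qs = lop_add[OF lop_Q] lop_scal[OF lop_Q] lop_zero[OF lop_Q] lop_diff[OF lop_Q] lop_minus[OF lop_Q] lop_sum[OF lop_Q]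

lemma la_snoc: "vl (us @ [v]) \<Longrightarrow> la (gn (us @ [v])) = scal ((-1) ^ (sdeg us * sdeg [v])) (Q (gn (v # us)))"
  unfolding la_def by (simp add: opr_gn Qs rotsign_append)

text \<open>The signs of single rotations accumulate to the Koszul sign of a block:
  \<open>vs\<close> is carried across \<open>us @ [v]\<close>, after which \<open>v\<close> is the
  last entry and follows.\<close>

lemma la_pow_append:
  "vl (us @ vs) \<Longrightarrow> (la ^^ length vs) (Q (gn (us @ vs))) = scal ((-1) ^ (sdeg us * sdeg vs)) (Q (gn (vs @ us)))"
proof (induction vs arbitrary: us)
  case Nil
  then show ?case by simp
next
  case (Cons v vs)
  have v: "vl (vs @ us @ [v])" "vl ((us @ [v]) @ vs)" using Cons.prems by (auto simp: vl_def)
  have "(la ^^ length (v # vs)) (Q (gn (us @ v # vs))) = la ((la ^^ length vs) (Q (gn ((us @ [v]) @ vs))))"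
    by simp
  also have "\<dots> = scal ((-1) ^ (sdeg (us @ [v]) * sdeg vs)) (la (gn (vs @ us @ [v])))"
    by (subst Cons.IH[OF v(2)]) (simp add: la_simps wop_Q[OF wop_la])
  also have "\<dots> = scal ((-1) ^ (sdeg (us @ [v]) * sdeg vs) * (-1) ^ ((sdeg vs + sdeg us) * sdeg [v])) (Q (gn (v # vs @ us)))"
    using la_snoc[of "vs @ us" v] v(1) by simp
  also have "(-1::'k) ^ (sdeg (us @ [v]) * sdeg vs) * (-1) ^ ((sdeg vs + sdeg us) * sdeg [v]) =
      (-1) ^ (sdeg us * sdeg (v # vs))"
    unfolding power_add[symmetric] by (rule minus_one_power_iff[THEN trans]) (simp add: minus_one_power_iff; blast)
  finally show ?case by simp
qed

lemma la_pow_length: "vl xs \<Longrightarrow> (la ^^ length xs) (Q (gn xs)) = Q (gn xs)"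
  using la_pow_append[of "[]" xs] by simp

lemma la_pow_mod: "vl xs \<Longrightarrow> (la ^^ (s mod length xs)) (Q (gn xs)) = (la ^^ s) (Q (gn xs))"
  by (rule funpow_mod_eq) (rule la_pow_length)

text \<open>A full turn is the identity, sign included, so rotation makes sense for every integer
  and becomes an action of the integers; positions can then be shifted without case
  distinctions.\<close>

definition rt :: "int \<Rightarrow> ('k,'a) ev \<Rightarrow> ('k,'a) ev" where
  "rt i = fam (\<lambda>L x. (la ^^ nat (i mod int L)) (Q x))"

lemma wop_rt: "wop (rt i)"
  unfolding rt_def by (rule wop_fam[OF wop_funpow[OF wop_la]])

lemmas lop_rt = wop_lop[OF wop_rt]
lemmas rt_simps = lop_simps[OF lop_rt]

lemma rt_gn: "vl xs \<Longrightarrow> rt i (gn xs) = (la ^^ nat (i mod int (length xs))) (Q (gn xs))"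
  unfolding rt_def by (subst fam_gn) (simp_all add: wop_funpow wop_la)

lemma rt_gn_nat: "vl xs \<Longrightarrow> rt (int s) (gn xs) = (la ^^ s) (Q (gn xs))"
  by (simp add: rt_gn la_pow_mod zmod_int[symmetric])

lemma rt_gn_neg: "vl xs \<Longrightarrow> s \<le> length xs \<Longrightarrow> rt (- int s) (gn xs) = (la ^^ (length xs - s)) (Q (gn xs))"
  using rt_gn_nat[of xs "length xs - s"]
  by (simp add: rt_gn of_nat_diff)

lemma rt_append:
  "vl (us @ vs) \<Longrightarrow> rt (int (length vs)) (gn (us @ vs)) = scal ((-1) ^ (sdeg us * sdeg vs)) (Q (gn (vs @ us)))"
  by (simp add: rt_gn_nat la_pow_append)

lemma rt_neg_append:
  "vl (us @ vs) \<Longrightarrow> rt (- int (length us)) (gn (us @ vs)) = scal ((-1) ^ (sdeg us * sdeg vs)) (Q (gn (vs @ us)))"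
  by (simp add: rt_gn_neg la_pow_append)

lemma rt_rt: "rt i (rt j x) = rt (i + j) x"
proof (rule wop_eqI[where A="\<lambda>x. rt i (rt j x)"])
  fix xs assume v: "vl xs"
  define L where "L = length xs"
  have L: "L > 0" using v by (auto simp: L_def vl_def)
  define s where "s = nat (j mod int L)"
  have s: "s < L" unfolding s_def using L by (simp add: nat_less_iff)
  define us vs where "us = take (L - s) xs" and "vs = drop (L - s) xs"
  have xs: "xs = us @ vs" "length vs = s" using s by (auto simp: us_def vs_def L_def)
  have v2: "vl (vs @ us)" "length (vs @ us) = L" using v xs by (auto simp: vl_def L_def)
  let ?t = "nat (i mod int L)"
  have "rt j (gn xs) = (la ^^ s) (Q (gn xs))" unfolding s_def L_def by (rule rt_gn[OF v])
  then have "rt i (rt j (gn xs)) = rt i (scal ((-1) ^ (sdeg us * sdeg vs)) (Q (gn (vs @ us))))"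
    using v la_pow_append[of us vs] unfolding xs by simp
  also have "\<dots> = scal ((-1) ^ (sdeg us * sdeg vs)) ((la ^^ ?t) (Q (gn (vs @ us))))"
    using v2 by (simp add: rt_simps wop_Q[OF wop_rt] rt_gn L_def del: length_append)
  also have "\<dots> = (la ^^ ?t) (scal ((-1) ^ (sdeg us * sdeg vs)) (Q (gn (vs @ us))))"
    by (simp add: lop_scal[OF lop_funpow[OF lop_la]])
  also have "\<dots> = (la ^^ ?t) ((la ^^ s) (Q (gn xs)))"
    using v la_pow_append[of us vs] xs by simp
  also have "\<dots> = (la ^^ (?t + s)) (Q (gn xs))" by (simp add: funpow_add)
  also have "\<dots> = rt (int (?t + s)) (gn xs)" by (rule rt_gn_nat[OF v, symmetric])
  also have "\<dots> = rt (i + j) (gn xs)"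
    using v L by (simp add: rt_gn s_def L_def[symmetric] mod_simps)
  finally show "rt i (rt j (gn xs)) = rt (i + j) (gn xs)" .
qed (rule wop_comp[OF wop_rt wop_rt] wop_rt)+

lemma rt_0: "rt 0 x = Q x"
  by (rule wop_eqI[OF wop_rt wop_id]) (simp add: rt_gn)

lemma rt_1: "rt 1 x = la x"
  by (rule wop_eqI[OF wop_rt wop_la]) (use rt_gn_nat[of _ 1] in \<open>simp add: wop_Q[OF wop_la]\<close>)

definition ln :: "nat \<Rightarrow> ('k,'a) ev \<Rightarrow> ('k,'a) ev" where
  "ln L = dg (\<lambda>ds. if length ds = L then 1 else 0)"

lemma wop_ln: "wop (ln L)" unfolding ln_def by (rule wop_dg)

lemma ln_gn: "vl xs \<Longrightarrow> ln L (gn xs) = (if length xs = L then Q (gn xs) else 0)"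
  by (simp add: ln_def dg_gn)

lemma ln_Q: "ln L x = x \<Longrightarrow> Q x = x"
  using Q_wop[OF wop_ln, of L x] by simp

lemma ln_eqI:
  assumes "wop A" "wop B" "\<And>xs. vl xs \<Longrightarrow> length xs = L \<Longrightarrow> A (gn xs) = B (gn xs)" "ln L x = x"
  shows "A x = B x"
proof -
  have "A (ln L x) = B (ln L x)"
    by (rule wop_eqI[OF wop_comp[OF assms(1) wop_ln] wop_comp[OF assms(2) wop_ln]])
      (auto simp: assms(3) ln_gn wop_Q[OF assms(1)] wop_Q[OF assms(2)]
        lop_zero[OF wop_lop[OF assms(1)]] lop_zero[OF wop_lop[OF assms(2)]])
  then show ?thesis using assms(4) by simp
qed

lemma fam_ln: "(\<And>L. wop (A L)) \<Longrightarrow> ln L x = x \<Longrightarrow> fam A x = A L x"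
  by (rule ln_eqI[OF wop_fam]) (auto simp: fam_gn)

lemma ln_cong_all:
  assumes "wop A" "wop B" "\<And>L x. ln L x = x \<Longrightarrow> A x = B x"
  shows "A x = B x"
proof (rule wop_eqI[OF assms(1,2)])
  fix xs assume "vl xs"
  then have "ln (length xs) (Q (gn xs)) = Q (gn xs)"
    by (simp add: wop_Q[OF wop_ln] ln_gn)
  from assms(3)[OF this] show "A (gn xs) = B (gn xs)"
    by (simp add: wop_Q assms)
qed

lemma dg_la:
  assumes "\<And>d ds. \<phi> (ds @ [d]) = \<phi> (d # ds)"
  shows "dg \<phi> (la x) = la (dg \<phi> x)"
proof (rule wop_eqI[where A="\<lambda>x. dg \<phi> (la x)"])
  fix xs assume v: "vl xs"
  then obtain us u where xs: "xs = us @ [u]" by (metis rev_exhaust vl_def)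
  with v have v2: "vl (u # us)" by (auto simp: vl_def)
  show "dg \<phi> (la (gn xs)) = la (dg \<phi> (gn xs))"
    using v v2 unfolding xs
    by (simp add: la_snoc dg_gn lop_scal[OF wop_lop[OF wop_dg]] la_simps dg_Qgn assms
      wop_Q[OF wop_la] wop_Q[OF wop_dg] mult.commute)
qed (rule wop_comp[OF wop_dg wop_la] wop_comp[OF wop_la wop_dg])+

lemma dg_rt:
  assumes "\<And>d ds. \<phi> (ds @ [d]) = \<phi> (d # ds)"
  shows "dg \<phi> (rt i x) = rt i (dg \<phi> x)"
proof (rule wop_eqI[where A="\<lambda>x. dg \<phi> (rt i x)"])
  fix xs assume v: "vl xs"
  have "dg \<phi> ((la ^^ n) (Q x)) = (la ^^ n) (dg \<phi> x)" for n x
    by (induction n) (auto simp: dg_la[OF assms] wop_Q[OF wop_dg])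
  then show "dg \<phi> (rt i (gn xs)) = rt i (dg \<phi> (gn xs))"
    using v by (simp add: rt_gn dg_gn rt_simps wop_Q[OF wop_rt] lop_scal[OF lop_funpow[OF lop_la]])
qed (rule wop_comp[OF wop_dg wop_rt] wop_comp[OF wop_rt wop_dg])+

lemma ln_rt: "ln L (rt i x) = rt i (ln L x)"
  unfolding ln_def by (rule dg_rt) simp

lemma rt_length: "ln L x = x \<Longrightarrow> rt (i + int L) x = rt i x"
  by (rule ln_eqI[OF wop_rt wop_rt]) (auto simp: rt_gn)

end

text \<open>The conditions \<open>2 \<le> sdeg\<close> guard the truncated subtraction: an operation whose result would have
  negative degree, such as \<open>m\<^sub>1\<close> on degree \<open>0\<close>, vanishes.\<close>

locale operations = graded_presentation sc G Nd
  for sc :: "'k::field_char_0 \<Rightarrow> 'a::ab_group_add \<Rightarrow> 'a" and G Nd +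
  fixes m :: "nat \<Rightarrow> 'a list \<Rightarrow> 'a"
  assumes m_lin: "length xs + length ys + 1 = n \<Longrightarrow>
      m n (xs @ (sc c a + b) # ys) = sc c (m n (xs @ a # ys)) + m n (xs @ b # ys)"
    and m_deg: "valid G bs \<Longrightarrow> bs \<noteq> [] \<Longrightarrow> 2 \<le> sdeg bs \<Longrightarrow> m (length bs) (map snd bs) \<in> G (sdeg bs - 2)"
    and m_junk: "valid G bs \<Longrightarrow> bs \<noteq> [] \<Longrightarrow> sdeg bs < 2 \<Longrightarrow> m (length bs) (map snd bs) = 0"
    and m_N: "valid G us \<Longrightarrow> valid G vs \<Longrightarrow> a \<in> G d \<Longrightarrow> a \<in> Nd d \<Longrightarrow> 2 \<le> sdeg (us @ (d, a) # vs) \<Longrightarrow>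
      m (length us + length vs + 1) (map snd us @ a # map snd vs) \<in> Nd (sdeg (us @ (d, a) # vs) - 2)"
begin

lemma m_zero: "length xs + length ys + 1 = n \<Longrightarrow> m n (xs @ 0 # ys) = 0"
  using m_lin[of xs ys n 1 0 0] by simp

lemma mapp_in: "valid G bs \<Longrightarrow> bs \<noteq> [] \<Longrightarrow> snd (Defs.mapp m bs) \<in> G (fst (Defs.mapp m bs))"
  using m_deg m_junk G_zero by (cases "2 \<le> sdeg bs") (auto simp: mapp_eq)

definition mu :: "nat \<Rightarrow> ('k,'a) ev \<Rightarrow> ('k,'a) ev" where
  "mu n = opr (\<lambda>xs. if 1 \<le> n \<and> n \<le> length xs \<and> 2 \<le> sdeg (take n xs)
     then gn (Defs.mapp m (take n xs) # drop n xs) else 0)"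

lemma wop_mu: "wop (mu n)"
  unfolding mu_def
proof (rule wop_opr)
  fix xs ys d a b c
  assume *: "valid G xs" "valid G ys" "a \<in> G d" "b \<in> G d"
  let ?F = "\<lambda>xs. if 1 \<le> n \<and> n \<le> length xs \<and> 2 \<le> sdeg (take n xs)
     then gn (Defs.mapp m (take n xs) # drop n xs) else 0 :: ('k,'a) ev"
  have vt: "valid G (take k zs)" "valid G (drop k zs)" if "valid G zs" for k zs
    using that by (auto simp: valid_def dest: in_set_takeD in_set_dropD)
  show "Q (?F (xs @ (d, sc c a + b) # ys)) = scal c (Q (?F (xs @ (d, a) # ys))) + Q (?F (xs @ (d, b) # ys))"
  proof (cases "n \<le> length xs")
    case True
    then have "1 \<le> n \<Longrightarrow> take n xs \<noteq> []" by auto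
    then show ?thesis using True
      using Q_lin[of "Defs.mapp m (take n xs) # drop n xs" ys a d b c] * vt mapp_in[of "take n xs"]
      by (auto simp: Qs)
  next
    case False
    define k where "k = n - Suc (length xs)"
    have n: "n = length xs + Suc k" using False by (simp add: k_def)
    define D where "D = sdeg (xs @ (d, a) # take k ys)"
    have D: "sdeg xs + (Suc d + sdeg (take k ys)) = D" by (simp add: D_def)
    show ?thesis
    proof (cases "k \<le> length ys \<and> 2 \<le> D")
      case True
      have mem: "m n (map snd xs @ e # map snd (take k ys)) \<in> G (D - 2)" if "e \<in> G d" for e
        using m_deg[of "xs @ (d, e) # take k ys"] that * vt True by (simp add: n D_def min.absorb2)
      have l: "m n (map snd xs @ (sc c a + b) # map snd (take k ys)) =
         sc c (m n (map snd xs @ a # map snd (take k ys))) + m n (map snd xs @ b # map snd (take k ys))"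
        using True by (intro m_lin) (simp add: n min.absorb2)
      have F: "?F (xs @ (d, e) # ys) = gn ([] @ (D - 2, m n (map snd xs @ e # map snd (take k ys))) # drop k ys)" for e
        using True by (auto simp: n mapp_eq D_def min.absorb2)
      show ?thesis
        unfolding F l by (rule Q_lin) (use * mem vt in auto)
    next
      case False
      then have "?F (xs @ (d, e) # ys) = 0" for e by (auto simp: n D_def)
      then show ?thesis by (simp add: Qs)
    qed
  qed
next
  fix xs ys d a
  assume *: "valid G xs" "valid G ys" "a \<in> G d" "a \<in> Nd d"
  let ?F = "\<lambda>xs. if 1 \<le> n \<and> n \<le> length xs \<and> 2 \<le> sdeg (take n xs)
     then gn (Defs.mapp m (take n xs) # drop n xs) else 0 :: ('k,'a) ev"
  have vt: "valid G (take k zs)" "valid G (drop k zs)" if "valid G zs" for k zs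
    using that by (auto simp: valid_def dest: in_set_takeD in_set_dropD)
  show "Q (?F (xs @ (d, a) # ys)) = 0"
  proof (cases "n \<le> length xs")
    case True
    then have "1 \<le> n \<Longrightarrow> take n xs \<noteq> []" by auto
    then show ?thesis using True
      using Q_N[of "Defs.mapp m (take n xs) # drop n xs" ys a d] * vt mapp_in[of "take n xs"]
      by (auto simp: Qs)
  next
    case False
    define k where "k = n - Suc (length xs)"
    have n: "n = length xs + Suc k" using False by (simp add: k_def)
    define D where "D = sdeg (xs @ (d, a) # take k ys)"
    have D: "sdeg xs + (Suc d + sdeg (take k ys)) = D" by (simp add: D_def)
    show ?thesis
    proof (cases "k \<le> length ys \<and> 2 \<le> D")
      case True
      have "m n (map snd xs @ a # map snd (take k ys)) \<in> G (D - 2)"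
        using m_deg[of "xs @ (d, a) # take k ys"] * vt True by (simp add: n D_def min.absorb2)
      moreover have "m n (map snd xs @ a # map snd (take k ys)) \<in> Nd (D - 2)"
        using m_N[of xs "take k ys" a d] * vt True by (simp add: n D_def min.absorb2)
      moreover have "?F (xs @ (d, a) # ys) = gn ([] @ (D - 2, m n (map snd xs @ a # map snd (take k ys))) # drop k ys)"
        using True by (auto simp: n mapp_eq D_def min.absorb2)
      ultimately show ?thesis using Q_N[of "[]" "drop k ys"] * vt by simp
    next
      case False
      then show ?thesis by (auto simp: n D_def Qs)
    qed
  qed
qed

lemmas lop_mu = wop_lop[OF wop_mu]
lemmas mu_simps = lop_simps[OF lop_mu]

lemma mu_gn:
  assumes "vl (bs @ vs)" "bs \<noteq> []"
  shows "mu (length bs) (gn (bs @ vs)) = Q (gn (Defs.mapp m bs # vs))"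
proof (cases "2 \<le> sdeg bs")
  case True
  then show ?thesis using assms by (cases bs) (auto simp: mu_def opr_gn)
next
  case False
  then have "m (length bs) (map snd bs) = 0" using assms by (intro m_junk) (auto simp: vl_def)
  then have "Q (gn (Defs.mapp m bs # vs)) = 0"
    using Q_zero[of "[]" vs] assms by (simp add: mapp_eq vl_def)
  then show ?thesis using assms False by (simp add: mu_def opr_gn Qs)
qed

lemma mu_short: "vl xs \<Longrightarrow> length xs < n \<Longrightarrow> mu n (gn xs) = 0"
  by (simp add: mu_def opr_gn Qs)

lemma mu_0: "mu 0 x = 0"
  by (rule wop_eqI[OF wop_mu wop_0]) (simp add: mu_def opr_gn Qs)

lemma mu_short_ln: "ln L x = x \<Longrightarrow> L < n \<Longrightarrow> mu n x = 0"
  by (rule ln_eqI[OF wop_mu wop_0]) (auto simp: mu_short)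

lemma dg_mu:
  assumes "\<And>bs ds. 1 \<le> n \<Longrightarrow> length bs = n \<Longrightarrow> 2 \<le> sum_list bs + n \<Longrightarrow> \<phi> ((sum_list bs + n - 2) # ds) = \<psi> (bs @ ds)"
  shows "dg \<phi> (mu n x) = mu n (dg \<psi> x)"
proof (rule wop_eqI[where A="\<lambda>x. dg \<phi> (mu n x)"])
  fix xs assume v: "vl xs"
  show "dg \<phi> (mu n (gn xs)) = mu n (dg \<psi> (gn xs))"
  proof (cases "1 \<le> n \<and> n \<le> length xs \<and> 2 \<le> sdeg (take n xs)")
    case True
    define bs ds where "bs = take n xs" and "ds = drop n xs"
    have xs: "xs = bs @ ds" "length bs = n" using True by (auto simp: bs_def ds_def)
    have bn: "bs \<noteq> []" using True xs by auto
    have v2: "vl (Defs.mapp m bs # ds)"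
      using v xs mapp_in[of bs] bn by (auto simp: vl_def)
    have 1: "mu n (gn xs) = Q (gn (Defs.mapp m bs # ds))"
      using mu_gn[of bs ds] v xs bn by simp
    have "2 \<le> sum_list (map fst bs) + n" using True xs by (simp add: sdeg_eq bs_def[symmetric])
    then have 2: "\<phi> (map fst (Defs.mapp m bs # ds)) = \<psi> (map fst xs)"
      using assms[of "map fst bs" "map fst ds"] xs True by (simp add: mapp_eq sdeg_eq)
    show ?thesis
      by (simp add: 1 dg_Qgn[OF v2] dg_gn[OF v] 2 mu_simps wop_Q[OF wop_mu] del: list.map)
  next
    case False
    then have "mu n (gn xs) = 0" using v by (auto simp: mu_def opr_gn Qs)
    then show ?thesis
      by (simp add: dg_gn[OF v] mu_simps wop_Q[OF wop_mu] lop_zero[OF wop_lop[OF wop_dg]])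
  qed
qed (rule wop_comp[OF wop_dg wop_mu] wop_comp[OF wop_mu wop_dg])+

lemma ln_mu: 
  assumes "ln L x = x" "n \<le> L"
  shows "ln (L - n + 1) (mu n x) = mu n x"
proof (cases n)
  case 0
  then show ?thesis by (simp add: mu_0 lop_zero[OF wop_lop[OF wop_ln]])
next
  case (Suc n')
  have "ln (L - n + 1) (mu n x) = mu n (ln L x)"
    unfolding ln_def by (rule dg_mu) (use assms Suc in auto)
  then show ?thesis using assms by simp
qed

text \<open>Conjugating an application at the front by rotations produces exactly the Koszul sign of an application
  at position \<open>i\<close>, so no signs occur in the computations with \<open>ins\<close>.\<close>

definition ins :: "int \<Rightarrow> nat \<Rightarrow> ('k,'a) ev \<Rightarrow> ('k,'a) ev" where
  "ins i n x = rt i (mu n (rt (- i) x))"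

lemma wop_ins: "wop (ins i n)"
  unfolding ins_def by (rule wop_comp[OF wop_rt wop_comp[OF wop_mu wop_rt]])

lemma ins_gn:
  assumes "vl (us @ bs @ vs)" "bs \<noteq> []"
  shows "ins (int (length us)) (length bs) (gn (us @ bs @ vs)) =
    scal ((-1) ^ sdeg us) (Q (gn (us @ Defs.mapp m bs # vs)))"
proof -
  have v: "vl (bs @ vs @ us)" using assms by (auto simp: vl_def)
  have v2: "vl ((Defs.mapp m bs # vs) @ us)" using assms mapp_in[of bs] by (auto simp: vl_def)
  have 1: "ins (int (length us)) (length bs) (gn (us @ bs @ vs)) =
      scal ((-1) ^ (sdeg us * sdeg (bs @ vs))) (rt (int (length us)) (mu (length bs) (gn (bs @ (vs @ us)))))"
    unfolding ins_def using assms(1)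
    by (simp add: rt_neg_append mu_simps wop_Q[OF wop_mu] rt_simps)
  show ?thesis
  proof (cases "2 \<le> sdeg bs")
    case True
    have "ins (int (length us)) (length bs) (gn (us @ bs @ vs)) =
      scal ((-1) ^ (sdeg us * sdeg (bs @ vs)) * (-1) ^ (sdeg (Defs.mapp m bs # vs) * sdeg us)) (Q (gn (us @ Defs.mapp m bs # vs)))"
      unfolding 1 using mu_gn[OF v assms(2)] rt_append[OF v2]
      by (simp add: wop_Q[OF wop_rt])
    also have "(-1::'k) ^ (sdeg us * sdeg (bs @ vs)) * (-1) ^ (sdeg (Defs.mapp m bs # vs) * sdeg us) = (-1) ^ sdeg us"
      unfolding power_add[symmetric] minus_one_power_iff using True
      by (auto simp: mapp_eq)
    finally show ?thesis .
  next
    case False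
    then have "m (length bs) (map snd bs) = 0" using assms by (intro m_junk) (auto simp: vl_def)
    then have "Q (gn (Defs.mapp m bs # vs @ us)) = 0" "Q (gn (us @ Defs.mapp m bs # vs)) = 0"
      using Q_zero[of "[]" "vs @ us"] Q_zero[of us vs] assms by (auto simp: mapp_eq vl_def)
    then show ?thesis unfolding 1 mu_gn[OF v assms(2)]
      by (simp add: rt_simps)
  qed
qed

lemma ln_ins: "ln L x = x \<Longrightarrow> n \<le> L \<Longrightarrow> ln (L - n + 1) (ins i n x) = ins i n x"
  unfolding ins_def using ln_mu[of L "rt (- i) x" n] by (simp add: ln_rt)

text \<open>Both operations have degree \<open>-1\<close> on \<open>A[1]\<close>, so on disjoint
  blocks they anticommute. The front block shrinks from \<open>n\<close> entries to one, which moves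
  the other block by \<open>n - 1\<close>.\<close>

lemma mu_ins_disjoint:
  assumes x: "ln L x = x" and n: "1 \<le> n" "n \<le> j" and k: "1 \<le> k" "j + k \<le> L"
  shows "mu n (ins (int j) k x) = - ins (int (j - n + 1)) k (mu n x)"
proof (rule ln_eqI[OF _ _ _ x])
  fix xs assume v: "vl xs" and L: "length xs = L"
  define as bs cs ds where "as = take n xs" and "bs = take (j - n) (drop n xs)"
    and "cs = take k (drop j xs)" and "ds = drop (j + k) xs"
  have "xs = take n xs @ take (j - n) (drop n xs) @ drop (j - n) (drop n xs)" by (metis append_take_drop_id)
  also have "drop (j - n) (drop n xs) = drop j xs" using n by simp
  also have "drop j xs = take k (drop j xs) @ drop k (drop j xs)" by (metis append_take_drop_id)
  also have "drop k (drop j xs) = ds" by (simp add: ds_def add.commute)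
  finally have xs: "xs = as @ bs @ cs @ ds" by (simp add: as_def bs_def cs_def)
  have len: "length as = n" "length bs = j - n" "length cs = k"
    using n k L by (auto simp: as_def bs_def cs_def)
  have ne: "as \<noteq> []" "cs \<noteq> []" using len n k by auto
  have va: "valid G as" "valid G bs" "valid G cs" "valid G ds" using v xs by (auto simp: vl_def)
  have mp: "valid G [Defs.mapp m as]" "valid G [Defs.mapp m cs]" using mapp_in va ne by auto
  have "ins (int j) k (gn xs) = scal ((-1) ^ sdeg (as @ bs)) (Q (gn (as @ bs @ Defs.mapp m cs # ds)))"
    using ins_gn[of "as @ bs" cs ds] v xs ne len n by simp
  then have 1: "mu n (ins (int j) k (gn xs)) = scal ((-1) ^ sdeg (as @ bs)) (Q (gn (Defs.mapp m as # bs @ Defs.mapp m cs # ds)))"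
    using mu_gn[of as "bs @ Defs.mapp m cs # ds"] ne len va mp
    by (simp add: mu_simps wop_Q[OF wop_mu] vl_def)
  have 2: "ins (int (j - n + 1)) k (mu n (gn xs)) = scal ((-1) ^ sdeg (Defs.mapp m as # bs)) (Q (gn (Defs.mapp m as # bs @ Defs.mapp m cs # ds)))"
    using mu_gn[of as "bs @ cs @ ds"] ins_gn[of "Defs.mapp m as # bs" cs ds] v xs ne len va mp
    by (simp add: wop_Q[OF wop_ins] vl_def)
  show "mu n (ins (int j) k (gn xs)) = - ins (int (j - n + 1)) k (mu n (gn xs))"
  proof (cases "2 \<le> sdeg as")
    case True
    then have "(-1::'k) ^ sdeg (as @ bs) = - ((-1) ^ sdeg (Defs.mapp m as # bs))"
      by (auto simp: mapp_eq minus_one_power_iff)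
    then show ?thesis unfolding 1 2 by simp
  next
    \<comment> \<open>The truncated degree label would give the wrong sign here, but the tensor
      itself is zero.\<close>
    case False
    then have "m (length as) (map snd as) = 0" using va ne by (intro m_junk) auto
    then have "Q (gn (Defs.mapp m as # bs @ Defs.mapp m cs # ds)) = 0"
      using Q_zero[of "[]" "bs @ Defs.mapp m cs # ds"] va mp by (simp add: mapp_eq)
    then show ?thesis unfolding 1 2 by simp
  qed
qed (rule wop_comp[OF wop_mu wop_ins] wop_neg[OF wop_comp[OF wop_ins wop_mu]])+

end

section \<open>The differentials\<close>

context graded_presentation
begin

definition N :: "('k,'a) ev \<Rightarrow> ('k,'a) ev" where
  "N = fam (\<lambda>L x. \<Sum>s<L. rt (int s) x)"

lemma wop_N: "wop N"
  unfolding N_def by (rule wop_fam[OF wop_Sum[OF wop_rt]])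

lemmas lop_N = wop_lop[OF wop_N]
lemmas N_simps = lop_simps[OF lop_N]

lemma N_ln: "ln L x = x \<Longrightarrow> N x = (\<Sum>s<L. rt (int s) x)"
  unfolding N_def by (rule fam_ln[OF wop_Sum[OF wop_rt]])

lemma rt_la: "rt i (la x) = rt (i + 1) x" and la_rt: "la (rt i x) = rt (i + 1) x"
  by (simp_all add: rt_1[symmetric] rt_rt add.commute)

lemma ln_la: "ln L (la x) = la (ln L x)"
  using ln_rt[of L 1] by (simp add: rt_1)

lemma rt_length_nat: "ln L x = x \<Longrightarrow> rt (int L) x = Q x"
  using rt_length[of L x 0] by (simp add: rt_0)

lemma sum_rt_shift: "ln L x = x \<Longrightarrow> (\<Sum>s<L. rt (int s + 1) x) = (\<Sum>s<L. rt (int s) x)"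
  using sum.lessThan_Suc_shift[of "\<lambda>s. rt (int s) x" L] sum.lessThan_Suc[of "\<lambda>s. rt (int s) x" L]
  by (simp add: rt_length_nat rt_0 add.commute)

lemma la_N: "la (N x) = N x"
  by (rule ln_cong_all[OF wop_comp[OF wop_la wop_N] wop_N])
    (simp add: N_ln la_simps la_rt sum_rt_shift)

lemma N_la: "N (la x) = N x"
proof (rule ln_cong_all[OF wop_comp[OF wop_N wop_la] wop_N])
  fix L x assume *: "ln L x = x"
  then have "ln L (la x) = la x" by (simp add: ln_la)
  then show "N (la x) = N x" using * by (simp add: N_ln rt_la sum_rt_shift)
qed

lemma ln_ln: "ln K (ln L x) = ln L (ln K x)"
  by (simp add: ln_def dg_dg mult.commute)

lemma ln_N: "ln L (N x) = N (ln L x)"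
proof (rule ln_cong_all[OF wop_comp[OF wop_ln wop_N] wop_comp[OF wop_N wop_ln]])
  fix K x assume *: "ln K x = x"
  then have "ln K (ln L x) = ln L x"
    using ln_ln[of K L x] by simp
  then show "ln L (N x) = N (ln L x)" using *
    by (simp add: N_ln lop_sum[OF wop_lop[OF wop_ln]] ln_rt)
qed

lemma rt_invariant:
  assumes y: "la y = y"
  shows "rt i y = y"
proof -
  have Q: "Q y = y" using Q_wop[OF wop_la, of y] y by simp
  have 1: "rt (int s) y = y" for s
    by (induction s) (simp_all add: rt_0 Q la_rt[symmetric] add.commute[of 1] y)
  show ?thesis
  proof (cases "i \<ge> 0")
    case True
    then show ?thesis using 1[of "nat i"] by simp
  next
    case False
    then have "rt i y = rt i (rt (int (nat (- i))) y)" by (simp only: 1)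
    then show ?thesis using False by (simp add: rt_rt rt_0 Q)
  qed
qed

lemma rt_N: "rt i (N x) = N x"
  by (rule rt_invariant[OF la_N])

lemma N_rt: "N (rt i x) = N x"
proof -
  have 1: "N (rt (int s) x) = N x" for s x
  proof (induction s)
    case (Suc s)
    then show ?case by (metis N_la la_rt of_nat_Suc add.commute)
  qed (simp add: rt_0 wop_Q[OF wop_N])
  show ?thesis
  proof (cases "i \<ge> 0")
    case True
    then show ?thesis using 1[of "nat i"] by simp
  next
    case False
    then have "N (rt i x) = N (rt (int (nat (- i))) (rt i x))" by (simp only: 1)
    then show ?thesis using False by (simp add: rt_rt rt_0 wop_Q[OF wop_N])
  qed
qed

lemma Q_sum_slot:
  assumes "valid G xs" "valid G ys" "\<And>i. i \<in> I \<Longrightarrow> a i \<in> G d"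
  shows "Q (gn (xs @ (d, \<Sum>i\<in>I. sc (c i) (a i)) # ys)) = (\<Sum>i\<in>I. scal (c i) (Q (gn (xs @ (d, a i) # ys))))"
    and "(\<Sum>i\<in>I. sc (c i) (a i)) \<in> G d"
proof -
  have "(\<Sum>i\<in>I. sc (c i) (a i)) \<in> G d \<and>
    Q (gn (xs @ (d, \<Sum>i\<in>I. sc (c i) (a i)) # ys)) = (\<Sum>i\<in>I. scal (c i) (Q (gn (xs @ (d, a i) # ys))))"
    using assms(3)
  proof (induction I rule: infinite_finite_induct)
    case (insert i I)
    then show ?case using Q_lin[OF assms(1,2), of "a i" d "\<Sum>i\<in>I. sc (c i) (a i)" "c i"]
      by (auto intro: G_add G_scale)
  qed (use assms Q_zero in \<open>auto simp: G_zero\<close>)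
  then show "Q (gn (xs @ (d, \<Sum>i\<in>I. sc (c i) (a i)) # ys)) = (\<Sum>i\<in>I. scal (c i) (Q (gn (xs @ (d, a i) # ys))))"
    and "(\<Sum>i\<in>I. sc (c i) (a i)) \<in> G d" by auto
qed

end

context operations
begin

definition bp :: "nat \<Rightarrow> ('k,'a) ev \<Rightarrow> ('k,'a) ev" where
  "bp n = fam (\<lambda>L x. \<Sum>i<L+1-n. ins (int i) n x)"

text \<open>The second sum is the wrap-around part: after the last \<open>s\<close> entries are
  rotated to the front, a block through the old position \<open>0\<close> is an initial block, and
  \<open>s < n\<close> says that it does reach this position.\<close>

definition bb :: "nat \<Rightarrow> ('k,'a) ev \<Rightarrow> ('k,'a) ev" where
  "bb n = fam (\<lambda>L x. (\<Sum>i<L+1-n. ins (int i) n x) + (\<Sum>s\<in>{1..<n}. mu n (rt (int s) x)))"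

lemma wop_bb_aux: "wop (\<lambda>x. (\<Sum>i<L+1-n. ins (int i) n x) + (\<Sum>s\<in>{1..<n}. mu n (rt (int s) x)))"
  by (rule wop_plus[OF wop_Sum[OF wop_ins] wop_Sum[OF wop_comp[OF wop_mu wop_rt]]])

lemma wop_bp: "wop (bp n)"
  unfolding bp_def by (rule wop_fam[OF wop_Sum[OF wop_ins]])

lemma wop_bb: "wop (bb n)"
  unfolding bb_def by (rule wop_fam[OF wop_bb_aux])

lemmas lop_bp = wop_lop[OF wop_bp]
lemmas bp_simps = lop_simps[OF lop_bp]
lemmas lop_bb = wop_lop[OF wop_bb]
lemmas bb_simps = lop_simps[OF lop_bb]
lemmas lop_ins = wop_lop[OF wop_ins]
lemmas ins_simps = lop_simps[OF lop_ins]

lemma bp_ln: "ln L x = x \<Longrightarrow> bp n x = (\<Sum>i<L+1-n. ins (int i) n x)"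
  unfolding bp_def by (rule fam_ln[OF wop_Sum[OF wop_ins]])

lemma bb_ln: "ln L x = x \<Longrightarrow> bb n x = (\<Sum>i<L+1-n. ins (int i) n x) + (\<Sum>s\<in>{1..<n}. mu n (rt (int s) x))"
  unfolding bb_def by (rule fam_ln[OF wop_bb_aux])

lemma ins_0: "ins i 0 x = 0"
  unfolding ins_def by (simp add: mu_0 rt_simps)

lemma mu_rt_short: "ln L x = x \<Longrightarrow> L < n \<Longrightarrow> mu n (rt i x) = 0"
  by (rule mu_short_ln[of L]) (simp_all add: ln_rt)

lemma bp_short: "ln L x = x \<Longrightarrow> n = 0 \<or> L < n \<Longrightarrow> bp n x = 0"
  by (auto simp: bp_ln ins_0)

lemma bb_short: "ln L x = x \<Longrightarrow> n = 0 \<or> L < n \<Longrightarrow> bb n x = 0"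
  by (auto simp: bb_ln ins_0 mu_rt_short)

lemma ln_bp: "ln L x = x \<Longrightarrow> n \<le> L \<Longrightarrow> ln (L + 1 - n) (bp n x) = bp n x"
  using ln_ins[of L x n] by (simp add: bp_ln lop_sum[OF wop_lop[OF wop_ln]] Suc_diff_le del: sum.lessThan_Suc)

text \<open>Insertions after \<open>\<lambda>\<close> and \<open>\<lambda>\<close> after insertions
  are sums of the same terms \<open>t i\<close> over ranges shifted by one, and the wrap-around
  terms shift in the same way. The end terms match because rotation by \<open>n - L\<close> equals
  rotation by \<open>n\<close>.\<close>

lemma bb_la: "bb n (la x) = bb n x - bp n x + la (bp n x)"
proof (rule ln_cong_all[OF wop_comp[OF wop_bb wop_la] wop_plus[OF wop_sub[OF wop_bb wop_bp] wop_comp[OF wop_la wop_bp]]])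
  fix L x assume x: "ln L x = x"
  have lx: "ln L (la x) = la x" using x by (simp add: ln_la)
  show "bb n (la x) = bb n x - bp n x + la (bp n x)"
  proof (cases "n = 0 \<or> L < n")
    case True
    then show ?thesis using bb_short[OF x] bb_short[OF lx] bp_short[OF x] by (auto simp: la_simps)
  next
    case False
    define K where "K = L - n"
    have K: "L + 1 - n = Suc K" "L - n + 1 = Suc K" and nL: "n \<le> L" "1 \<le> n" using False by (auto simp: K_def)
    define t where "t i = rt (int i) (mu n (rt (1 - int i) x))" for i
    have 1: "ins (int i) n (la x) = t i" "la (ins (int i) n x) = t (Suc i)" for i
      by (simp_all add: ins_def t_def la_rt rt_la add.commute)
    have "ln (Suc K) (mu n (rt (1 - int (Suc K)) x)) = mu n (rt (1 - int (Suc K)) x)"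
      using ln_mu[of L "rt (1 - int (Suc K)) x" n] x nL K by (simp add: ln_rt)
    then have "t (Suc K) = mu n (rt (1 - int (Suc K)) x)"
      unfolding t_def by (simp add: rt_length_nat Q_wop[OF wop_mu] del: of_nat_Suc)
    also have "rt (1 - int (Suc K)) x = rt (int n) x"
      using rt_length[OF x, of "1 - int (Suc K)"] nL by (simp add: K_def of_nat_diff)
    finally have t2: "t (Suc K) = mu n (rt (int n) x)" .
    have t1: "t 0 = mu n (rt 1 x)" by (simp add: t_def rt_0 Q_wop[OF wop_mu])
    have s: "t 0 + (\<Sum>i<Suc K. t (Suc i)) = (\<Sum>i<Suc K. t i) + t (Suc K)"
      using sum.lessThan_Suc_shift[of t "Suc K"] by (simp add: add.commute)
    have "(\<Sum>s\<in>{1..<n}. mu n (rt (int s) (la x))) = (\<Sum>s\<in>{Suc 1..<Suc n}. mu n (rt (int s) x))"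
      by (subst sum.shift_bounds_Suc_ivl) (simp add: rt_la add.commute)
    also have "mu n (rt 1 x) + \<dots> = (\<Sum>s\<in>{1..<Suc n}. mu n (rt (int s) x))"
      using sum.atLeast_Suc_lessThan[of 1 "Suc n" "\<lambda>s. mu n (rt (int s) x)"] nL by simp
    also have "\<dots> = (\<Sum>s\<in>{1..<n}. mu n (rt (int s) x)) + mu n (rt (int n) x)"
      using nL by simp
    finally have u: "mu n (rt 1 x) + (\<Sum>s\<in>{1..<n}. mu n (rt (int s) (la x))) =
      (\<Sum>s\<in>{1..<n}. mu n (rt (int s) x)) + mu n (rt (int n) x)" .
    have "bb n (la x) = (\<Sum>i<Suc K. t i) + (\<Sum>s\<in>{1..<n}. mu n (rt (int s) (la x)))"
      using bb_ln[OF lx, of n] by (simp only: K 1)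
    moreover have "bb n x - bp n x = (\<Sum>s\<in>{1..<n}. mu n (rt (int s) x))"
      using bb_ln[OF x, of n] bp_ln[OF x, of n] by simp
    moreover have "la (bp n x) = (\<Sum>i<Suc K. t (Suc i))"
      using bp_ln[OF x, of n] by (simp only: K lop_sum[OF lop_la] 1)
    moreover have "(\<Sum>i<Suc K. t i) = mu n (rt 1 x) + (\<Sum>i<Suc K. t (Suc i)) - mu n (rt (int n) x)"
      using s unfolding t1 t2 eq_diff_eq by simp
    moreover have "(\<Sum>s\<in>{1..<n}. mu n (rt (int s) (la x))) =
        (\<Sum>s\<in>{1..<n}. mu n (rt (int s) x)) + mu n (rt (int n) x) - mu n (rt 1 x)"
      using u unfolding eq_diff_eq by (simp add: add.commute)
    ultimately show ?thesis by simp
  qed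
qed

lemma bp_invariant:
  assumes y: "ln L y = y" "la y = y" and n: "n \<le> L"
  shows "bp n y = N (mu n y)"
proof -
  have "ln (L + 1 - n) (mu n y) = mu n y" using ln_mu[OF y(1) n] n by (simp add: Suc_diff_le)
  then show ?thesis
    by (simp add: bp_ln[OF y(1)] N_ln ins_def rt_invariant[OF y(2)])
qed

text \<open>\<open>N\<close> absorbs the outer rotation of each insertion. What remains is the
  operation at the front of the rotations by \<open>0, -1, ..., n - L\<close> and by
  \<open>1, ..., n - 1\<close>; these run once through all residues modulo \<open>L\<close>, so
  their sum is \<open>N x\<close>.\<close>

lemma N_bb: "N (bb n x) = bp n (N x)"
proof (rule ln_cong_all[OF wop_comp[OF wop_N wop_bb] wop_comp[OF wop_bp wop_N]])
  fix L x assume x: "ln L x = x"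
  have nx: "ln L (N x) = N x" using x by (simp add: ln_N)
  show "N (bb n x) = bp n (N x)"
  proof (cases "n = 0 \<or> L < n")
    case True
    then show ?thesis using bb_short[OF x] bp_short[OF nx] by (auto simp: N_simps)
  next
    case False
    define K where "K = L - n"
    have K: "L + 1 - n = Suc K" "L = K + n" and nL: "n \<le> L" "1 \<le> n" using False by (auto simp: K_def)
    have r: "rt (- int (Suc i)) x = rt (int (L - Suc i)) x" if "i < K" for i
    proof -
      have "int (L - Suc i) = - int (Suc i) + int L" using that K by simp
      then show ?thesis by (simp only: rt_length[OF x])
    qed
    have "(\<Sum>i<Suc K. rt (- int i) x) = rt 0 x + (\<Sum>i<K. rt (- int (Suc i)) x)"
      by (simp add: sum.lessThan_Suc_shift del: sum.lessThan_Suc of_nat_Suc)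
    also have "(\<Sum>i<K. rt (- int (Suc i)) x) = (\<Sum>i<K. rt (int (L - Suc i)) x)"
      using r by (intro sum.cong) auto
    also have "\<dots> = (\<Sum>s\<in>{n..<L}. rt (int s) x)"
      by (rule sum.reindex_bij_witness[of _ "\<lambda>s. L - Suc s" "\<lambda>i. L - Suc i"]) (use K in auto)
    finally have 1: "(\<Sum>i<Suc K. rt (- int i) x) + (\<Sum>s\<in>{1..<n}. rt (int s) x) = N x"
    proof -
      assume *: "(\<Sum>i<Suc K. rt (- int i) x) = rt 0 x + (\<Sum>s\<in>{n..<L}. rt (int s) x)"
      have "N x = (\<Sum>s\<in>{0..<L}. rt (int s) x)" by (simp add: N_ln[OF x] atLeast0LessThan)
      also have "\<dots> = rt 0 x + ((\<Sum>s\<in>{1..<n}. rt (int s) x) + (\<Sum>s\<in>{n..<L}. rt (int s) x))"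
        using nL sum.atLeastLessThan_concat[of 1 n L "\<lambda>s. rt (int s) x"]
        by (subst sum.atLeast_Suc_lessThan) auto
      finally show ?thesis unfolding * by (simp add: algebra_simps)
    qed
    have "N (bb n x) = (\<Sum>i<Suc K. N (mu n (rt (- int i) x))) + (\<Sum>s\<in>{1..<n}. N (mu n (rt (int s) x)))"
      using bb_ln[OF x, of n] by (simp only: K(1) lop_add[OF lop_N] lop_sum[OF lop_N] ins_def N_rt)
    also have "\<dots> = N (mu n ((\<Sum>i<Suc K. rt (- int i) x) + (\<Sum>s\<in>{1..<n}. rt (int s) x)))"
      by (simp only: lop_add[OF lop_N] lop_sum[OF lop_N] lop_add[OF lop_mu] lop_sum[OF lop_mu])
    also have "\<dots> = bp n (N x)" unfolding 1 using bp_invariant[OF nx la_N] nL by simp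
    finally show ?thesis .
  qed
qed

lemma bb_invariant:
  assumes y: "ln L y = y" "la y = y" and n: "n \<le> L"
  shows "bb n y = N (mu n y) + scal (of_nat (n - 1)) (mu n y)"
proof -
  have c: "(\<Sum>s\<in>{1..<n}. z) = scal (of_nat (n - 1)) (z::('k,'a) ev)" for z
    by (simp add: ev.sum_constant_scale)
  show ?thesis
    unfolding bb_ln[OF y(1)] rt_invariant[OF y(2)] c bp_invariant[OF y n, symmetric] bp_ln[OF y(1)] ..
qed

text \<open>Applications that meet the new front entry are the nested terms of the first sum. All
  others anticommute past \<open>mu k\<close> and form \<open>- mu k (bp n y)\<close>, except that
  applications starting inside the first \<open>k\<close> entries must be given back; these are the
  second sum.\<close>

lemma bb_mu:
  assumes y: "ln L y = y" "la y = y" and n: "1 \<le> n" "1 \<le> k" "n + k \<le> L + 1"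
  shows "bb n (mu k y) = - mu k (bp n y) + (\<Sum>s<n. mu n (ins (int s) k y)) + (\<Sum>t<k. mu k (ins (int t) n y))"
proof -
  define L' where "L' = L + 1 - k"
  define K where "K = L + 1 - n - k"
  have K: "L + 1 - n = k + K" "L' + 1 - n = Suc K" using n by (auto simp: K_def L'_def)
  have ly: "ln L' (mu k y) = mu k y"
    using ln_mu[OF y(1), of k] n by (simp add: L'_def Suc_diff_le)
  have S: "(\<Sum>s<n. mu n (ins (int s) k y)) = mu n (mu k y) + (\<Sum>s\<in>{1..<n}. mu n (rt (int s) (mu k y)))"
  proof -
    have "(\<Sum>s<n. mu n (ins (int s) k y)) = (\<Sum>s\<in>{0..<n}. mu n (rt (int s) (mu k y)))"
      by (simp add: ins_def rt_invariant[OF y(2)] atLeast0LessThan)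
    also have "\<dots> = mu n (mu k y) + (\<Sum>s\<in>{1..<n}. mu n (rt (int s) (mu k y)))"
      using n by (subst sum.atLeast_Suc_lessThan) (auto simp: rt_0 wop_Q[OF wop_mu])
    finally show ?thesis .
  qed
  have "mu k (bp n y) = (\<Sum>i<k + K. mu k (ins (int i) n y))"
    unfolding bp_ln[OF y(1)] K by (simp add: mu_simps)
  also have "\<dots> = (\<Sum>t<k. mu k (ins (int t) n y)) + (\<Sum>i<K. mu k (ins (int (k + i)) n y))"
    by (induction K) (auto simp: add.assoc)
  also have "(\<Sum>i<K. mu k (ins (int (k + i)) n y)) = - (\<Sum>i<K. ins (int (Suc i)) n (mu k y))"
    unfolding sum_negf[symmetric]
  proof (rule sum.cong[OF refl])
    fix i assume "i \<in> {..<K}"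
    then show "mu k (ins (int (k + i)) n y) = - ins (int (Suc i)) n (mu k y)"
      using mu_ins_disjoint[OF y(1), of k "k + i" n] n by (auto simp: K_def)
  qed
  finally have M: "mu k (bp n y) = (\<Sum>t<k. mu k (ins (int t) n y)) - (\<Sum>i<K. ins (int (Suc i)) n (mu k y))"
    by simp
  have "bb n (mu k y) = (\<Sum>i<Suc K. ins (int i) n (mu k y)) + (\<Sum>s\<in>{1..<n}. mu n (rt (int s) (mu k y)))"
    unfolding bb_ln[OF ly] K ..
  also have "(\<Sum>i<Suc K. ins (int i) n (mu k y)) = mu n (mu k y) + (\<Sum>i<K. ins (int (Suc i)) n (mu k y))"
    by (simp add: sum.lessThan_Suc_shift ins_def rt_0 wop_Q[OF wop_mu] Q_wop[OF wop_mu] del: sum.lessThan_Suc of_nat_Suc)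
  finally show ?thesis unfolding M S by simp
qed

lemma ins_ins_disjoint:
  assumes x: "ln L x = x" and n: "1 \<le> n" "1 \<le> k" "i + n \<le> j" "j + k \<le> L"
  shows "ins (int i) n (ins (int j) k x) = - ins (int (j - n + 1)) k (ins (int i) n x)"
proof -
  define z where "z = rt (- int i) x"
  have z: "ln L z = z" using x by (simp add: z_def ln_rt)
  have "ins (int i) n (ins (int j) k x) = rt (int i) (mu n (ins (int (j - i)) k z))"
    unfolding ins_def z_def using n by (simp add: rt_rt of_nat_diff)
  also have "mu n (ins (int (j - i)) k z) = - ins (int (j - i - n + 1)) k (mu n z)"
    by (rule mu_ins_disjoint[OF z]) (use n in auto)
  also have "rt (int i) (- ins (int (j - i - n + 1)) k (mu n z)) = - ins (int (j - n + 1)) k (ins (int i) n x)"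
    unfolding ins_def z_def using n by (simp add: rt_rt of_nat_diff rt_simps algebra_simps)
  finally show ?thesis .
qed

end

text \<open>Stasheff's identities are required only modulo \<open>Nd\<close>, so that the same
  results apply to \<open>A\<close>, with zero null spaces, and to \<open>H(A)\<close>, presented by
  cycles modulo boundaries, where associativity holds up to a boundary. The output of the identity
  is a single entry, of degree \<open>sdeg xs - 3\<close>.\<close>

locale ainf_presentation = operations sc G Nd m
  for sc :: "'k::field_char_0 \<Rightarrow> 'a::ab_group_add \<Rightarrow> 'a" and G Nd m +
  assumes stasheff: "valid G xs \<Longrightarrow> xs \<noteq> [] \<Longrightarrow> 3 \<le> sdeg xs \<Longrightarrow>
    (\<Sum>i<length xs. \<Sum>j\<in>{1..length xs - i}. sc ((-1) ^ sdeg (take i xs))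
       (m (length xs - j + 1) (map snd (take i xs) @ m j (map snd (take j (drop i xs))) # map snd (drop (i + j) xs))))
     \<in> Nd (sdeg xs - 3)"
begin

text \<open>Every summand puts a value of degree \<open>sdeg ws - 3\<close> into the first slot of
  the same tensor. By linearity in this slot the sum is one tensor, whose first entry is Stasheff's
  sum for the first \<open>r\<close> entries and hence null.\<close>

lemma mu_ins_nested:
  assumes x: "ln L x = x" and r: "1 \<le> r" "r \<le> L"
  shows "(\<Sum>k\<in>{1..r}. \<Sum>i<r+1-k. mu (r + 1 - k) (ins (int i) k x)) = 0"
proof -
  have "(\<Sum>i<r. \<Sum>k\<in>{1..r-i}. mu (r - k + 1) (ins (int i) k x)) = 0"
  proof (rule ln_eqI[OF _ wop_0 _ x])
    show "wop (\<lambda>x. \<Sum>i<r. \<Sum>k\<in>{1..r-i}. mu (r - k + 1) (ins (int i) k x))"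
      by (rule wop_Sum[OF wop_Sum[OF wop_comp[OF wop_mu wop_ins]]])
    fix xs assume v: "vl xs" and L: "length xs = L"
    define ws ds where "ws = take r xs" and "ds = drop r xs"
    have xs: "xs = ws @ ds" "length ws = r" using r L by (auto simp: ws_def ds_def)
    have va: "valid G ws" "valid G ds" using v by (auto simp: xs(1) vl_def)
    define a where "a i k = m (length ws - k + 1) (map snd (take i ws) @ m k (map snd (take k (drop i ws))) # map snd (drop (i + k) ws))" for i k
    have vt: "valid G (take k zs)" "valid G (drop k zs)" if "valid G zs" for k zs
      using that by (auto simp: valid_def dest: in_set_takeD in_set_dropD)
    have summand: "mu (r - k + 1) (ins (int i) k (gn xs)) = scal ((-1) ^ sdeg (take i ws)) (Q (gn ([] @ (sdeg ws - 3, a i k) # ds)))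
        \<and> a i k \<in> G (sdeg ws - 3) \<and> (sdeg ws < 3 \<longrightarrow> a i k = 0)"
      if i: "i < r" and k: "k \<in> {1..r-i}" for i k
    proof -
      define us bs vs where "us = take i ws" and "bs = take k (drop i ws)" and "vs = drop (i + k) ws"
      have ws: "ws = us @ bs @ vs"
        unfolding us_def bs_def vs_def by (metis append_take_drop_id drop_drop add.commute)
      have len: "length us = i" "length bs = k" "length vs = r - i - k"
        using i k xs by (auto simp: us_def bs_def vs_def)
      have bn: "bs \<noteq> []" using len k by auto
      have vv: "valid G us" "valid G bs" "valid G vs" using va ws by auto
      have mb: "valid G [Defs.mapp m bs]" using mapp_in[of bs] vv bn by auto
      let ?B = "us @ Defs.mapp m bs # vs"
      have B: "length ?B = r - k + 1" "length ws - k + 1 = r - k + 1" using len i k xs by auto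
      have aB: "a i k = m (length ?B) (map snd ?B)"
        unfolding a_def us_def[symmetric] bs_def[symmetric] vs_def[symmetric] B by (simp add: mapp_eq len)
      have "ins (int i) k (gn xs) = scal ((-1) ^ sdeg us) (Q (gn (?B @ ds)))"
        using ins_gn[of us bs "vs @ ds"] v bn len by (simp add: xs(1) ws)
      then have 1: "mu (r - k + 1) (ins (int i) k (gn xs)) = scal ((-1) ^ sdeg us) (Q (gn (Defs.mapp m ?B # ds)))"
        using mu_gn[of ?B ds] B vv mb va by (simp add: mu_simps wop_Q[OF wop_mu] vl_def)
      show ?thesis
      proof (cases "2 \<le> sdeg bs")
        case True
        then have sB: "sdeg ?B = sdeg ws - 1" by (simp add: ws mapp_eq)
        have "Defs.mapp m ?B = (sdeg ws - 3, a i k)" unfolding mapp_eq[of m ?B] aB sB by simp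
        moreover have "a i k \<in> G (sdeg ws - 3)"
          using mapp_in[of ?B] vv mb \<open>Defs.mapp m ?B = _\<close> by simp
        moreover have "sdeg ws < 3 \<longrightarrow> a i k = 0"
        proof
          assume "sdeg ws < 3"
          then have "sdeg ?B < 2" using sB by linarith
          then show "a i k = 0" unfolding aB using m_junk[of ?B] vv mb by (simp del: sdeg_simps)
        qed
        ultimately show ?thesis unfolding 1 by (simp add: us_def)
      next
        case False
        then have "m (length bs) (map snd bs) = 0" using vv bn by (intro m_junk) auto
        then have a0: "a i k = 0"
          unfolding a_def us_def[symmetric] bs_def[symmetric] vs_def[symmetric]
        proof -
          have "length (map snd us) + length (map snd vs) + 1 = length ws - k + 1" using len i k xs(2) by simp arith
          from m_zero[OF this] show "m (length ws - k + 1) (map snd us @ m k (map snd bs) # map snd vs) = 0"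
            using \<open>m (length bs) (map snd bs) = 0\<close> len(2) by simp
        qed
        then have "Q (gn (Defs.mapp m ?B # ds)) = 0"
          unfolding mapp_eq[of m ?B] aB[symmetric] a0 using Q_zero[of "[]" ds] va by simp
        moreover have "Q (gn ([] @ (sdeg ws - 3, a i k) # ds)) = 0"
          using Q_zero[of "[]" ds] va a0 by simp
        ultimately show ?thesis unfolding 1 by (simp add: a0 G_zero)
      qed
    qed
    let ?I = "SIGMA i:{..<r}. {1..r-i}"
    let ?c = "\<lambda>(i,k). (-1::'k) ^ sdeg (take i ws)"
    have "(\<Sum>i<r. \<Sum>k\<in>{1..r-i}. mu (r - k + 1) (ins (int i) k (gn xs))) =
       (\<Sum>i<r. \<Sum>k\<in>{1..r-i}. scal ((-1) ^ sdeg (take i ws)) (Q (gn ([] @ (sdeg ws - 3, a i k) # ds))))"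
      using summand by (intro sum.cong refl) auto
    also have "\<dots> = (\<Sum>p\<in>?I. scal (?c p) (Q (gn ([] @ (sdeg ws - 3, (\<lambda>(i,k). a i k) p) # ds))))"
      by (subst sum.Sigma) (auto simp: case_prod_unfold)
    also have "\<dots> = Q (gn ([] @ (sdeg ws - 3, \<Sum>p\<in>?I. sc (?c p) ((\<lambda>(i,k). a i k) p)) # ds))"
      by (rule Q_sum_slot(1)[symmetric]) (use va summand in auto)
    also have "\<dots> = 0"
    proof (cases "3 \<le> sdeg ws")
      case True
      have "(\<Sum>p\<in>?I. sc (?c p) ((\<lambda>(i,k). a i k) p)) = (\<Sum>i<r. \<Sum>k\<in>{1..r-i}. sc ((-1) ^ sdeg (take i ws)) (a i k))"
        by (subst sum.Sigma) (auto simp: case_prod_unfold)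
      also have "\<dots> \<in> Nd (sdeg ws - 3)"
      proof -
        have "ws \<noteq> []" using xs(2) r by auto
        then show ?thesis using stasheff[of ws] va(1) True unfolding a_def xs(2) by blast
      qed
      finally show ?thesis
        by (intro Q_N Q_sum_slot(2)[of "[]" "[]"]) (use va summand in auto)
    next
      \<comment> \<open>The degree is too low for Stasheff's identity, but then each value
        \<open>a i k\<close> is already zero.\<close>
      case False
      then have "sc (?c p) ((\<lambda>(i,k). a i k) p) = 0" if "p \<in> ?I" for p using summand that by auto
      then have "(\<Sum>p\<in>?I. sc (?c p) ((\<lambda>(i,k). a i k) p)) = 0" by (intro sum.neutral) blast
      then show ?thesis using Q_zero[of "[]" ds] va by simp
    qed
    finally show "(\<Sum>i<r. \<Sum>k\<in>{1..r-i}. mu (r - k + 1) (ins (int i) k (gn xs))) = 0" .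
  qed
  also have "(\<Sum>i<r. \<Sum>k\<in>{1..r-i}. mu (r - k + 1) (ins (int i) k x)) =
     (\<Sum>k\<in>{1..r}. \<Sum>i<r+1-k. mu (r - k + 1) (ins (int i) k x))"
    unfolding sum.Sigma[OF finite_lessThan ballI[OF finite_atLeastAtMost]]
      sum.Sigma[OF finite_atLeastAtMost ballI[OF finite_lessThan]]
    by (rule sum.reindex_bij_witness[of _ "\<lambda>(k,i). (i,k)" "\<lambda>(i,k). (k,i)"]) auto
  also have "\<dots> = (\<Sum>k\<in>{1..r}. \<Sum>i<r+1-k. mu (r + 1 - k) (ins (int i) k x))"
    by (intro sum.cong refl) (simp add: Suc_diff_le)
  finally show ?thesis .
qed

lemma reflect: "(\<Sum>k\<in>{1..r::nat}. f (r + 1 - k) k) = (\<Sum>k\<in>{1..r}. f k (r + 1 - k))"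
  by (rule sum.reindex_bij_witness[of _ "\<lambda>k. r + 1 - k" "\<lambda>k. r + 1 - k"]) auto

text \<open>This is the component of \<open>b'\<^sup>2\<close> that shortens tensors by
  \<open>r - 1\<close>. Terms on disjoint blocks cancel in pairs under exchange of the two
  operations, that is, of \<open>k\<close> and \<open>r + 1 - k\<close>; nested terms cancel by
  Stasheff's identity, rotated to each starting place.\<close>

lemma bp_bp: "(\<Sum>k\<in>{1..r}. bp (r + 1 - k) (bp k x)) = 0"
proof (rule ln_cong_all[OF wop_Sum[OF wop_comp[OF wop_bp wop_bp]] wop_0])
  fix L x assume x: "ln L x = x"
  show "(\<Sum>k\<in>{1..r}. bp (r + 1 - k) (bp k x)) = 0"
  proof (cases "r \<le> L")
    case False
    have "bp (r + 1 - k) (bp k x) = 0" if "k \<in> {1..r}" for k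
    proof (cases "k \<le> L")
      case True
      show ?thesis using bp_short[OF ln_bp[OF x True]] False that by auto
    next
      case False
      then show ?thesis using bp_short[OF x, of k] by (simp add: bp_simps)
    qed
    then show ?thesis by simp
  next
    case True
    \<comment> \<open>\<open>M\<close> is the length of the final tensor, and also the number of
      places where the outer operation can start.\<close>
    define M where "M = L + 1 - r"
    let ?t = "\<lambda>n k i j. ins (int i) n (ins (int j) k x)"
    have split: "bp (r + 1 - k) (bp k x) =
        (\<Sum>i<M. \<Sum>j<i. ?t (r + 1 - k) k i j) + (\<Sum>i<M. \<Sum>s<r+1-k. ?t (r + 1 - k) k i (i + s))
        - (\<Sum>i<M. \<Sum>j<i. ?t k (r + 1 - k) i j)" if k: "k \<in> {1..r}" for k
    proof -
      define n where "n = r + 1 - k"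
      have n: "1 \<le> n" "n + k = r + 1" "k \<le> L" "1 \<le> k" using k True by (auto simp: n_def)
      have e: "L + 1 - k + 1 - n = M" "L + 1 - k = M + n - 1" using n True by (auto simp: M_def)
      have "bp n (bp k x) = (\<Sum>i<M. \<Sum>j<M + n - 1. ?t n k i j)"
        using bp_ln[OF ln_bp[OF x n(3)], of n, unfolded e(1)] bp_ln[OF x, of k, unfolded e(2)]
        by (simp add: ins_simps)
      also have "\<dots> = (\<Sum>i<M. (\<Sum>j<i. ?t n k i j) + (\<Sum>s<n. ?t n k i (i + s)) + (\<Sum>j\<in>{i+n..<M+n-1}. ?t n k i j))"
      proof (rule sum.cong[OF refl])
        fix i assume "i \<in> {..<M}"
        then have eq: "{..<M + n - 1} = ({..<i} \<union> {i..<i+n}) \<union> {i+n..<M+n-1}" using n by auto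
        have "(\<Sum>j<M + n - 1. ?t n k i j) = (\<Sum>j\<in>{..<i} \<union> {i..<i+n}. ?t n k i j) + (\<Sum>j\<in>{i+n..<M+n-1}. ?t n k i j)"
          unfolding eq by (rule sum.union_disjoint) auto
        also have "(\<Sum>j\<in>{..<i} \<union> {i..<i+n}. ?t n k i j) = (\<Sum>j<i. ?t n k i j) + (\<Sum>j\<in>{i..<i+n}. ?t n k i j)"
          by (rule sum.union_disjoint) auto
        also have "(\<Sum>j\<in>{i..<i+n}. ?t n k i j) = (\<Sum>s<n. ?t n k i (i + s))"
          by (rule sum.reindex_bij_witness[of _ "\<lambda>s. i + s" "\<lambda>j. j - i"]) auto
        finally show "(\<Sum>j<M + n - 1. ?t n k i j) = 
          (\<Sum>j<i. ?t n k i j) + (\<Sum>s<n. ?t n k i (i + s)) + (\<Sum>j\<in>{i+n..<M+n-1}. ?t n k i j)" .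
      qed
      also have "\<dots> = (\<Sum>i<M. \<Sum>j<i. ?t n k i j) + (\<Sum>i<M. \<Sum>s<n. ?t n k i (i + s)) + (\<Sum>i<M. \<Sum>j\<in>{i+n..<M+n-1}. ?t n k i j)"
        by (simp add: sum.distrib)
      also have "(\<Sum>i<M. \<Sum>j\<in>{i+n..<M+n-1}. ?t n k i j) = (\<Sum>i<M. \<Sum>j\<in>{i+n..<M+n-1}. - ?t k n (j - n + 1) i)"
        by (intro sum.cong refl ins_ins_disjoint[OF x]) (use n True in \<open>auto simp: M_def\<close>)
      also have "\<dots> = - (\<Sum>i<M. \<Sum>j\<in>{i+n..<M+n-1}. ?t k n (j - n + 1) i)"
        by (simp only: sum_negf)
      also have "(\<Sum>i<M. \<Sum>j\<in>{i+n..<M+n-1}. ?t k n (j - n + 1) i) = (\<Sum>i<M. \<Sum>j<i. ?t k n i j)"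
        unfolding sum.Sigma[OF finite_lessThan ballI[OF finite_atLeastLessThan]]
          sum.Sigma[OF finite_lessThan ballI[OF finite_lessThan]]
        by (rule sum.reindex_bij_witness[of _ "\<lambda>(i,j). (j, i + n - 1)" "\<lambda>(i,j). (j - n + 1, i)"])
          (use n in \<open>auto simp: \<close>)
      finally show ?thesis unfolding n_def[symmetric] by simp
    qed
    have z: "(\<Sum>k\<in>{1..r}. \<Sum>s<r+1-k. ?t (r + 1 - k) k i (i + s)) = 0" if "1 \<le> r" for i
    proof -
      have e: "?t n k i (i + s) = rt (int i) (mu n (ins (int s) k (rt (- int i) x)))" for n k s
        by (simp add: ins_def rt_rt algebra_simps)
      have "ln L (rt (- int i) x) = rt (- int i) x" using x by (simp add: ln_rt)
      from mu_ins_nested[OF this that True] show ?thesis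
        unfolding e by (simp only: lop_sum[OF lop_rt, symmetric] lop_zero[OF lop_rt])
    qed
    have "(\<Sum>k\<in>{1..r}. bp (r + 1 - k) (bp k x)) =
        (\<Sum>k\<in>{1..r}. \<Sum>i<M. \<Sum>j<i. ?t (r + 1 - k) k i j) + (\<Sum>k\<in>{1..r}. \<Sum>i<M. \<Sum>s<r+1-k. ?t (r + 1 - k) k i (i + s))
        - (\<Sum>k\<in>{1..r}. \<Sum>i<M. \<Sum>j<i. ?t k (r + 1 - k) i j)"
      by (rule trans[OF sum.cong[OF refl split]]) (simp_all only: sum.distrib sum_subtractf)
    also have "(\<Sum>k\<in>{1..r}. \<Sum>i<M. \<Sum>j<i. ?t k (r + 1 - k) i j) = (\<Sum>k\<in>{1..r}. \<Sum>i<M. \<Sum>j<i. ?t (r + 1 - k) k i j)"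
      by (rule reflect[symmetric])
    also have "(\<Sum>k\<in>{1..r}. \<Sum>i<M. \<Sum>s<r+1-k. ?t (r + 1 - k) k i (i + s)) = 0"
      using z by (cases "1 \<le> r") (simp_all add: sum.swap[of _ "{..<M}"])
    finally show ?thesis by simp
  qed
qed

text \<open>Here \<open>b\<^sup>2(1 - \<lambda>) = 0\<close>, so in characteristic zero it suffices to treat rotation invariant tensors;
  on these \<open>b\<^sub>k = (N + k - 1) m\<^sub>k\<close>, with \<open>m\<^sub>k\<close> applied at the front, and Stasheff sums remain.\<close>

lemma bb_bb: "(\<Sum>k\<in>{1..r}. bb (r + 1 - k) (bb k x)) = 0"
proof -
  let ?B = "\<lambda>x. \<Sum>k\<in>{1..r}. bb (r + 1 - k) (bb k x)"
  have wB: "wop ?B" by (rule wop_Sum[OF wop_comp[OF wop_bb wop_bb]])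
  have la: "?B (la x) = ?B x" for x
  proof -
    have "bb n (bb k (la x)) = bb n (bb k x) - bp n (bp k x) + la (bp n (bp k x))" for n k
      by (simp add: bb_la bb_simps)
    then have "?B (la x) = ?B x - (\<Sum>k\<in>{1..r}. bp (r + 1 - k) (bp k x)) + la (\<Sum>k\<in>{1..r}. bp (r + 1 - k) (bp k x))"
      by (simp only: sum.distrib sum_subtractf lop_sum[OF lop_la])
    then show ?thesis unfolding bp_bp lop_zero[OF lop_la] by simp
  qed
  have inv: "?B y = 0" if y: "ln L y = y" "la y = y" for L y
  proof (cases "r \<le> L")
    case False
    have "bb (r + 1 - k) (bb k y) = 0" if k: "k \<in> {1..r}" for k
    proof (cases "k \<le> L")
      case True
      have l: "ln (L + 1 - k) (mu k y) = mu k y" using ln_mu[OF y(1) True] True by (simp add: Suc_diff_le)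
      then have "ln (L + 1 - k) (bb k y) = bb k y"
        unfolding bb_invariant[OF y True] by (simp add: lop_add[OF wop_lop[OF wop_ln]] ln_N lop_scal[OF wop_lop[OF wop_ln]])
      then show ?thesis using bb_short False k by auto
    next
      case False
      then show ?thesis using bb_short[OF y(1), of k] by (simp add: bb_simps)
    qed
    then show ?thesis by simp
  next
    case True
    let ?c = "\<lambda>n. of_nat (n - 1) :: 'k"
    let ?S = "\<lambda>n k. \<Sum>s<n. mu n (ins (int s) k y)"
    \<comment> \<open>Summed over \<open>k\<close>, the difference in the second line cancels by
      reflection. Reflection also combines the coefficients \<open>k - 1\<close> and
      \<open>r - k\<close> of the nested terms into the constant \<open>r - 1\<close>.\<close>
    have t: "bb (r + 1 - k) (bb k y) = bp (r + 1 - k) (bp k y)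
       + (scal (?c (r + 1 - k)) (mu (r + 1 - k) (N (mu k y))) - scal (?c k) (mu k (N (mu (r + 1 - k) y))))
       + (scal (?c k) (?S (r + 1 - k) k) + scal (?c k) (?S k (r + 1 - k)))" if k: "k \<in> {1..r}" for k
    proof -
      define n where "n = r + 1 - k"
      have n: "1 \<le> n" "n \<le> L" "n + k \<le> L + 1" "k \<le> L" "1 \<le> k" "n \<le> L + 1 - k" using k True by (auto simp: n_def)
      have l: "ln (L + 1 - k) (mu k y) = mu k y" using ln_mu[OF y(1) n(4)] n by (simp add: Suc_diff_le)
      then have l2: "ln (L + 1 - k) (N (mu k y)) = N (mu k y)" by (simp add: ln_N)
      have "bb n (bb k y) = bb n (N (mu k y)) + scal (?c k) (bb n (mu k y))"
        unfolding bb_invariant[OF y n(4)] by (simp add: bb_simps)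
      also have "bb n (N (mu k y)) = bp n (N (mu k y)) + scal (?c n) (mu n (N (mu k y)))"
        unfolding bb_invariant[OF l2 la_N n(6)] bp_invariant[OF l2 la_N n(6)] ..
      also have "bb n (mu k y) = - mu k (N (mu n y)) + ?S n k + ?S k n"
        unfolding bb_mu[OF y n(1) n(5) n(3)] bp_invariant[OF y n(2)] ..
      also have "N (mu k y) = bp k y" using bp_invariant[OF y n(4)] by simp
      finally show ?thesis unfolding n_def[symmetric]
        by (simp add: ev.scale_right_distrib ev.scale_right_diff_distrib bp_invariant[OF y n(4)])
    qed
    have "?B y = (\<Sum>k\<in>{1..r}. bp (r + 1 - k) (bp k y))
       + ((\<Sum>k\<in>{1..r}. scal (?c (r + 1 - k)) (mu (r + 1 - k) (N (mu k y)))) - (\<Sum>k\<in>{1..r}. scal (?c k) (mu k (N (mu (r + 1 - k) y)))))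
       + ((\<Sum>k\<in>{1..r}. scal (?c k) (?S (r + 1 - k) k)) + (\<Sum>k\<in>{1..r}. scal (?c k) (?S k (r + 1 - k))))"
      unfolding sum.distrib[symmetric] sum_subtractf[symmetric] by (rule sum.cong[OF refl t])
    also have "(\<Sum>k\<in>{1..r}. scal (?c k) (mu k (N (mu (r + 1 - k) y)))) = (\<Sum>k\<in>{1..r}. scal (?c (r + 1 - k)) (mu (r + 1 - k) (N (mu k y))))"
      by (rule reflect[symmetric])
    also have "(\<Sum>k\<in>{1..r}. scal (?c k) (?S k (r + 1 - k))) = (\<Sum>k\<in>{1..r}. scal (?c (r + 1 - k)) (?S (r + 1 - k) k))"
      by (rule reflect[symmetric])
    also have "(\<Sum>k\<in>{1..r}. scal (?c k) (?S (r + 1 - k) k)) + (\<Sum>k\<in>{1..r}. scal (?c (r + 1 - k)) (?S (r + 1 - k) k))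
       = (\<Sum>k\<in>{1..r}. scal (?c r) (?S (r + 1 - k) k))"
      unfolding sum.distrib[symmetric]
    proof (rule sum.cong[OF refl])
      fix k assume "k \<in> {1..r}"
      then have "?c k + ?c (r + 1 - k) = ?c r"
        unfolding of_nat_add[symmetric] by (intro arg_cong[where f=of_nat]) auto
      then show "scal (?c k) (?S (r + 1 - k) k) + scal (?c (r + 1 - k)) (?S (r + 1 - k) k) = scal (?c r) (?S (r + 1 - k) k)"
        by (simp only: ev.scale_left_distrib[symmetric])
    qed
    also have "\<dots> = scal (?c r) (\<Sum>k\<in>{1..r}. ?S (r + 1 - k) k)"
      by (simp only: ev.scale_sum_right)
    also have "\<dots> = 0"
    proof (cases "1 \<le> r")
      case r: True
      show ?thesis unfolding mu_ins_nested[OF y(1) r True] by simp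
    qed simp
    finally show ?thesis unfolding bp_bp by simp
  qed
  show ?thesis
  proof (rule ln_cong_all[OF wB wop_0])
    fix L x assume x: "ln L x = x"
    have 1: "?B (rt (int s) x) = ?B x" for s
    proof (induction s)
      case 0 then show ?case using ln_Q[OF x] by (simp add: rt_0)
    next
      case (Suc s) then show ?case using la[of "rt (int s) x"] by (simp add: la_rt add.commute)
    qed
    have "0 = ?B (N x)" using inv[of L "N x"] x la_N by (simp add: ln_N)
    also have "\<dots> = (\<Sum>s<L. ?B (rt (int s) x))" unfolding N_ln[OF x] by (rule lop_sum[OF wop_lop[OF wB]])
    also have "\<dots> = scal (of_nat L) (?B x)" unfolding 1 by (simp add: ev.sum_constant_scale)
    finally have "L = 0 \<or> ?B x = 0" by simp
    moreover have "x = 0" if "L = 0"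
    proof -
      have "ln 0 x = 0" by (rule wop_eqI[OF wop_ln wop_0]) (auto simp: ln_gn vl_def)
      then show ?thesis using x that by simp
    qed
    ultimately show "?B x = 0" using lop_zero[OF wop_lop[OF wB]] by blast
  qed
qed

end

section \<open>Vanishing in positive weight\<close>

context graded_presentation
begin

lemmas lop_dg = wop_lop[OF wop_dg]
lemmas dg_simps = lop_simps[OF lop_dg]

lemma dg_comm: "dg \<phi> (dg \<psi> x) = dg \<psi> (dg \<phi> x)"
  by (simp add: dg_dg mult.commute)

lemma ln_dg: "ln L (dg \<phi> x) = dg \<phi> (ln L x)"
  unfolding ln_def by (rule dg_comm)

lemma dg_ln_cong:
  assumes x: "ln L x = x" and "\<And>ds. length ds = L \<Longrightarrow> \<phi> ds = \<psi> ds"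
  shows "dg \<phi> x = dg \<psi> x"
  by (rule ln_eqI[OF wop_dg wop_dg _ x]) (simp add: dg_gn assms)

lemma dg_const: "Q x = x \<Longrightarrow> dg (\<lambda>_. c) x = scal c x"
  using wop_eqI[OF wop_dg wop_smult[OF wop_id], of "\<lambda>_. c" c x] by (simp add: dg_gn)

lemma dg_add: "dg \<phi> x + dg \<psi> x = dg (\<lambda>ds. \<phi> ds + \<psi> ds) x"
  by (rule wop_eqI[OF wop_plus[OF wop_dg wop_dg] wop_dg]) (simp add: dg_gn ev.scale_left_distrib)

lemma dg_sum: "(\<Sum>i\<in>I. dg (\<phi> i) x) = dg (\<lambda>ds. \<Sum>i\<in>I. \<phi> i ds) x"
  by (rule wop_eqI[OF wop_Sum[OF wop_dg] wop_dg]) (simp add: dg_gn ev.scale_sum_left)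

lemma dg_N:
  assumes "\<And>d ds. \<phi> (ds @ [d]) = \<phi> (d # ds)"
  shows "dg \<phi> (N x) = N (dg \<phi> x)"
proof (rule ln_cong_all[OF wop_comp[OF wop_dg wop_N] wop_comp[OF wop_N wop_dg]])
  fix L x assume x: "ln L x = x"
  then have "ln L (dg \<phi> x) = dg \<phi> x" by (simp add: ln_dg)
  then show "dg \<phi> (N x) = N (dg \<phi> x)"
    using x by (simp add: N_ln dg_simps dg_rt[OF assms])
qed

definition invlen :: "('k,'a) ev \<Rightarrow> ('k,'a) ev" where
  "invlen = dg (\<lambda>ds. 1 / of_nat (length ds))"

definition totdeg :: "('k,'a) ev \<Rightarrow> ('k,'a) ev" where
  "totdeg = dg (\<lambda>ds. of_nat (sum_list ds))"

definition hddeg :: "('k,'a) ev \<Rightarrow> ('k,'a) ev" where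
  "hddeg = dg (\<lambda>ds. of_nat (hd ds))"

text \<open>A contracting homotopy of the rows, up to the averaging operator.\<close>

definition rowh :: "('k,'a) ev \<Rightarrow> ('k,'a) ev" where
  "rowh = fam (\<lambda>L x. scal (- 1 / of_nat L) (\<Sum>j<L. scal (of_nat j) (rt (int j) x)))"

lemma wop_rowh_aux: "wop (\<lambda>x. scal c (\<Sum>j<L. scal (of_nat j) (rt (int j) x)))"
  by (rule wop_smult[OF wop_Sum[OF wop_smult[OF wop_rt]]])

lemma wop_rowh: "wop rowh"
  unfolding rowh_def by (rule wop_fam[OF wop_rowh_aux])

lemmas lop_rowh = wop_lop[OF wop_rowh]
lemmas rowh_simps = lop_simps[OF lop_rowh]

lemma rowh_ln: "ln L x = x \<Longrightarrow> rowh x = scal (- 1 / of_nat L) (\<Sum>j<L. scal (of_nat j) (rt (int j) x))"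
  unfolding rowh_def by (rule fam_ln[OF wop_rowh_aux])

lemma invlen_ln: "ln L x = x \<Longrightarrow> invlen x = scal (1 / of_nat L) x"
  unfolding invlen_def using dg_ln_cong[of L x "\<lambda>ds. 1 / of_nat (length ds)" "\<lambda>_. 1 / of_nat L"] dg_const[of x]
  by (simp add: ln_Q)

lemma ln_0: "ln 0 x = 0"
  by (rule wop_eqI[OF wop_ln wop_0]) (auto simp: ln_gn vl_def)

text \<open>Summation by parts: shifting the index costs one copy of \<open>N x\<close>, and the end
  term is \<open>L\<close> times \<open>x\<close> because a full turn is trivial.\<close>

lemma la_rowh_ln:
  assumes x: "ln L x = x"
  shows "scal (- 1 / of_nat L) (\<Sum>j<L. scal (of_nat j) (rt (int j + 1) x)) = rowh x - x + N (invlen x)"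
proof (cases "L = 0")
  case True
  then have "x = 0" using x ln_0 by simp
  then show ?thesis by (simp add: True rowh_simps N_simps invlen_def dg_simps)
next
  case False
  let ?T = "\<Sum>j<L. scal (of_nat j) (rt (int j) x)"
  have "(\<Sum>j<Suc L. scal (of_nat j) (rt (int j) x)) = (\<Sum>j<L. scal (of_nat (Suc j)) (rt (int j + 1) x))"
    by (subst sum.lessThan_Suc_shift) (simp add: add.commute)
  also have "\<dots> = (\<Sum>j<L. scal (of_nat j) (rt (int j + 1) x)) + (\<Sum>j<L. rt (int j + 1) x)"
    by (simp add: ev.scale_left_distrib sum.distrib add.commute)
  also have "(\<Sum>j<L. rt (int j + 1) x) = N x" by (simp add: sum_rt_shift[OF x] N_ln[OF x])
  finally have "(\<Sum>j<L. scal (of_nat j) (rt (int j + 1) x)) = ?T + scal (of_nat L) x - N x"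
    by (simp add: rt_length_nat[OF x] ln_Q[OF x] eq_diff_eq)
  then show ?thesis using False
    by (simp add: rowh_ln[OF x] invlen_ln[OF x] N_simps ev.scale_right_distrib ev.scale_right_diff_distrib)
qed

lemma la_rowh: "la (rowh x) = rowh x - Q x + N (invlen x)"
proof (rule ln_cong_all[OF wop_comp[OF wop_la wop_rowh] wop_plus[OF wop_sub[OF wop_rowh wop_id] wop_comp[OF wop_N]]])
  fix L x assume x: "ln L x = x"
  have "la (rowh x) = scal (- 1 / of_nat L) (\<Sum>j<L. scal (of_nat j) (rt (int j + 1) x))"
    unfolding rowh_ln[OF x] lop_scal[OF lop_la] lop_sum[OF lop_la] la_rt ..
  then show "la (rowh x) = rowh x - Q x + N (invlen x)"
    by (simp only: la_rowh_ln[OF x] ln_Q[OF x])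
qed (simp add: invlen_def wop_dg)

lemma rowh_la: "rowh (la x) = rowh x - Q x + N (invlen x)"
proof (rule ln_cong_all[OF wop_comp[OF wop_rowh wop_la] wop_plus[OF wop_sub[OF wop_rowh wop_id] wop_comp[OF wop_N]]])
  fix L x assume x: "ln L x = x"
  then have "ln L (la x) = la x" by (simp add: ln_la)
  from rowh_ln[OF this] show "rowh (la x) = rowh x - Q x + N (invlen x)"
    by (simp add: la_rowh_ln[OF x, symmetric] ln_Q[OF x] rt_la)
qed (simp add: invlen_def wop_dg)

lemma dg_rowh:
  assumes "\<And>d ds. \<phi> (ds @ [d]) = \<phi> (d # ds)"
  shows "dg \<phi> (rowh x) = rowh (dg \<phi> x)"
proof (rule ln_cong_all[OF wop_comp[OF wop_dg wop_rowh] wop_comp[OF wop_rowh wop_dg]])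
  fix L x assume x: "ln L x = x"
  then have "ln L (dg \<phi> x) = dg \<phi> x" by (simp add: ln_dg)
  then show "dg \<phi> (rowh x) = rowh (dg \<phi> x)"
    using x by (simp add: rowh_ln dg_simps dg_rt[OF assms])
qed

lemma N_N_invlen: "N (N (invlen x)) = N x"
proof (rule ln_cong_all[OF wop_comp[OF wop_N wop_comp[OF wop_N]] wop_N])
  fix L x assume x: "ln L x = x"
  have n: "ln L (N x) = N x" using x by (simp add: ln_N)
  have "N (N x) = scal (of_nat L) (N x)"
    by (simp add: N_ln[OF n] rt_N ev.sum_constant_scale)
  moreover have "x = 0" if "L = 0" using that x ln_0 by simp
  ultimately show "N (N (invlen x)) = N x"
    by (cases "L = 0") (simp add: invlen_def N_simps dg_simps,
      simp add: invlen_ln[OF x] N_simps)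
qed (simp add: invlen_def wop_dg)

text \<open>Rotating there and back brings entry \<open>s\<close> to the front in between, and the
  two Koszul signs are equal.\<close>

lemma rt_hddeg:
  assumes x: "ln L x = x" and s: "s < L"
  shows "rt (int s) (hddeg (rt (- int s) x)) = dg (\<lambda>ds. of_nat (ds ! s)) x"
  unfolding hddeg_def
proof (rule ln_eqI[OF wop_comp[OF wop_rt wop_comp[OF wop_dg wop_rt]] wop_dg _ x])
  fix xs assume v: "vl xs" and L: "length xs = L"
  define us vs where "us = take s xs" and "vs = drop s xs"
  have xs: "xs = us @ vs" "length us = s" "vs \<noteq> []" using s L by (auto simp: us_def vs_def)
  have v2: "vl (us @ vs)" "vl (vs @ us)" using v xs by (auto simp: vl_def)
  have h: "hd (map fst (vs @ us)) = map fst xs ! s" using xs by (simp add: nth_append hd_map hd_conv_nth)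
  have e: "(-1::'k) ^ (sdeg us * sdeg vs) * (-1) ^ (sdeg vs * sdeg us) = 1"
    by (simp add: mult.commute flip: power_mult_distrib)
  show "rt (int s) (dg (\<lambda>ds. of_nat (hd ds)) (rt (- int s) (gn xs))) = dg (\<lambda>ds. of_nat (ds ! s)) (gn xs)"
  proof -
    have 1: "rt (- int s) (gn xs) = scal ((-1) ^ (sdeg us * sdeg vs)) (Q (gn (vs @ us)))"
      using rt_neg_append[OF v2(1)] xs by simp
    have 2: "rt (int s) (Q (gn (vs @ us))) = scal ((-1) ^ (sdeg vs * sdeg us)) (Q (gn xs))"
      using rt_append[OF v2(2)] xs by (simp add: wop_Q[OF wop_rt])
    have "rt (int s) (dg (\<lambda>ds. of_nat (hd ds)) (rt (- int s) (gn xs))) =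
      scal ((-1) ^ (sdeg us * sdeg vs) * (-1) ^ (sdeg vs * sdeg us) * of_nat (map fst xs ! s)) (Q (gn xs))"
      unfolding 1 lop_scal[OF lop_dg] dg_Qgn[OF v2(2)] h lop_scal[OF lop_rt] 2
      by (simp only: ev.scale_scale mult.assoc mult.left_commute mult.commute)
    then show ?thesis unfolding e dg_gn[OF v] by simp
  qed
qed

text \<open>On an invariant tensor the outer norm conjugates the degree of the first entry into the
  degree at each position, and these add up to the total degree.\<close>

lemma N_hddeg_N: "N (hddeg (N x)) = totdeg (N x)"
proof (rule ln_cong_all[OF wop_comp[OF wop_N wop_comp[OF _ wop_N]] wop_comp[OF _ wop_N]])
  fix L x assume x: "ln L x = x"
  define y where "y = N x"
  have y: "ln L y = y" "\<And>i. rt i y = y" using x by (simp_all add: y_def ln_N rt_N)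
  have "N (hddeg y) = (\<Sum>s<L. rt (int s) (hddeg (rt (- int s) y)))"
    using y by (subst N_ln[of L]) (simp_all add: hddeg_def ln_dg)
  also have "\<dots> = dg (\<lambda>ds. \<Sum>s<L. of_nat (ds ! s)) y"
    by (simp add: rt_hddeg[OF y(1)] dg_sum)
  also have "\<dots> = totdeg y" unfolding totdeg_def
    by (rule dg_ln_cong[OF y(1)]) (simp add: sum_list_sum_nth atLeast0LessThan)
  finally show "N (hddeg (N x)) = totdeg (N x)" by (simp add: y_def)
qed (simp_all add: hddeg_def totdeg_def wop_dg)

text \<open>Separates tensor length \<open>l\<close> and weight \<open>f\<close>. As every entry is
  shifted by one, the degree in \<open>T^c A[1]\<close> is \<open>l + f\<close>.\<close>

definition pj :: "int \<Rightarrow> int \<Rightarrow> ('k,'a) ev \<Rightarrow> ('k,'a) ev" where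
  "pj l f = dg (\<lambda>ds. if int (length ds) = l \<and> int (sum_list ds) = f then 1 else 0)"

lemma wop_pj: "wop (pj l f)" unfolding pj_def by (rule wop_dg)

lemmas lop_pj = wop_lop[OF wop_pj]
lemmas pj_simps = lop_simps[OF lop_pj]

lemma pj_pj: "pj l f (pj l' f' x) = (if l = l' \<and> f = f' then pj l f x else 0)"
proof (cases "l = l' \<and> f = f'")
  case True
  have "pj l f (pj l f x) = pj l f x"
    by (rule wop_eqI[OF wop_comp[OF wop_pj wop_pj] wop_pj])
      (auto simp: pj_def dg_gn dg_Qgn dg_simps)
  then show ?thesis using True by simp
next
  case False
  have "pj l f (pj l' f' x) = 0"
    by (rule wop_eqI[OF wop_comp[OF wop_pj wop_pj] wop_0])
      (use False in \<open>auto simp: pj_def dg_gn dg_Qgn dg_simps\<close>)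
  then show ?thesis using False by (simp split: if_split; blast)
qed

lemma pj_la: "pj l f (la x) = la (pj l f x)"
  unfolding pj_def by (rule dg_la) (simp add: add.commute)

lemma pj_N: "pj l f (N x) = N (pj l f x)"
  unfolding pj_def by (rule dg_N) (simp add: add.commute)

lemma pj_Q: "pj l f x = x \<Longrightarrow> Q x = x"
  using Q_wop[OF wop_pj, of l f x] by simp

lemma pj_zero: "l \<le> 0 \<or> f < 0 \<Longrightarrow> pj l f x = 0"
  by (rule wop_eqI[OF wop_pj wop_0]) (auto simp: pj_def dg_gn vl_def)

lemma totdeg_pj: "pj l (int k) x = x \<Longrightarrow> totdeg x = scal (of_nat k) x"
proof -
  assume x: "pj l (int k) x = x"
  have "totdeg (pj l (int k) x) = scal (of_nat k) (pj l (int k) x)"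
    by (rule wop_eqI[OF wop_comp[OF _ wop_pj] wop_smult[OF wop_pj]])
      (auto simp: totdeg_def wop_dg pj_def dg_gn dg_Qgn dg_simps)
  with x show ?thesis by simp
qed

end

context operations
begin

lemma dg_ins:
  assumes rot: "\<And>d ds. \<phi> (ds @ [d]) = \<phi> (d # ds)" "\<And>d ds. \<psi> (ds @ [d]) = \<psi> (d # ds)"
    and mu: "\<And>x. dg \<phi> (mu n x) = mu n (dg \<psi> x)"
  shows "dg \<phi> (ins i n x) = ins i n (dg \<psi> x)"
  unfolding ins_def by (simp add: dg_rt[OF rot(1)] mu dg_rt[OF rot(2)])

lemma dg_bp:
  assumes rot: "\<And>d ds. \<phi> (ds @ [d]) = \<phi> (d # ds)" "\<And>d ds. \<psi> (ds @ [d]) = \<psi> (d # ds)"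
    and mu: "\<And>x. dg \<phi> (mu n x) = mu n (dg \<psi> x)"
  shows "dg \<phi> (bp n x) = bp n (dg \<psi> x)"
proof (rule ln_cong_all[OF wop_comp[OF wop_dg wop_bp] wop_comp[OF wop_bp wop_dg]])
  fix L x assume x: "ln L x = x"
  then have "ln L (dg \<psi> x) = dg \<psi> x" by (simp add: ln_dg)
  then show "dg \<phi> (bp n x) = bp n (dg \<psi> x)"
    using x by (simp add: bp_ln dg_simps dg_ins[OF rot mu])
qed

lemma dg_bb:
  assumes rot: "\<And>d ds. \<phi> (ds @ [d]) = \<phi> (d # ds)" "\<And>d ds. \<psi> (ds @ [d]) = \<psi> (d # ds)"
    and mu: "\<And>x. dg \<phi> (mu n x) = mu n (dg \<psi> x)"
  shows "dg \<phi> (bb n x) = bb n (dg \<psi> x)"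
proof (rule ln_cong_all[OF wop_comp[OF wop_dg wop_bb] wop_comp[OF wop_bb wop_dg]])
  fix L x assume x: "ln L x = x"
  then have "ln L (dg \<psi> x) = dg \<psi> x" by (simp add: ln_dg)
  then show "dg \<phi> (bb n x) = bb n (dg \<psi> x)"
    using x by (simp add: bb_ln dg_simps dg_ins[OF rot mu] mu dg_rt[OF rot(2)])
qed

lemma pj_mu: "pj l f (mu n x) = mu n (pj (l + int n - 1) (f + 2 - int n) x)"
  unfolding pj_def by (rule dg_mu) auto

lemma pj_bp: "pj l f (bp n x) = bp n (pj (l + int n - 1) (f + 2 - int n) x)"
  unfolding pj_def by (rule dg_bp) (auto simp: add.commute pj_mu[unfolded pj_def])

lemma pj_bb: "pj l f (bb n x) = bb n (pj (l + int n - 1) (f + 2 - int n) x)"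
  unfolding pj_def by (rule dg_bb) (auto simp: add.commute pj_mu[unfolded pj_def])

lemma hddeg_ins:
  assumes x: "ln L x = x" and n: "1 \<le> i" "1 \<le> n" "i + n \<le> L"
  shows "hddeg (ins (int i) n x) = ins (int i) n (hddeg x)"
  unfolding hddeg_def
proof (rule ln_eqI[OF wop_comp[OF wop_dg wop_ins] wop_comp[OF wop_ins wop_dg] _ x])
  fix xs assume v: "vl xs" and L: "length xs = L"
  define us bs vs where "us = take i xs" and "bs = take n (drop i xs)" and "vs = drop (i + n) xs"
  have xs: "xs = us @ bs @ vs"
    unfolding us_def bs_def vs_def by (metis append_take_drop_id drop_drop add.commute)
  have len: "length us = i" "length bs = n" using n L by (auto simp: us_def bs_def)
  have ne: "us \<noteq> []" "bs \<noteq> []" using len n by auto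
  have v1: "vl (us @ bs @ vs)" using v xs by simp
  have v2: "vl (us @ Defs.mapp m bs # vs)" using v1 mapp_in[of bs] ne by (auto simp: vl_def)
  have i: "ins (int i) n (gn xs) = scal ((-1) ^ sdeg us) (Q (gn (us @ Defs.mapp m bs # vs)))"
    using ins_gn[OF v1 ne(2)] xs len by simp
  have "hd (map fst (us @ Defs.mapp m bs # vs)) = hd (map fst xs)" using ne by (simp add: xs hd_append)
  then show "dg (\<lambda>ds. of_nat (hd ds)) (ins (int i) n (gn xs)) = ins (int i) n (dg (\<lambda>ds. of_nat (hd ds)) (gn xs))"
    by (simp add: dg_gn[OF v] ins_simps wop_Q[OF wop_ins] i dg_simps dg_Qgn[OF v2] mult.commute)
qed

text \<open>\<open>m\<^sub>2\<close> preserves degrees; this derivation property drives Goodwillie's argument.\<close>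

lemma bb_hddeg_N: "bb 2 (hddeg (N x)) = hddeg (N (bb 2 x))"
  unfolding N_bb
proof (rule ln_cong_all[OF wop_comp[OF wop_bb wop_comp[OF _ wop_N]] wop_comp[OF _ wop_comp[OF wop_bp wop_N]]])
  fix L x assume x: "ln L x = x"
  define y where "y = N x"
  have y: "ln L y = y" "la y = y" using x by (simp_all add: y_def ln_N la_N)
  have hy: "ln L (hddeg y) = hddeg y" using y by (simp add: hddeg_def ln_dg)
  show "bb 2 (hddeg (N x)) = hddeg (bp 2 (N x))"
  proof (cases "L < 2")
    case True
    then show ?thesis
      using bb_short[OF hy] bp_short[OF y(1)] by (simp add: y_def[symmetric] hddeg_def dg_simps)
  next
    case False
    define K where "K = L - 2"
    have K: "L + 1 - 2 = Suc K" "L = K + 2" using False by (auto simp: K_def)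
    have m0: "hddeg (mu 2 y) = mu 2 (dg (\<lambda>ds. of_nat (ds ! 0) + of_nat (ds ! 1)) y)"
      unfolding hddeg_def
    proof (rule dg_mu)
      fix bs ds :: "nat list" assume "length bs = 2"
      then obtain b c where "bs = [b, c]" by (auto simp: numeral_2_eq_2 length_Suc_conv)
      then show "of_nat (hd ((sum_list bs + 2 - 2) # ds)) = of_nat ((bs @ ds) ! 0) + (of_nat ((bs @ ds) ! 1) :: 'k)"
        by simp
    qed
    have m1: "rt 1 (hddeg y) = dg (\<lambda>ds. of_nat (ds ! 1)) y"
      using rt_hddeg[OF y(1), of 1] K rt_invariant[OF y(2)] by simp
    have m2: "hddeg y = dg (\<lambda>ds. of_nat (ds ! 0)) y"
      unfolding hddeg_def by (rule dg_ln_cong[OF y(1)]) (use K in \<open>auto intro!: arg_cong[where f=of_nat] hd_conv_nth\<close>)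
    have 0: "mu 2 (hddeg y) + mu 2 (rt 1 (hddeg y)) = hddeg (mu 2 y)"
      unfolding m0 m1 unfolding m2 lop_add[OF lop_mu, symmetric] dg_add ..
    have i0: "ins 0 2 z = mu 2 z" for z
      by (simp add: ins_def rt_0 wop_Q[OF wop_mu] Q_wop[OF wop_mu])
    have "bb 2 (hddeg y) = (\<Sum>i<Suc K. ins (int i) 2 (hddeg y)) + mu 2 (rt 1 (hddeg y))"
      using bb_ln[OF hy, of 2] unfolding K(1) by (simp add: numeral_2_eq_2 del: sum.lessThan_Suc)
    also have "\<dots> = mu 2 (hddeg y) + mu 2 (rt 1 (hddeg y)) + (\<Sum>i<K. ins (int (Suc i)) 2 (hddeg y))"
      by (simp add: sum.lessThan_Suc_shift i0 del: sum.lessThan_Suc of_nat_Suc)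
    also have "\<dots> = hddeg (mu 2 y) + (\<Sum>i<K. hddeg (ins (int (Suc i)) 2 y))"
      unfolding 0 using K by (simp add: hddeg_ins[OF y(1)] del: of_nat_Suc)
    also have "\<dots> = (\<Sum>i<Suc K. hddeg (ins (int i) 2 y))"
      by (simp add: sum.lessThan_Suc_shift i0 del: sum.lessThan_Suc of_nat_Suc)
    also have "\<dots> = hddeg (bp 2 y)"
      unfolding bp_ln[OF y(1)] K(1) unfolding hddeg_def lop_sum[OF lop_dg] ..
    finally show ?thesis by (simp add: y_def)
  qed
qed (simp_all add: hddeg_def wop_dg)

text \<open>The part of the total differential that preserves the weight; over \<open>H(A)\<close>,
  where only \<open>m\<^sub>2\<close> survives, it is the entire differential.\<close>

definition d0 :: "(int \<Rightarrow> ('k,'a) ev) \<Rightarrow> int \<Rightarrow> ('k,'a) ev" where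
  "d0 x p = (if even p then bb 2 (x p) + (x (p + 1) - la (x (p + 1))) else - bp 2 (x p) + N (x (p + 1)))"

end

context ainf_presentation
begin

theorem goodwillie:
  assumes only2: "\<And>j x. j \<noteq> 2 \<Longrightarrow> mu j x = 0"
    and k: "1 \<le> k"
    and y: "\<And>p. pj (n - p - int k) (int k) (y p) = y p"
    and cyc: "\<And>p. d0 y p = 0"
  shows "\<exists>w. (\<forall>p. pj (n + 1 - p - int k) (int k) (w p) = w p) \<and> (\<forall>p. d0 w p = y p)"
proof -
  have z1: "bp j x = 0" "bb j x = 0" if "j \<noteq> 2" for j x
  proof -
    show "bp j x = 0"
      by (rule ln_cong_all[OF wop_bp wop_0]) (simp add: bp_ln ins_def only2[OF that] rt_simps)
    show "bb j x = 0"
      by (rule ln_cong_all[OF wop_bb wop_0]) (simp add: bb_ln ins_def only2[OF that] rt_simps)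
  qed
  have sq: "bp 2 (bp 2 x) = 0" "bb 2 (bb 2 x) = 0" for x
  proof -
    have I: "{1..3::nat} = {1, 2, 3}" by auto
    show "bp 2 (bp 2 x) = 0" using bp_bp[of 3 x] z1(1)[of 1 x] z1(1)[of 3 x] unfolding I
      by (simp add: bp_simps)
    show "bb 2 (bb 2 x) = 0" using bb_bb[of 3 x] z1(2)[of 1 x] z1(2)[of 3 x] unfolding I
      by (simp add: bb_simps)
  qed
  have tm: "totdeg (mu 2 x) = mu 2 (totdeg x)" for x
    unfolding totdeg_def by (rule dg_mu) auto
  have wI: "wop invlen" "wop hddeg" "wop totdeg" by (simp_all add: invlen_def hddeg_def totdeg_def wop_dg)
  interpret P: periodic_ops Q la N invlen rowh "bb 2" "bp 2" hddeg totdeg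
  proof
    fix x y :: "('k,'a) ev"
    show "Q (x + y) = Q x + Q y" "la (x + y) = la x + la y" "N (x + y) = N x + N y"
      "invlen (x + y) = invlen x + invlen y" "rowh (x + y) = rowh x + rowh y" "bb 2 (x + y) = bb 2 x + bb 2 y"
      "bp 2 (x + y) = bp 2 x + bp 2 y" "hddeg (x + y) = hddeg x + hddeg y" "totdeg (x + y) = totdeg x + totdeg y"
      by (simp_all add: lop_add lop_Q lop_la lop_N lop_rowh lop_bb lop_bp wI wop_lop)
    show "Q (la x) = la x" "Q (N x) = N x" "Q (invlen x) = invlen x" "Q (rowh x) = rowh x"
      "Q (bb 2 x) = bb 2 x" "Q (bp 2 x) = bp 2 x" "Q (hddeg x) = hddeg x" "Q (totdeg x) = totdeg x"
      "la (Q x) = la x" "N (Q x) = N x" "invlen (Q x) = invlen x" "rowh (Q x) = rowh x"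
      "bb 2 (Q x) = bb 2 x" "bp 2 (Q x) = bp 2 x" "hddeg (Q x) = hddeg x" "totdeg (Q x) = totdeg x"
      by (simp_all add: Q_wop wop_Q wop_la wop_N wop_rowh wop_bb wop_bp wI)
    show "la (totdeg x) = totdeg (la x)" "N (totdeg x) = totdeg (N x)" "invlen (totdeg x) = totdeg (invlen x)"
      "rowh (totdeg x) = totdeg (rowh x)" "hddeg (totdeg x) = totdeg (hddeg x)"
      by (simp_all add: totdeg_def invlen_def hddeg_def dg_la dg_N dg_rowh dg_comm)
    show "bb 2 (totdeg x) = totdeg (bb 2 x)" "bp 2 (totdeg x) = totdeg (bp 2 x)"
      using tm dg_bb[of "\<lambda>ds. of_nat (sum_list ds)" "\<lambda>ds. of_nat (sum_list ds)" 2 x]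
        dg_bp[of "\<lambda>ds. of_nat (sum_list ds)" "\<lambda>ds. of_nat (sum_list ds)" 2 x]
      unfolding totdeg_def by (simp_all add: add.commute)
    show "la (N x) = N x" "N (la x) = N x" by (rule la_N N_la)+
    show "la (rowh x) = rowh x - Q x + N (invlen x)" "rowh (la x) = rowh x - Q x + N (invlen x)"
      by (rule la_rowh rowh_la)+
    show "invlen (la x) = la (invlen x)" "invlen (N x) = N (invlen x)"
      unfolding invlen_def by (simp_all add: dg_la dg_N)
    show "N (N (invlen x)) = N x" by (rule N_N_invlen)
    show "bb 2 (la x) = bb 2 x - bp 2 x + la (bp 2 x)" by (rule bb_la)
    show "bp 2 (N x) = N (bb 2 x)" by (simp add: N_bb)
    show "bp 2 (bp 2 x) = 0" "bb 2 (bb 2 x) = 0" by (rule sq)+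
    show "N (hddeg (N x)) = totdeg (N x)" by (rule N_hddeg_N)
    show "bb 2 (hddeg (N x)) = hddeg (N (bb 2 x))" by (rule bb_hddeg_N)
  qed
  \<comment> \<open>The homotopy yields the square of the degree operator, which is multiplication
    by the square of \<open>k\<close> in weight \<open>k\<close>; the division is made
    beforehand.\<close>
  define c where "c = (1::'k) / (of_nat k * of_nat k)"
  have c: "c * (of_nat k * of_nat k) = 1" using k by (simp add: c_def)
  define t where "t p = scal c (y p)" for p
  have d0: "P.dd x p = d0 x p" for x p by (simp add: P.dd_def d0_def)
  have "P.dd t p = scal c (d0 y p)" for p
    by (simp add: d0 d0_def t_def bb_simps bp_simps la_simps N_simps
        ev.scale_right_distrib ev.scale_right_diff_distrib)
  then have "P.dd t p = 0" for p by (simp add: cyc)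
  then obtain w where w: "\<And>p. d0 w p = totdeg (totdeg (t p))"
    using P.dd_surj[of t] unfolding d0 by blast
  have "totdeg (totdeg (t p)) = y p" for p
    using totdeg_pj[OF y, of p] wop_lop[OF wI(3)] c
    by (simp add: t_def lop_scal mult.assoc)
  then have w: "d0 w p = y p" for p using w by simp
  \<comment> \<open>The solution need not be homogeneous. Its components of the expected length and
    weight still solve the equation, because \<open>d0\<close> is compatible with both
    gradings.\<close>
  define w' where "w' p = pj (n + 1 - p - int k) (int k) (w p)" for p
  have "d0 w' p = pj (n - p - int k) (int k) (d0 w p)" for p
    unfolding d0_def w'_def
    by (simp add: pj_simps pj_bb pj_bp pj_la pj_N algebra_simps)
  then have "d0 w' p = y p" for p using w y by simp
  moreover have "pj (n + 1 - p - int k) (int k) (w' p) = w' p" for p by (simp add: w'_def pj_pj)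
  ultimately show ?thesis by blast
qed

end

section \<open>Chains by column and weight\<close>

text \<open>These copies repeat the formulas of the statement literally, with finitely supported
  sums in place of functions, so that \<open>lookup\<close> carries one to the other.\<close>

definition bpE :: "(nat \<Rightarrow> 'a list \<Rightarrow> 'a) \<Rightarrow> 'a hlist \<Rightarrow> ('k::field,'a) ev" where
  "bpE m xs = (\<Sum>i<length xs. \<Sum>j\<in>{1..length xs - i}.
      scal ((-1) ^ sdeg (take i xs))
        (gn (take i xs @ [Defs.mapp m (take j (drop i xs))] @ drop (i + j) xs)))"

definition bE :: "(nat \<Rightarrow> 'a list \<Rightarrow> 'a) \<Rightarrow> 'a hlist \<Rightarrow> ('k::field,'a) ev" where
  "bE m xs = bpE m xs +
     (\<Sum>s\<in>{1..<length xs}. \<Sum>j\<in>{s+1..length xs}.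
        scal (rotsign s xs) (gn (Defs.mapp m (take j (rot s xs)) # drop j (rot s xs))))"

definition lamE :: "nat \<Rightarrow> 'a hlist \<Rightarrow> ('k::field,'a) ev" where
  "lamE s xs = scal (rotsign s xs) (gn (rot s xs))"

definition NE :: "'a hlist \<Rightarrow> ('k::field,'a) ev" where
  "NE xs = (\<Sum>s<length xs. lamE s xs)"

definition DE :: "(nat \<Rightarrow> 'a list \<Rightarrow> 'a) \<Rightarrow> (int \<Rightarrow> ('k::field,'a) ev) \<Rightarrow> int \<Rightarrow> ('k,'a) ev" where
  "DE m X p = (if even p then ext (bE m) (X p) else - ext (bpE m) (X p)) +
     (if odd (p + 1) then X (p + 1) - ext (lamE 1) (X (p + 1)) else ext NE (X (p + 1)))"

context graded_presentation
begin

definition ks :: "int \<Rightarrow> ('k,'a) ev \<Rightarrow> bool" where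
  "ks D u \<longleftrightarrow> (\<forall>g\<in>keys u. vl g \<and> int (sdeg g) = D)"

lemma vt: "valid G zs \<Longrightarrow> valid G (take k zs)" "valid G zs \<Longrightarrow> valid G (drop k zs)"
  by (auto simp: valid_def dest: in_set_takeD in_set_dropD)

lemma Q_lamE:
  assumes v: "vl xs" and s: "s \<le> length xs"
  shows "Q (lamE s xs) = rt (int s) (gn xs)"
proof -
  define us vs where "us = take (length xs - s) xs" and "vs = drop (length xs - s) xs"
  have "xs = us @ vs" "length vs = s" using s by (auto simp: us_def vs_def)
  then show ?thesis using rt_append[of us vs] v by (simp add: lamE_def rotsign_append Qs)
qed

lemma Q_NE: "vl xs \<Longrightarrow> Q (NE xs) = N (gn xs)"
  unfolding N_def NE_def
  by (subst fam_gn[OF _ wop_Sum[OF wop_rt]]) (simp_all add: Qs Q_lamE)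

lemma Q_ext:
  assumes "wop A" "\<And>g. g \<in> keys u \<Longrightarrow> Q (F g) = A (gn g)"
  shows "Q (ext F u) = A u"
  by (rule lop_eqI[OF lop_comp[OF lop_Q lop_ext] wop_lop[OF assms(1)]]) (simp add: assms(2))

lemma pj_gn: "vl xs \<Longrightarrow> pj l f (gn xs) = (if int (length xs) = l \<and> int (sdeg xs) = l + f then Q (gn xs) else 0)"
  by (auto simp: pj_def dg_gn sdeg_eq)

lemma Q_decomp:
  assumes "ks D u"
  shows "Q u = (\<Sum>f\<in>{0..D}. pj (D - f) f u)"
proof (rule lop_eqI[OF lop_Q lop_Sum[OF lop_pj]])
  fix g assume g: "g \<in> keys u"
  then have v: "vl g" "int (sdeg g) = D" using assms by (auto simp: ks_def)
  have "pj (D - f) f (gn g) = (if f = int (sum_list (map fst g)) then Q (gn g) else 0)" for f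
    using v by (auto simp: pj_gn sdeg_eq)
  moreover have "int (sum_list (map fst g)) \<in> {0..D}" using v by (simp add: sdeg_eq)
  ultimately show "Q (gn g) = (\<Sum>f\<in>{0..D}. pj (D - f) f (gn g))" by simp
qed

text \<open>The entry \<open>x p f\<close> is the component of weight \<open>f\<close> in column \<open>p\<close>. In total degree \<open>n\<close> its tensor length
  must be \<open>n - p - f\<close>, so each column has finitely many nonzero entries.\<close>

definition hom :: "int \<Rightarrow> (int \<Rightarrow> int \<Rightarrow> ('k,'a) ev) \<Rightarrow> bool" where
  "hom n x \<longleftrightarrow> (\<forall>p f. pj (n - p - f) f (x p f) = x p f)"

lemma hom_neg: "hom n x \<Longrightarrow> f < 0 \<Longrightarrow> x p f = 0"
  by (metis hom_def pj_zero)

lemma hom_short: "hom n x \<Longrightarrow> n - p \<le> f \<Longrightarrow> x p f = 0"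
  by (metis hom_def pj_zero diff_le_0_iff_le)

end

context operations
begin

lemma Q_ins_term:
  assumes v: "vl xs" and ij: "j \<in> {1..length xs - i}"
  shows "Q (scal ((-1) ^ sdeg (take i xs))
        (gn (take i xs @ [Defs.mapp m (take j (drop i xs))] @ drop (i + j) xs))) = ins (int i) j (gn xs)"
proof -
  have xs: "take i xs @ take j (drop i xs) @ drop (i + j) xs = xs"
    by (metis append_take_drop_id drop_drop add.commute)
  have "length (take i xs) = i" "length (take j (drop i xs)) = j" "take j (drop i xs) \<noteq> []" using ij by auto
  then show ?thesis using ins_gn[of "take i xs" "take j (drop i xs)" "drop (i + j) xs"] v xs
    by (simp add: Qs)
qed

lemma Q_wrap_term:
  assumes v: "vl xs" and s: "s < length xs" "j \<in> {s+1..length xs}"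
  shows "Q (scal (rotsign s xs) (gn (Defs.mapp m (take j (rot s xs)) # drop j (rot s xs)))) = mu j (rt (int s) (gn xs))"
proof -
  have vr: "vl (rot s xs)" "length (rot s xs) = length xs"
    using v s vt[of xs "length xs - s"] by (auto simp: rot_def vl_def)
  have "rt (int s) (gn xs) = scal (rotsign s xs) (Q (gn (rot s xs)))"
    using Q_lamE[OF v, of s] s by (simp add: lamE_def Qs)
  moreover have "mu j (gn (rot s xs)) = Q (gn (Defs.mapp m (take j (rot s xs)) # drop j (rot s xs)))"
    using mu_gn[of "take j (rot s xs)" "drop j (rot s xs)"] vr s by (auto simp: vl_def)
  ultimately show ?thesis by (simp add: Qs mu_simps wop_Q[OF wop_mu])
qed

lemma swap_ins:
  "(\<Sum>i<L. \<Sum>j\<in>{1..L-i}. g i j) = (\<Sum>n\<in>{1..L}. \<Sum>i<L+1-n. g i n)" for L :: nat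
  unfolding sum.Sigma[OF finite_lessThan ballI[OF finite_atLeastAtMost]]
    sum.Sigma[OF finite_atLeastAtMost ballI[OF finite_lessThan]]
  by (rule sum.reindex_bij_witness[of _ "\<lambda>(k,i). (i,k)" "\<lambda>(i,k). (k,i)"]) auto

lemma swap_wrap:
  "(\<Sum>s\<in>{1..<L}. \<Sum>j\<in>{s+1..L}. g s j) = (\<Sum>n\<in>{1..L}. \<Sum>s\<in>{1..<n}. g s n)" for L :: nat
  unfolding sum.Sigma[OF finite_atLeastLessThan ballI[OF finite_atLeastAtMost]]
    sum.Sigma[OF finite_atLeastAtMost ballI[OF finite_atLeastLessThan]]
  by (rule sum.reindex_bij_witness[of _ "\<lambda>(k,i). (i,k)" "\<lambda>(i,k). (k,i)"]) auto

lemma bp_gn: "vl xs \<Longrightarrow> bp n (gn xs) = (\<Sum>i<length xs + 1 - n. ins (int i) n (gn xs))"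
  unfolding bp_def by (rule fam_gn[OF _ wop_Sum[OF wop_ins]])

lemma bb_gn: "vl xs \<Longrightarrow> bb n (gn xs) = bp n (gn xs) + (\<Sum>s\<in>{1..<n}. mu n (rt (int s) (gn xs)))"
  unfolding bb_def by (subst fam_gn[OF _ wop_bb_aux]) (simp_all add: bp_gn)

lemma mu_rt_gn_short: "vl xs \<Longrightarrow> length xs < n \<Longrightarrow> mu n (rt i (gn xs)) = 0"
  using mu_rt_short[of "length xs" "Q (gn xs)" n i]
  by (simp add: wop_Q[OF wop_ln] ln_gn wop_Q[OF wop_rt])

lemma bp_gn_short: "vl xs \<Longrightarrow> length xs < n \<Longrightarrow> bp n (gn xs) = 0"
  by (simp add: bp_gn)

lemma bb_gn_short: "vl xs \<Longrightarrow> length xs < n \<Longrightarrow> bb n (gn xs) = 0"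
  by (simp add: bb_gn bp_gn_short mu_rt_gn_short)

lemma Q_bpE:
  assumes v: "vl xs"
  shows "Q (bpE m xs) = (\<Sum>n\<in>{1..length xs}. bp n (gn xs))"
proof -
  have "Q (bpE m xs) = (\<Sum>i<length xs. \<Sum>j\<in>{1..length xs - i}. ins (int i) j (gn xs))"
    unfolding bpE_def lop_sum[OF lop_Q] by (intro sum.cong refl Q_ins_term[OF v])
  then show ?thesis unfolding swap_ins bp_gn[OF v] .
qed

lemma Q_bE:
  assumes v: "vl xs"
  shows "Q (bE m xs) = (\<Sum>n\<in>{1..length xs}. bb n (gn xs))"
proof -
  have "Q (\<Sum>s\<in>{1..<length xs}. \<Sum>j\<in>{s+1..length xs}.
        scal (rotsign s xs) (gn (Defs.mapp m (take j (rot s xs)) # drop j (rot s xs)))) =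
      (\<Sum>s\<in>{1..<length xs}. \<Sum>j\<in>{s+1..length xs}. mu j (rt (int s) (gn xs)))"
    unfolding lop_sum[OF lop_Q] by (intro sum.cong refl Q_wrap_term[OF v]) auto
  then show ?thesis
    unfolding bE_def lop_add[OF lop_Q] Q_bpE[OF v] swap_wrap bb_gn[OF v] sum.distrib by simp
qed

lemma Q_bE_bound:
  assumes v: "vl xs" and J: "length xs \<le> J"
  shows "Q (bE m xs) = (\<Sum>n\<in>{1..J}. bb n (gn xs))" "Q (bpE m xs) = (\<Sum>n\<in>{1..J}. bp n (gn xs))"
  unfolding Q_bE[OF v] Q_bpE[OF v]
  by (rule sum.mono_neutral_left; use J v bb_gn_short bp_gn_short in auto)+

lemma Q_bE_ext:
  assumes "\<And>g. g \<in> keys u \<Longrightarrow> vl g \<and> length g \<le> J"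
  shows "Q (ext (bE m) u) = (\<Sum>n\<in>{1..J}. bb n u)" "Q (ext (bpE m) u) = (\<Sum>n\<in>{1..J}. bp n u)"
  by (rule Q_ext[OF wop_Sum[OF wop_bb]], use assms Q_bE_bound in blast)
     (rule Q_ext[OF wop_Sum[OF wop_bp]], use assms Q_bE_bound in blast)

text \<open>The total differential by components. As \<open>m\<^sub>j\<close> changes the weight by
  \<open>j - 2\<close>, weight \<open>f\<close> receives from weight \<open>f + 2 - j\<close>, and
  nonnegativity of weights leaves only \<open>j \<le> f + 2\<close>.\<close>

definition dar :: "(int \<Rightarrow> int \<Rightarrow> ('k,'a) ev) \<Rightarrow> int \<Rightarrow> int \<Rightarrow> ('k,'a) ev" where
  "dar x p f = (if even p
     then (\<Sum>j\<in>{1..nat (f + 2)}. bb j (x p (f + 2 - int j))) + (x (p + 1) f - la (x (p + 1) f))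
     else - (\<Sum>j\<in>{1..nat (f + 2)}. bp j (x p (f + 2 - int j))) + N (x (p + 1) f))"

lemma dar_bound:
  assumes x: "\<And>f. f < 0 \<Longrightarrow> x p f = 0" and J: "nat (f + 2) \<le> J"
  shows "dar x p f = (if even p
     then (\<Sum>j\<in>{1..J}. bb j (x p (f + 2 - int j))) + (x (p + 1) f - la (x (p + 1) f))
     else - (\<Sum>j\<in>{1..J}. bp j (x p (f + 2 - int j))) + N (x (p + 1) f))"
proof -
  have "x p (f + 2 - int j) = 0" if "j \<in> {1..J} - {1..nat (f + 2)}" for j
    using that by (intro x) auto
  then have "(\<Sum>j\<in>{1..nat (f + 2)}. bb j (x p (f + 2 - int j))) = (\<Sum>j\<in>{1..J}. bb j (x p (f + 2 - int j)))"
    "(\<Sum>j\<in>{1..nat (f + 2)}. bp j (x p (f + 2 - int j))) = (\<Sum>j\<in>{1..J}. bp j (x p (f + 2 - int j)))"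
    using J by (auto intro!: sum.mono_neutral_left simp: bb_simps bp_simps)
  then show ?thesis unfolding dar_def by simp
qed

lemma hom_dar:
  assumes "hom n x"
  shows "hom (n - 1) (dar x)"
  unfolding hom_def
proof (intro allI)
  fix p f
  have h: "pj (n - p - f) f (x p f) = x p f" for p f using assms by (simp add: hom_def)
  have 1: "pj (n - 1 - p - f) f (bb j (x p (f + 2 - int j))) = bb j (x p (f + 2 - int j))"
    "pj (n - 1 - p - f) f (bp j (x p (f + 2 - int j))) = bp j (x p (f + 2 - int j))" for j
    using h[of p "f + 2 - int j"] by (simp_all add: pj_bb pj_bp algebra_simps)
  have 2: "pj (n - 1 - p - f) f (x (p + 1) f) = x (p + 1) f"
    using h[of "p + 1" f] by (simp add: algebra_simps)
  show "pj (n - 1 - p - f) f (dar x p f) = dar x p f"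
    unfolding dar_def
    by (simp add: pj_simps 1 2 pj_la pj_N)
qed

lemma dar_add: "dar (\<lambda>p f. x p f + y p f) p f = dar x p f + dar y p f"
  unfolding dar_def
  by (simp add: bb_simps bp_simps la_simps N_simps sum.distrib)

lemma dar_diff: "dar (\<lambda>p f. x p f - y p f) p f = dar x p f - dar y p f"
  unfolding dar_def
  by (simp add: bb_simps bp_simps la_simps N_simps sum_subtractf)

lemma dar_cong: "(\<And>p g. g \<le> f + 1 \<Longrightarrow> x p g = y p g) \<Longrightarrow> dar x p f = dar y p f"
  unfolding dar_def by (auto intro!: sum.cong arg_cong2[where f="(+)"])

lemma hom_add: "hom n x \<Longrightarrow> hom n y \<Longrightarrow> hom n (\<lambda>p f. x p f + y p f)"
  by (simp add: hom_def pj_simps)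

lemma hom_diff: "hom n x \<Longrightarrow> hom n y \<Longrightarrow> hom n (\<lambda>p f. x p f - y p f)"
  by (simp add: hom_def pj_simps)

lemma ks_length: "ks D u \<Longrightarrow> g \<in> keys u \<Longrightarrow> vl g \<and> length g \<le> nat D"
  by (auto simp: ks_def sdeg_eq)

lemma Q_DE:
  assumes X: "ks (n - p) (X p)" "ks (n - (p + 1)) (X (p + 1))" and J: "nat (n - p) \<le> J"
  shows "Q (DE m X p) = (if even p then (\<Sum>j\<in>{1..J}. bb j (X p)) + (Q (X (p + 1)) - la (X (p + 1)))
     else - (\<Sum>j\<in>{1..J}. bp j (X p)) + N (X (p + 1)))"
proof -
  have "vl g \<and> length g \<le> J" if "g \<in> keys (X p)" for g using ks_length[OF X(1) that] J by auto
  note 1 = Q_bE_ext[of "X p" J, OF this]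
  have 2: "Q (ext (lamE 1) (X (p + 1))) = la (X (p + 1))"
    by (rule Q_ext[OF wop_la]) (use X(2) Q_lamE[of _ 1] in \<open>auto simp: ks_def rt_1 vl_def Suc_le_eq\<close>)
  have 3: "Q (ext NE (X (p + 1))) = N (X (p + 1))"
    by (rule Q_ext[OF wop_N]) (use X(2) Q_NE in \<open>auto simp: ks_def\<close>)
  show ?thesis unfolding DE_def by (simp add: Qs 1 2 3 del: One_nat_def)
qed

lemma Q_DE_comp:
  assumes X: "\<And>p. ks (n - p) (X p)"
  shows "pj (n - 1 - p - f) f (Q (DE m X p)) = dar (\<lambda>p f. pj (n - p - f) f (X p)) p f"
proof -
  define J where "J = max (nat (n - p)) (nat (f + 2))"
  have 1: "pj (n - 1 - p - f) f (bb j (X p)) = bb j (pj (n - p - (f + 2 - int j)) (f + 2 - int j) (X p))"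
    "pj (n - 1 - p - f) f (bp j (X p)) = bp j (pj (n - p - (f + 2 - int j)) (f + 2 - int j) (X p))" for j
    by (simp_all add: pj_bb pj_bp algebra_simps)
  have "Q (DE m X p) = (if even p then (\<Sum>j\<in>{1..J}. bb j (X p)) + (Q (X (p + 1)) - la (X (p + 1)))
     else - (\<Sum>j\<in>{1..J}. bp j (X p)) + N (X (p + 1)))"
    by (rule Q_DE) (use X[of p] X[of "p + 1"] J_def in auto)
  moreover have e: "n - (p + 1) - f = n - 1 - p - f" by simp
  ultimately show ?thesis
    by (subst dar_bound[of _ _ _ J])
      (simp_all add: J_def pj_zero pj_simps 1 pj_la pj_N
        wop_Q[OF wop_pj] e)
qed

text \<open>The auxiliary \<open>dp\<close> projects to one total degree and commutes with all
  operators up to the expected shift. Hence the class of the differential has the right total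
  degree, and only finitely many weights can occur in it.\<close>

lemma Q_DE_decomp:
  assumes X: "\<And>p. ks (n - p) (X p)"
  shows "Q (DE m X p) = (\<Sum>f\<in>{0..n - 1 - p}. dar (\<lambda>p f. pj (n - p - f) f (X p)) p f)"
proof -
  define J where "J = nat (n - p)"
  define dp where "dp D = dg (\<lambda>ds. if int (length ds + sum_list ds) = D then 1 else 0)" for D
  have dpQ: "dp D u = Q u" if "ks D u" for D u
    by (rule lop_eqI[OF _ lop_Q]) (use that in \<open>auto simp: dp_def lop_dg ks_def dg_gn sdeg_eq add.commute\<close>)
  have mu: "dp D (mu j x) = mu j (dp (D + 1) x)" for D j x
    unfolding dp_def by (rule dg_mu) (auto simp: algebra_simps)
  have dpb: "dp D (bb j x) = bb j (dp (D + 1) x)" "dp D (bp j x) = bp j (dp (D + 1) x)" for D j x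
    using mu unfolding dp_def by (intro dg_bb dg_bp; simp add: add.commute)+
  have dpl: "dp D (la x) = la (dp D x)" "dp D (N x) = N (dp D x)" for D x
    unfolding dp_def by (intro dg_la dg_N; simp add: add.commute)+
  have dpQ2: "dp D (Q x) = dp D x" for D x unfolding dp_def by (rule wop_Q[OF wop_dg])
  have Q: "Q (DE m X p) = (if even p then (\<Sum>j\<in>{1..J}. bb j (X p)) + (Q (X (p + 1)) - la (X (p + 1)))
     else - (\<Sum>j\<in>{1..J}. bp j (X p)) + N (X (p + 1)))"
    by (rule Q_DE) (use X[of p] X[of "p + 1"] J_def in auto)
  have e: "dp (n - 1 - p + 1) (X p) = Q (X p)" "dp (n - 1 - p) (X (p + 1)) = Q (X (p + 1))"
    using X[of p] X[of "p + 1"] by (auto intro!: dpQ simp: algebra_simps)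
  have "dp (n - 1 - p) (Q (DE m X p)) = Q (DE m X p)"
    unfolding Q dp_def using e dpb dpl dpQ2 unfolding dp_def
    by (simp add: dg_simps
      wop_Q[OF wop_bb] wop_Q[OF wop_bp] wop_Q[OF wop_la] wop_Q[OF wop_N])
  moreover have "dp D x = (\<Sum>f\<in>{0..D}. pj (D - f) f x)" for D x
  proof (rule wop_eqI[OF _ wop_Sum[OF wop_pj]])
    fix g assume v: "vl g"
    have "pj (D - f) f (gn g) = (if f = int (sum_list (map fst g)) then if int (sdeg g) = D then Q (gn g) else 0 else 0)" for f
      using v by (auto simp: pj_gn sdeg_eq)
    moreover have "int (sdeg g) = D \<Longrightarrow> int (sum_list (map fst g)) \<in> {0..D}" using v by (simp add: sdeg_eq)
    ultimately show "dp D (gn g) = (\<Sum>f\<in>{0..D}. pj (D - f) f (gn g))"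
      using v by (auto simp: dp_def dg_gn sdeg_eq add.commute)
  qed (simp add: dp_def wop_dg)
  ultimately have "Q (DE m X p) = (\<Sum>f\<in>{0..n - 1 - p}. pj (n - 1 - p - f) f (Q (DE m X p)))" by simp
  then show ?thesis unfolding Q_DE_comp[OF X] .
qed

text \<open>Evaluates the differential built from \<open>m\<^sub>2\<close> alone in any of the
  presentations, including that of \<open>A\<close>, where it need not square to zero.\<close>

lemma Q_DE_only2:
  assumes m': "m' 2 = m 2" "\<And>n as. n \<noteq> 2 \<Longrightarrow> m' n as = 0"
    and X: "\<And>p g. g \<in> keys (X p) \<Longrightarrow> vl g"
  shows "Q (DE m' X p) = (if even p then bb 2 (X p) + (Q (X (p + 1)) - la (X (p + 1))) else - bp 2 (X p) + N (X (p + 1)))"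
proof -
  have bp: "Q (bpE m' xs) = bp 2 (gn xs)" if v: "vl xs" for xs
  proof -
    have va: "valid G xs" using v by (simp add: vl_def)
    have t: "Q (scal ((-1) ^ sdeg (take i xs)) (gn (take i xs @ [Defs.mapp m' (take j (drop i xs))] @ drop (i + j) xs)))
        = (if j = 2 then ins (int i) 2 (gn xs) else 0)" if "j \<in> {1..length xs - i}" for i j
    proof (cases "j = 2")
      case True
      then have "Defs.mapp m' (take j (drop i xs)) = Defs.mapp m (take j (drop i xs))"
        using that m'(1) by (simp add: mapp_eq min_def)
      then show ?thesis using Q_ins_term[OF v that] True by simp
    next
      case False
      have "length (take j (drop i xs)) \<noteq> 2" using False that by simp
      then have "snd (Defs.mapp m' (take j (drop i xs))) = 0" using m'(2) by (simp only: mapp_eq snd_conv)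
      then show ?thesis using False Q_zero[OF vt(1)[OF va] vt(2)[OF va], of i "fst (Defs.mapp m' (take j (drop i xs)))" "i + j"]
        by (cases "Defs.mapp m' (take j (drop i xs))") (simp add: Qs)
    qed
    have "Q (bpE m' xs) = (\<Sum>i<length xs. \<Sum>j\<in>{1..length xs - i}. if j = 2 then ins (int i) 2 (gn xs) else 0)"
      unfolding bpE_def lop_sum[OF lop_Q] by (intro sum.cong refl t)
    also have "\<dots> = (\<Sum>n\<in>{1..length xs}. if n = 2 then (\<Sum>i<length xs + 1 - 2. ins (int i) 2 (gn xs)) else 0)"
      unfolding swap_ins by (intro sum.cong refl) auto
    also have "\<dots> = bp 2 (gn xs)"
      unfolding bp_gn[OF v] by (subst sum.delta) auto
    finally show ?thesis .
  qed
  have bb: "Q (bE m' xs) = bb 2 (gn xs)" if v: "vl xs" for xs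
  proof -
    have t: "Q (scal (rotsign s xs) (gn (Defs.mapp m' (take j (rot s xs)) # drop j (rot s xs)))) =
        (if j = 2 then mu 2 (rt (int s) (gn xs)) else 0)" if "s < length xs" "j \<in> {s+1..length xs}" for s j
    proof (cases "j = 2")
      case True
      moreover have "length (rot s xs) = length xs" by (simp add: rot_def)
      ultimately have "length (take j (rot s xs)) = 2" using that by simp
      then have "Defs.mapp m' (take j (rot s xs)) = Defs.mapp m (take j (rot s xs))"
        by (simp only: mapp_eq m'(1))
      then show ?thesis using Q_wrap_term[OF v that] True by simp
    next
      case False
      have vr: "valid G (rot s xs)" using v vt[of xs] by (simp add: rot_def vl_def)
      have "length (rot s xs) = length xs" by (simp add: rot_def)
      then have "length (take j (rot s xs)) \<noteq> 2" using False that by simp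
      then have "snd (Defs.mapp m' (take j (rot s xs))) = 0" using m'(2) by (simp only: mapp_eq snd_conv)
      then show ?thesis using False Q_zero[of "[]" "drop j (rot s xs)" "fst (Defs.mapp m' (take j (rot s xs)))"] vt(2)[OF vr]
        by (cases "Defs.mapp m' (take j (rot s xs))") (simp add: Qs)
    qed
    have "Q (bE m' xs) = bp 2 (gn xs) + (\<Sum>s\<in>{1..<length xs}. \<Sum>j\<in>{s+1..length xs}. if j = 2 then mu 2 (rt (int s) (gn xs)) else 0)"
      unfolding bE_def lop_add[OF lop_Q] lop_sum[OF lop_Q] bp[OF v] by (intro arg_cong2[where f="(+)"] sum.cong refl t) auto
    also have "(\<Sum>s\<in>{1..<length xs}. \<Sum>j\<in>{s+1..length xs}. if j = 2 then mu 2 (rt (int s) (gn xs)) else 0) =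
       (\<Sum>n\<in>{1..length xs}. if n = 2 then (\<Sum>s\<in>{1..<2}. mu 2 (rt (int s) (gn xs))) else 0)"
      unfolding swap_wrap by (intro sum.cong refl) auto
    also have "\<dots> = (\<Sum>s\<in>{1..<2}. mu 2 (rt (int s) (gn xs)))"
      by (subst sum.delta) (auto simp: mu_rt_gn_short[OF v])
    finally show ?thesis unfolding bb_gn[OF v] .
  qed
  have 1: "Q (ext (bE m') (X p)) = bb 2 (X p)" "Q (ext (bpE m') (X p)) = bp 2 (X p)" for p
    by (rule Q_ext[OF wop_bb], use X bb in blast, rule Q_ext[OF wop_bp], use X bp in blast)
  have 2: "Q (ext (lamE 1) (X (p + 1))) = la (X (p + 1))"
    by (rule Q_ext[OF wop_la]) (use X[of _ "p + 1"] Q_lamE[of _ 1] in \<open>auto simp: rt_1 vl_def Suc_le_eq\<close>)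
  have 3: "Q (ext NE (X (p + 1))) = N (X (p + 1))"
    by (rule Q_ext[OF wop_N]) (use X[of _ "p + 1"] Q_NE in auto)
  show ?thesis unfolding DE_def by (simp add: Qs 1 2 3 del: One_nat_def)
qed

end

context ainf_presentation
begin

text \<open>Two vertical operations \<open>j\<close> and \<open>i\<close> are grouped by
  \<open>j + i\<close>, and each group vanishes by \<open>bb_bb\<close> or \<open>bp_bp\<close>; the
  mixed terms cancel by \<open>bb_la\<close> and \<open>N_bb\<close>.\<close>

lemma dar_dar:
  assumes h: "hom n x"
  shows "dar (dar x) p f = 0"
proof -
  have neg: "x p f = 0" "dar x p f = 0" if "f < 0" for p f
    using hom_neg[OF h that] hom_neg[OF hom_dar[OF h] that] by auto
  \<comment> \<open>Two operations \<open>j\<close>, \<open>i\<close> reach weight \<open>f\<close>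
    from weight \<open>f + 4 - j - i\<close>, so \<open>f + 4\<close> bounds \<open>j + i\<close>; a
    common bound lets the double sum be reindexed.\<close>
  define J where "J = nat (f + 4)"
  have inner: "dar x p (f + 2 - int j) = (if even p
     then (\<Sum>i\<in>{1..J}. bb i (x p (f + 4 - int j - int i))) + (x (p + 1) (f + 2 - int j) - la (x (p + 1) (f + 2 - int j)))
     else - (\<Sum>i\<in>{1..J}. bp i (x p (f + 4 - int j - int i))) + N (x (p + 1) (f + 2 - int j)))" if "j \<in> {1..J}" for j
    using that by (subst dar_bound[of _ _ _ J]) (auto simp: neg J_def algebra_simps)
  have dsum: "(\<Sum>j\<in>{1..J}. \<Sum>i\<in>{1..J}. A j (A i (x p (f + 4 - int j - int i)))) = 0"
    if A: "\<And>j. lop (A j)" "\<And>r y. (\<Sum>k\<in>{1..r}. A (r + 1 - k) (A k y)) = 0" for A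
  proof -
    have z: "x p (f + 4 - int j - int i) = 0" if "\<not> j + i \<le> J" for i j
      using that by (intro neg) (auto simp: J_def)
    have "(\<Sum>j\<in>{1..J}. \<Sum>i\<in>{1..J}. A j (A i (x p (f + 4 - int j - int i)))) =
        (\<Sum>(j,i)\<in>{1..J}\<times>{1..J}. A j (A i (x p (f + 4 - int j - int i))))"
      by (simp add: sum.cartesian_product)
    also have "\<dots> = (\<Sum>(j,i)\<in>{(j,i). 1 \<le> j \<and> 1 \<le> i \<and> j + i \<le> J}. A j (A i (x p (f + 4 - int j - int i))))"
    proof -
      have "j + i \<le> J" if "A j (A i (x p (f + 4 - int j - int i))) \<noteq> 0" for i j
        using z[of j i] that lop_zero[OF A(1)] by metis
      then show ?thesis by (intro sum.mono_neutral_right) auto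
    qed
    also have "\<dots> = (\<Sum>(r,k)\<in>(SIGMA r:{1..J-1}. {1..r}). A (r + 1 - k) (A k (x p (f + 3 - int r))))"
      by (rule sum.reindex_bij_witness[of _ "\<lambda>(r,k). (r + 1 - k, k)" "\<lambda>(j,i). (j + i - 1, i)"])
        (auto simp: of_nat_diff algebra_simps)
    also have "\<dots> = (\<Sum>r\<in>{1..J-1}. \<Sum>k\<in>{1..r}. A (r + 1 - k) (A k (x p (f + 3 - int r))))"
      by (subst sum.Sigma) auto
    also have "\<dots> = 0" by (simp only: A(2) sum.neutral_const)
    finally show ?thesis .
  qed
  have outer: "dar (dar x) p f = (if even p
     then (\<Sum>j\<in>{1..J}. bb j (dar x p (f + 2 - int j))) + (dar x (p + 1) f - la (dar x (p + 1) f))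
     else - (\<Sum>j\<in>{1..J}. bp j (dar x p (f + 2 - int j))) + N (dar x (p + 1) f))"
    by (rule dar_bound) (auto simp: neg J_def)
  have next': "dar x (p + 1) f = (if even (p + 1)
     then (\<Sum>j\<in>{1..J}. bb j (x (p + 1) (f + 2 - int j))) + (x (p + 2) f - la (x (p + 2) f))
     else - (\<Sum>j\<in>{1..J}. bp j (x (p + 1) (f + 2 - int j))) + N (x (p + 2) f))"
    by (subst dar_bound[of _ _ _ J]) (auto simp: neg J_def add.assoc)
  show ?thesis
  proof (cases "even p")
    case True
    have "(\<Sum>j\<in>{1..J}. bb j (dar x p (f + 2 - int j))) =
        (\<Sum>j\<in>{1..J}. (\<Sum>i\<in>{1..J}. bb j (bb i (x p (f + 4 - int j - int i)))) +
          (bp j (x (p + 1) (f + 2 - int j)) - la (bp j (x (p + 1) (f + 2 - int j)))))"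
      using True by (intro sum.cong refl)
        (simp add: inner bb_simps bb_la)
    also have "\<dots> = (\<Sum>j\<in>{1..J}. bp j (x (p + 1) (f + 2 - int j))) - la (\<Sum>j\<in>{1..J}. bp j (x (p + 1) (f + 2 - int j)))"
      unfolding sum.distrib dsum[OF lop_bb bb_bb] sum_subtractf lop_sum[OF lop_la] by simp
    finally show ?thesis unfolding outer next' using True
      by (simp add: la_simps la_N)
  next
    case False
    have "(\<Sum>j\<in>{1..J}. bp j (dar x p (f + 2 - int j))) =
        (\<Sum>j\<in>{1..J}. - (\<Sum>i\<in>{1..J}. bp j (bp i (x p (f + 4 - int j - int i)))) +
          N (bb j (x (p + 1) (f + 2 - int j))))"
      using False by (intro sum.cong refl)
        (simp add: inner bp_simps N_bb)
    also have "\<dots> = N (\<Sum>j\<in>{1..J}. bb j (x (p + 1) (f + 2 - int j)))"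
      unfolding sum.distrib sum_negf dsum[OF lop_bp bp_bp] lop_sum[OF lop_N] by simp
    finally show ?thesis unfolding outer next' using False
      by (simp add: N_simps N_la)
  qed
qed

end

section \<open>Translation between finitely supported sums and the functions of the
  statement\<close>

lemma fun_sum_apply: "(\<Sum>i\<in>I. f i) y = (\<Sum>i\<in>I. f i y)"
  by (induction I rule: infinite_finite_induct) auto

lemma lookup_fun_simps:
  "lookup (u + v) = lookup u + lookup v" "lookup (u - v) = lookup u - lookup v"
  "lookup (- u) = - lookup u" "lookup 0 = 0"
  "lookup (scal c u) = fscale c (lookup u)" "lookup (gn xs) = gen xs"
  by (auto simp: fun_eq_iff lookup_add lookup_minus lookup_gn gen_def fscale_def)

lemma lookup_fun_sum: "lookup (\<Sum>i\<in>I. f i) = (\<Sum>i\<in>I. lookup (f i))"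
  by (simp add: fun_eq_iff fun_sum_apply lookup_sum)

lemma fsupp_lookup: "fsupp (lookup u) = keys u"
  by (auto simp: fsupp_def in_keys_iff)

lemma lookup_ext: "lookup (ext F u) = lin (\<lambda>g. lookup (F g)) (lookup u)"
  by (simp add: ext_def lin_def fsupp_lookup lookup_fun_sum lookup_fun_simps)

lemma lookup_bpE: "lookup (bpE m xs) = bpgen m xs"
  unfolding bpE_def bpgen_def by (simp add: lookup_fun_sum lookup_fun_simps)

lemma lookup_bE: "lookup (bE m xs) = bgen m xs"
  unfolding bE_def bgen_def by (simp add: lookup_fun_sum lookup_fun_simps lookup_bpE)

lemma lookup_lamE: "lookup (lamE s xs) = lamgen s xs"
  unfolding lamE_def lamgen_def by (simp add: lookup_fun_simps)

lemma lookup_NE: "lookup (NE xs) = Ngen xs"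
  unfolding NE_def Ngen_def by (simp add: lookup_fun_sum lookup_lamE)

lemma lookup_DE: "lookup (DE m X p) = Dtot m (\<lambda>p. lookup (X p)) p"
  unfolding DE_def Dtot_def
  by (simp add: lookup_fun_simps lookup_ext lookup_bpE lookup_bE lookup_lamE lookup_NE)

lemma exists_lookup: "finite (fsupp x) \<Longrightarrow> \<exists>u. x = lookup u"
  by (rule exI[of _ "Abs_poly_mapping x"]) (simp add: fsupp_def)

lemma fspan_zero: "0 \<in> fspan S"
  unfolding fspan_def by (auto intro!: exI[of _ "0::nat"])

lemma fspan_step:
  assumes "v \<in> S" "y \<in> fspan S"
  shows "fscale a v + y \<in> fspan S"
proof -
  obtain k c w where w: "\<forall>i<k. w i \<in> S" "y = (\<Sum>i<(k::nat). fscale (c i) (w i))"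
    using assms(2) by (auto simp: fspan_def)
  let ?c = "\<lambda>i. if i < k then c i else a" and ?w = "\<lambda>i. if i < k then w i else v"
  have "fscale a v + y = (\<Sum>i<Suc k. fscale (?c i) (?w i))"
    by (simp add: w(2) add.commute)
  then show ?thesis unfolding fspan_def using w(1) assms(1)
    by (intro CollectI exI[of _ "Suc k"] exI[of _ ?c] exI[of _ ?w]) auto
qed

lemma fspan_lookup: "x \<in> fspan (lookup ` S) \<longleftrightarrow> (\<exists>u\<in>ev.span S. x = lookup u)"
proof
  assume "x \<in> fspan (lookup ` S)"
  then obtain k c v where v: "\<forall>i<k. v i \<in> lookup ` S" "x = (\<Sum>i<(k::nat). fscale (c i) (v i))"
    by (auto simp: fspan_def)
  then obtain u where u: "\<And>i. i < k \<Longrightarrow> u i \<in> S \<and> v i = lookup (u i)"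
    unfolding image_iff by metis
  have "x = lookup (\<Sum>i<k. scal (c i) (u i))"
    using u by (simp add: v(2) lookup_fun_sum lookup_fun_simps)
  moreover have "(\<Sum>i<k. scal (c i) (u i)) \<in> ev.span S"
    using u by (intro ev.span_sum ev.span_scale ev.span_base) auto
  ultimately show "\<exists>u\<in>ev.span S. x = lookup u" by blast
next
  assume "\<exists>u\<in>ev.span S. x = lookup u"
  then obtain u where u: "u \<in> ev.span S" "x = lookup u" by blast
  from u(1) have "lookup u \<in> fspan (lookup ` S)"
  proof (induction rule: ev.span_induct_alt)
    case base then show ?case using fspan_zero by (simp add: zero_fun_def)
  next
    case (step c x y)
    then show ?case using fspan_step[of "lookup x" "lookup ` S" "lookup y" c]
      by (simp add: lookup_fun_simps plus_fun_def)
  qed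
  then show "x \<in> fspan (lookup ` S)" using u by simp
qed

context graded_presentation
begin

lemma relgens_eq:
  assumes "Nd = (\<lambda>_. B)"
  shows "relgens sc G B = lookup ` (RL \<union> RN)"
proof -
  have "lookup ` RL = {gen (xs @ [(d, sc c a + b)] @ ys) - fscale c (gen (xs @ [(d, a)] @ ys))
        - gen (xs @ [(d, b)] @ ys) | xs ys d a b c.
        valid G xs \<and> valid G ys \<and> a \<in> G d \<and> b \<in> G d}" (is "_ = ?S")
  proof (intro equalityI subsetI)
    fix y assume "y \<in> lookup ` RL"
    then obtain xs ys d a b c where "y = lookup (gn (xs @ (d, sc c a + b) # ys) - scal c (gn (xs @ (d, a) # ys)) - gn (xs @ (d, b) # ys))"
      and *: "valid G xs" "valid G ys" "a \<in> G d" "b \<in> G d"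
      unfolding RL_def by blast
    then have "y = gen (xs @ [(d, sc c a + b)] @ ys) - fscale c (gen (xs @ [(d, a)] @ ys)) - gen (xs @ [(d, b)] @ ys)"
      by (simp add: lookup_fun_simps)
    then show "y \<in> ?S" using * by blast
  next
    fix y assume "y \<in> ?S"
    then obtain xs ys d a b c where "y = gen (xs @ [(d, sc c a + b)] @ ys) - fscale c (gen (xs @ [(d, a)] @ ys)) - gen (xs @ [(d, b)] @ ys)"
      and *: "valid G xs" "valid G ys" "a \<in> G d" "b \<in> G d" by blast
    then have "y = lookup (gn (xs @ (d, sc c a + b) # ys) - scal c (gn (xs @ (d, a) # ys)) - gn (xs @ (d, b) # ys))"
      by (simp add: lookup_fun_simps)
    moreover have "gn (xs @ (d, sc c a + b) # ys) - scal c (gn (xs @ (d, a) # ys)) - gn (xs @ (d, b) # ys) \<in> RL"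
      unfolding RL_def using * by blast
    ultimately show "y \<in> lookup ` RL" by blast
  qed
  moreover have "lookup ` RN = {gen (xs @ [(d, a)] @ ys) | xs ys d a. valid G xs \<and> valid G ys \<and> a \<in> G d \<and> a \<in> B}" (is "_ = ?S")
  proof (intro equalityI subsetI)
    fix y assume "y \<in> lookup ` RN"
    then obtain xs ys d a where "y = lookup (gn (xs @ (d, a) # ys))" and *: "valid G xs" "valid G ys" "a \<in> G d" "a \<in> Nd d"
      unfolding RN_def by blast
    then have "y = gen (xs @ [(d, a)] @ ys)" by (simp add: lookup_fun_simps)
    then show "y \<in> ?S" using * assms by auto
  next
    fix y assume "y \<in> ?S"
    then obtain xs ys d a where "y = gen (xs @ [(d, a)] @ ys)" and *: "valid G xs" "valid G ys" "a \<in> G d" "a \<in> Nd d" using assms by auto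
    then have "y = lookup (gn (xs @ (d, a) # ys))" by (simp add: lookup_fun_simps)
    moreover have "gn (xs @ (d, a) # ys) \<in> RN" unfolding RN_def using * by blast
    ultimately show "y \<in> lookup ` RN" by blast
  qed
  ultimately show ?thesis unfolding relgens_def image_Un by simp
qed

text \<open>\<open>V\<close> also contains the invalid lists, which never occur in the relations of
  the statement. Deleting them maps \<open>V\<close> into the span of the relations and fixes chains
  on valid lists, so on such chains both notions of being zero agree.\<close>

definition prj :: "('k,'a) ev \<Rightarrow> ('k,'a) ev" where
  "prj = ext (\<lambda>g. if vl g then gn g else 0)"

lemma prj_id: "(\<And>g. g \<in> keys u \<Longrightarrow> vl g) \<Longrightarrow> prj u = u"
  unfolding prj_def by (rule lop_eqI[OF lop_ext lop_id]) simp

lemma prj_V: "u \<in> V \<Longrightarrow> prj u \<in> ev.span (RL \<union> RN)"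
  unfolding V_def
proof (rule lop_span[of prj, rotated 2])
  fix x assume x: "x \<in> RL \<union> RN \<union> {gn xs |xs. \<not> vl xs}"
  have "prj x = x" if "x \<in> RL \<union> RN"
    using that unfolding RL_def RN_def prj_def
    by (auto simp: ext_simps vl_split G_add G_scale)
  moreover have "prj x = 0" if "x \<in> {gn xs |xs. \<not> vl xs}" using that by (auto simp: prj_def)
  ultimately have "prj x = 0 \<or> (prj x = x \<and> x \<in> RL \<union> RN)" using x by blast
  then show "prj x \<in> ev.span (RL \<union> RN)"
    using ev.span_base[of x "RL \<union> RN"] ev.span_zero[of "RL \<union> RN"] by presburger
qed (auto simp: prj_def lop_ext)

lemma span_V: "ev.span (RL \<union> RN) \<subseteq> V"
  unfolding V_def by (rule ev.span_mono) auto

lemma Q_eq_0_supp: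
  assumes "\<And>g. g \<in> keys u \<Longrightarrow> vl g"
  shows "Q u = 0 \<longleftrightarrow> u \<in> ev.span (RL \<union> RN)"
proof
  assume "Q u = 0"
  then have "prj u \<in> ev.span (RL \<union> RN)" using prj_V Q_eq_0 by blast
  then show "u \<in> ev.span (RL \<union> RN)" by (simp only: prj_id[OF assms])
next
  assume "u \<in> ev.span (RL \<union> RN)"
  then show "Q u = 0" using span_V Q_eq_0 by blast
qed

lemma lookup_in_fspan:
  assumes "Nd = (\<lambda>_. B)" "\<And>g. g \<in> keys u \<Longrightarrow> vl g"
  shows "lookup u \<in> fspan (relgens sc G B) \<longleftrightarrow> Q u = 0"
proof -
  have "Q u = 0 \<longleftrightarrow> u \<in> ev.span (RL \<union> RN)" using assms(2) by (rule Q_eq_0_supp)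
  then show ?thesis unfolding relgens_eq[OF assms(1)] fspan_lookup poly_mapping.lookup_inject by simp
qed

lemma lookup_in_fspanD:
  assumes "Nd = (\<lambda>_. B)" "lookup u \<in> fspan (relgens sc G B)"
  shows "Q u = 0"
  using assms(2) span_V unfolding relgens_eq[OF assms(1)] fspan_lookup Q_eq_0 poly_mapping.lookup_inject
  by blast

end

text \<open>The value in \<open>A\<close> of the length one part of a tensor; it turns \<open>b'\<^sup>2 = 0\<close> into Stasheff's identities.\<close>

definition len1 :: "('k::field \<Rightarrow> 'a::ab_group_add \<Rightarrow> 'a) \<Rightarrow> ('k,'a) ev \<Rightarrow> 'a" where
  "len1 sc u = (\<Sum>g\<in>keys u. if length g = 1 then sc (lookup u g) (snd (hd g)) else 0)"

context
  fixes sc :: "'k::field_char_0 \<Rightarrow> 'a::ab_group_add \<Rightarrow> 'a"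
  assumes sc: "vector_space sc"
begin

interpretation scv: vector_space sc by (rule sc)

lemma len1_superset:
  "finite A \<Longrightarrow> keys u \<subseteq> A \<Longrightarrow> len1 sc u = (\<Sum>g\<in>A. if length g = 1 then sc (lookup u g) (snd (hd g)) else 0)"
  unfolding len1_def by (rule sum.mono_neutral_left) (auto simp: in_keys_iff)

lemma len1_add: "len1 sc (u + v) = len1 sc u + len1 sc v"
proof -
  have "keys (u + v) \<subseteq> keys u \<union> keys v" by (rule keys_add)
  then show ?thesis
    by (simp add: len1_superset[of "keys u \<union> keys v"] sum.distrib[symmetric])
      (auto intro!: sum.cong simp: lookup_add scv.scale_left_distrib)
qed

lemma len1_scal: "len1 sc (scal c u) = sc c (len1 sc u)"
proof -
  have "keys (scal c u) \<subseteq> keys u" by (auto simp: in_keys_iff)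
  then show ?thesis
    by (simp add: len1_superset[of "keys u"] scv.scale_sum_right) (auto intro!: sum.cong)
qed

lemma len1_zero: "len1 sc 0 = 0" by (simp add: len1_def)

lemma len1_diff: "len1 sc (u - v) = len1 sc u - len1 sc v"
  using len1_add[of u "- v"] len1_scal[of "- 1" v] by simp

lemma len1_sum: "len1 sc (\<Sum>i\<in>I. f i) = (\<Sum>i\<in>I. len1 sc (f i))"
  by (induction I rule: infinite_finite_induct) (auto simp: len1_add len1_zero)

lemma len1_gn: "len1 sc (gn g) = (if length g = 1 then snd (hd g) else 0)"
  by (simp add: len1_def gn_def)

text \<open>Length one is reached only by a single operation that consumes the whole list.\<close>

lemma len1_bpE:
  assumes "ys \<noteq> []"
  shows "len1 sc (bpE m ys) = m (length ys) (map snd ys)"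
proof -
  let ?X = "m (length ys) (map snd ys)"
  have t: "len1 sc (scal ((-1) ^ sdeg (take i ys)) (gn (take i ys @ [Defs.mapp m (take j (drop i ys))] @ drop (i + j) ys)))
      = (if i = 0 \<and> j = length ys then ?X else 0)" if "i < length ys" "j \<in> {1..length ys - i}" for i j
  proof -
    have l: "length (take i ys @ [Defs.mapp m (take j (drop i ys))] @ drop (i + j) ys) = length ys - j + 1"
      using that by auto
    show ?thesis
    proof (cases "i = 0 \<and> j = length ys")
      case True
      then show ?thesis by (simp add: len1_scal len1_gn mapp_eq)
    next
      case False
      then have "length ys - j + 1 \<noteq> 1" using that by auto
      then show ?thesis unfolding len1_scal len1_gn l using False by auto
    qed
  qed
  have "len1 sc (bpE m ys) = (\<Sum>i<length ys. \<Sum>j\<in>{1..length ys - i}. if i = 0 \<and> j = length ys then ?X else 0)"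
    unfolding bpE_def len1_sum by (intro sum.cong refl t) auto
  also have "\<dots> = (\<Sum>i<length ys. if i = 0 then ?X else 0)"
    by (intro sum.cong refl) (use assms in \<open>auto simp: sum.delta Suc_le_eq\<close>)
  also have "\<dots> = ?X" using assms by (simp add: sum.delta)
  finally show ?thesis .
qed

end

text \<open>The hypothesis places \<open>b'\<^sup>2\<close> in the span of the relations, on which
  \<open>len1\<close> vanishes. The length one part of \<open>b'\<^sup>2\<close> is an inner
  operation followed by one on the whole shortened list, which is Stasheff's sum.\<close>

lemma ainf_alg_presentation:
  fixes sc :: "'k::field_char_0 \<Rightarrow> 'a::ab_group_add \<Rightarrow> 'a"
  assumes A: "ainf_alg sc G m"
  shows "ainf_presentation sc G (\<lambda>_. {0}) m"
proof -
  have sc: "vector_space sc" using A by (simp add: ainf_alg_def)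
  interpret scv: vector_space sc by (rule sc)
  have lin: "m n (xs @ (sc c a + b) # ys) = sc c (m n (xs @ a # ys)) + m n (xs @ b # ys)"
    if "length xs + length ys + 1 = n" for n xs ys a b c
  proof -
    have "\<forall>n xs ys a b c. length xs + length ys + 1 = n \<longrightarrow>
          m n (xs @ [sc c a + b] @ ys) = sc c (m n (xs @ [a] @ ys)) + m n (xs @ [b] @ ys)"
      using A unfolding ainf_alg_def by blast
    from this[rule_format, OF that, of c a b] show ?thesis by simp
  qed
  have zero: "m n (xs @ 0 # ys) = 0" if "length xs + length ys + 1 = n" for n xs ys
    using lin[OF that, of 1 0 0] by simp
  have deg: "if 2 \<le> sdeg xs then m (length xs) (map snd xs) \<in> G (sdeg xs - 2) else m (length xs) (map snd xs) = 0"
    if "valid G xs" "xs \<noteq> []" for xs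
    using A that unfolding ainf_alg_def by blast
  interpret graded_presentation sc G "\<lambda>_. {0}"
    using A by unfold_locales (auto simp: ainf_alg_def graded_vs_def)
  interpret operations sc G "\<lambda>_. {0}" m
  proof
    show "m (length us + length vs + 1) (map snd us @ a # map snd vs) \<in> {0}" if "a \<in> {0}" for us vs :: "'a hlist" and a
      using zero[of "map snd us" "map snd vs"] that by simp
  qed (use lin deg in \<open>auto split: if_splits\<close>)
  show ?thesis
  proof
    fix xs assume v: "valid G xs" "xs \<noteq> []"
    have "lookup (ext (bpE m) (bpE m xs)) \<in> fspan (relgens sc G {0})"
    proof -
      have "\<forall>xs. valid G xs \<longrightarrow> lin (bpgen m) (bpgen m xs) \<in> fspan (relgens sc G {0})"
        using A unfolding ainf_alg_def by blast
      then show ?thesis using v(1) by (simp add: lookup_ext lookup_bpE)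
    qed
    then have "\<exists>u\<in>ev.span (RL \<union> RN). lookup (ext (bpE m) (bpE m xs)) = lookup u"
      unfolding relgens_eq[OF refl] fspan_lookup by assumption
    then obtain u where u: "u \<in> ev.span (RL \<union> RN)" "lookup (ext (bpE m) (bpE m xs)) = lookup u"
      by (elim bexE)
    have "ext (bpE m) (bpE m xs) = u" using u(2) unfolding poly_mapping.lookup_inject .
    moreover have "len1 sc u = 0"
      using u(1)
    proof (induction rule: ev.span_induct_alt)
      case base then show ?case by (simp add: len1_zero[OF sc])
    next
      case (step c x y)
      have "len1 sc x = 0"
        using step(1) unfolding RL_def RN_def
        by (auto simp: len1_diff[OF sc] len1_scal[OF sc] len1_gn[OF sc] length_Suc_conv append_eq_Cons_conv)
      then show ?case using step by (simp add: len1_add[OF sc] len1_scal[OF sc])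
    qed
    ultimately have "len1 sc (ext (bpE m) (bpE m xs)) = 0" by simp
    moreover have "len1 sc (ext (bpE m) (bpE m xs)) = (\<Sum>i<length xs. \<Sum>j\<in>{1..length xs - i}. sc ((-1) ^ sdeg (take i xs))
       (m (length xs - j + 1) (map snd (take i xs) @ m j (map snd (take j (drop i xs))) # map snd (drop (i + j) xs))))"
      unfolding bpE_def[of m xs] lop_sum[OF lop_ext] len1_sum[OF sc] lop_scal[OF lop_ext] len1_scal[OF sc] ext_gn
    proof (intro sum.cong refl arg_cong2[where f=sc])
      fix i j assume ij: "i \<in> {..<length xs}" "j \<in> {1..length xs - i}"
      then have l: "length (take i xs @ [Defs.mapp m (take j (drop i xs))] @ drop (i + j) xs) = length xs - j + 1" by auto
      have "length (take j (drop i xs)) = j" using ij by simp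
      then show "len1 sc (bpE m (take i xs @ [Defs.mapp m (take j (drop i xs))] @ drop (i + j) xs)) =
         m (length xs - j + 1) (map snd (take i xs) @ m j (map snd (take j (drop i xs))) # map snd (drop (i + j) xs))"
        by (subst len1_bpE[OF sc]) (simp, unfold l, simp add: mapp_eq)
    qed
    ultimately show "(\<Sum>i<length xs. \<Sum>j\<in>{1..length xs - i}. sc ((-1) ^ sdeg (take i xs))
       (m (length xs - j + 1) (map snd (take i xs) @ m j (map snd (take j (drop i xs))) # map snd (drop (i + j) xs)))) \<in> {0}"
      by simp
  qed
qed

context graded_presentation
begin

text \<open>A representative of \<open>pj l f x\<close> supported on lists of this length and
  weight. The one chosen by \<open>Q\<close> comes from an arbitrary basis and may involve other
  lists.\<close>

definition rpj :: "int \<Rightarrow> int \<Rightarrow> ('k,'a) ev \<Rightarrow> ('k,'a) ev" where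
  "rpj l f = ext (\<lambda>g. if vl g \<and> int (length g) = l \<and> int (sum_list (map fst g)) = f then gn g else 0)"

lemma keys_rpj: "g \<in> keys (rpj l f x) \<Longrightarrow> vl g \<and> int (length g) = l \<and> int (sum_list (map fst g)) = f"
  using keys_ext[of "\<lambda>g. if vl g \<and> int (length g) = l \<and> int (sum_list (map fst g)) = f then gn g else 0" x]
  by (auto simp: rpj_def gn_def split: if_splits)

lemma Q_rpj: "Q (rpj l f x) = pj l f x"
proof -
  have "Q (rpj l f (gn g)) = pj l f (gn g)" for g
    by (cases "vl g") (auto simp: rpj_def pj_gn sdeg_eq Qs wop_invalid[OF wop_pj])
  moreover have "lop (rpj l f)" unfolding rpj_def by (rule lop_ext)
  ultimately show ?thesis using lop_eqI[OF lop_comp[OF lop_Q] lop_pj] by blast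
qed

lemma pj_keys:
  assumes "\<And>g. g \<in> keys u \<Longrightarrow> vl g \<and> int (length g) = l \<and> int (sum_list (map fst g)) = f"
  shows "pj l f u = Q u"
  by (rule lop_eqI[OF lop_pj lop_Q]) (use assms in \<open>auto simp: pj_gn sdeg_eq\<close>)

definition vlk :: "('k,'a) ev \<Rightarrow> bool" where
  "vlk u \<longleftrightarrow> (\<forall>g\<in>keys u. vl g)"

lemma vlkD: "vlk u \<Longrightarrow> g \<in> keys u \<Longrightarrow> vl g"
  by (simp add: vlk_def)

lemma vlk_0: "vlk 0" by (simp add: vlk_def)

lemma vlk_gn: "vl g \<Longrightarrow> vlk (gn g)" by (simp add: vlk_def gn_def)

lemma vlk_add: "vlk u \<Longrightarrow> vlk v \<Longrightarrow> vlk (u + v)"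
  unfolding vlk_def using keys_add[of u v] by blast

lemma vlk_scal: "vlk u \<Longrightarrow> vlk (scal c u)"
  unfolding vlk_def by (auto simp: in_keys_iff)

lemma vlk_minus: "vlk u \<Longrightarrow> vlk (- u)"
  using vlk_scal[of u "-1"] by simp

lemma vlk_diff: "vlk u \<Longrightarrow> vlk v \<Longrightarrow> vlk (u - v)"
  using vlk_add[of u "- v"] vlk_minus[of v] by simp

lemma vlk_sum: "(\<And>i. i \<in> I \<Longrightarrow> vlk (f i)) \<Longrightarrow> vlk (\<Sum>i\<in>I. f i)"
  by (induction I rule: infinite_finite_induct) (auto simp: vlk_0 vlk_add)

lemma vlk_ext: "vlk u \<Longrightarrow> (\<And>g. vl g \<Longrightarrow> vlk (F g)) \<Longrightarrow> vlk (ext F u)"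
  unfolding vlk_def using keys_ext[of F u] by blast

end

context operations
begin

lemma vlk_bpE:
  assumes "vl xs"
  shows "vlk (bpE m xs)"
  unfolding bpE_def
proof (rule vlk_sum[OF vlk_sum[OF vlk_scal[OF vlk_gn]]])
  fix i j
  assume ij: "i \<in> {..<length xs}" "j \<in> {1..length xs - i}"
  have "valid G xs" using assms by (simp add: vl_def)
  moreover have "take j (drop i xs) \<noteq> []" using ij by auto
  ultimately show "vl (take i xs @ [Defs.mapp m (take j (drop i xs))] @ drop (i + j) xs)"
    using mapp_in[of "take j (drop i xs)"] by (simp add: vl_def vt)
qed

lemma vlk_bE:
  assumes "vl xs"
  shows "vlk (bE m xs)"
  unfolding bE_def
proof (rule vlk_add[OF vlk_bpE[OF assms] vlk_sum[OF vlk_sum[OF vlk_scal[OF vlk_gn]]]])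
  fix s j
  assume ij: "s \<in> {1..<length xs}" "j \<in> {s+1..length xs}"
  have "valid G (rot s xs)" using assms vt[of xs] by (simp add: vl_def rot_def)
  moreover have "length (rot s xs) = length xs" by (simp add: rot_def)
  then have "take j (rot s xs) \<noteq> []" using ij by auto
  ultimately show "vl (Defs.mapp m (take j (rot s xs)) # drop j (rot s xs))"
    using mapp_in[of "take j (rot s xs)"] by (simp add: vl_def vt)
qed

lemma vlk_lamE:
  assumes "vl xs"
  shows "vlk (lamE s xs)"
proof -
  have "length (rot s xs) = length xs" by (simp add: rot_def)
  then have "rot s xs \<noteq> []" using assms by (auto simp: vl_def)
  moreover have "valid G (rot s xs)" using assms vt[of xs] by (simp add: vl_def rot_def)
  ultimately show ?thesis unfolding lamE_def by (intro vlk_scal vlk_gn) (simp add: vl_def)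
qed

lemma vlk_DE:
  assumes X: "\<And>p. vlk (X p)"
  shows "vlk (DE m X p)"
proof -
  have "vlk (NE g)" if "vl g" for g
    unfolding NE_def by (rule vlk_sum[OF vlk_lamE[OF that]])
  then have "vlk (ext NE (X q))" for q by (rule vlk_ext[OF X])
  moreover have "vlk (ext (bE m) (X q))" "vlk (ext (bpE m) (X q))" "vlk (ext (lamE s) (X q))" for q s
    by (rule vlk_ext[OF X] vlk_bE vlk_bpE vlk_lamE; assumption?)+
  ultimately show ?thesis unfolding DE_def by (simp add: vlk_add vlk_diff vlk_minus X)
qed

lemma bb_1: "bb 1 x = bp 1 x"
  by (rule ln_cong_all[OF wop_bb wop_bp]) (simp add: bb_ln bp_ln)

end

section \<open>Cycles, boundaries and homotopies\<close>

locale ainf_algebra = ainf_presentation sc G "\<lambda>_. {0}" m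
  for sc :: "'k::field_char_0 \<Rightarrow> 'a::ab_group_add \<Rightarrow> 'a" and G m
begin

section \<open>The operations in low arity, cycles and boundaries\<close>

definition M1 :: "'a \<Rightarrow> 'a" where "M1 a = m 1 [a]"

definition Zc :: "nat \<Rightarrow> 'a set" where "Zc d = {a \<in> G d. M1 a = 0}"

definition Bd :: "nat \<Rightarrow> 'a set" where "Bd d = M1 ` G (Suc d)"

lemma M1_lin: "M1 (sc c a + b) = sc c (M1 a) + M1 b"
  unfolding M1_def using m_lin[of "[]" "[]" 1 c a b] by simp

lemma M1_add: "M1 (a + b) = M1 a + M1 b" using M1_lin[of 1 a b] by simp

lemma M1_zero [simp]: "M1 0 = 0" using M1_add[of 0 0] by simp

lemma M1_scale: "M1 (sc c a) = sc c (M1 a)" using M1_lin[of c a 0] by simp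

lemma M1_minus: "M1 (- a) = - M1 a" using M1_scale[of "-1" a] by simp

lemma M1_diff: "M1 (a - b) = M1 a - M1 b" using M1_add[of a "- b"] M1_minus[of b] by simp

lemma M1_in: "a \<in> G (Suc d) \<Longrightarrow> M1 a \<in> G d"
  using m_deg[of "[(Suc d, a)]"] by (simp add: M1_def)

lemma M1_G0: "a \<in> G 0 \<Longrightarrow> M1 a = 0"
  using m_junk[of "[(0, a)]"] by (simp add: M1_def)

lemma mapp_1: "Defs.mapp m [(d, a)] = (d - 1, M1 a)"
  by (simp add: mapp_eq M1_def)

lemma G_minus: "a \<in> G d \<Longrightarrow> - a \<in> G d"
  using G_scale[of a d "-1"] by simp

lemma G_diff: "a \<in> G d \<Longrightarrow> b \<in> G d \<Longrightarrow> a - b \<in> G d"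
  using G_add[of a d "- b"] G_minus[of b d] by simp

lemma M1_M1: "a \<in> G d \<Longrightarrow> M1 (M1 a) = 0"
proof (cases "2 \<le> d")
  case True
  assume "a \<in> G d"
  then show ?thesis using stasheff[of "[(d, a)]"] True by (simp add: M1_def)
next
  case False
  assume a: "a \<in> G d"
  have "d = 0 \<or> d = Suc 0" using False by auto
  then show ?thesis using a M1_G0[of a] M1_G0[of "M1 a"] M1_in[of a 0] by auto
qed

lemma m2_in: "a \<in> G d \<Longrightarrow> b \<in> G e \<Longrightarrow> m 2 [a, b] \<in> G (d + e)"
  using m_deg[of "[(d, a), (e, b)]"] by (simp add: numeral_2_eq_2)

lemma m2_zero: "m 2 [0, b] = 0" "m 2 [a, 0] = 0"
  using m_zero[of "[]" "[b]" 2] m_zero[of "[a]" "[]" 2] by simp_all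

text \<open>Stasheff's identity for two entries, with the signs of \<open>A[1]\<close>: passing
  \<open>a\<close> costs its shifted degree \<open>d + 1\<close>.\<close>

lemma leibniz:
  assumes "a \<in> G d" "b \<in> G e"
  shows "M1 (m 2 [a, b]) + m 2 [M1 a, b] + sc ((-1) ^ (d + 1)) (m 2 [a, M1 b]) = 0"
proof (cases "d + e = 0")
  case True
  then show ?thesis using assms m2_in[OF assms] by (simp add: M1_G0 m2_zero)
next
  case False
  have I: "{..<2::nat} = {0, 1}" "{1..2::nat} = {1, 2}" by auto
  have "(\<Sum>i<2. \<Sum>j\<in>{1..2 - i}. sc ((-1) ^ sdeg (take i [(d, a), (e, b)]))
       (m (2 - j + 1) (map snd (take i [(d, a), (e, b)]) @ m j (map snd (take j (drop i [(d, a), (e, b)]))) #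
          map snd (drop (i + j) [(d, a), (e, b)])))) = 0"
    using stasheff[of "[(d, a), (e, b)]"] assms False by (simp add: numeral_2_eq_2)
  then show ?thesis unfolding I(1) by (simp add: I M1_def numeral_2_eq_2 algebra_simps)
qed

text \<open>In Stasheff's identity for three cycles the terms with an inner \<open>m\<^sub>1\<close>
  vanish; the term left besides the two products is \<open>m\<^sub>1\<close> of a value of
  \<open>m\<^sub>3\<close>.\<close>

lemma assoc:
  assumes "a \<in> Zc d" "b \<in> Zc e" "c \<in> Zc f"
  shows "m 2 [m 2 [a, b], c] + sc ((-1) ^ (d + 1)) (m 2 [a, m 2 [b, c]]) \<in> Bd (d + e + f)"
proof -
  let ?xs = "[(d, a), (e, b), (f, c)]"
  have z: "m 3 [0, x, y] = 0" "m 3 [x, 0, y] = 0" "m 3 [x, y, 0] = 0" for x y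
    using m_zero[of "[]" "[x, y]" 3] m_zero[of "[x]" "[y]" 3] m_zero[of "[x, y]" "[]" 3] by simp_all
  have I: "{..<3::nat} = {0, 1, 2}" "{1..3::nat} = {1, 2, 3}" "{1..2::nat} = {1, 2}" by auto
  have v: "a \<in> G d" "b \<in> G e" "c \<in> G f" "m 1 [a] = 0" "m 1 [b] = 0" "m 1 [c] = 0"
    using assms by (auto simp: Zc_def M1_def)
  have "(\<Sum>i<3. \<Sum>j\<in>{1..3 - i}. sc ((-1) ^ sdeg (take i ?xs))
       (m (3 - j + 1) (map snd (take i ?xs) @ m j (map snd (take j (drop i ?xs))) # map snd (drop (i + j) ?xs)))) = 0"
    using stasheff[of ?xs] v by (simp add: numeral_3_eq_3)
  then have "m 2 [m 2 [a, b], c] + sc ((-1) ^ (d + 1)) (m 2 [a, m 2 [b, c]]) + M1 (m 3 [a, b, c]) = 0"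
    unfolding I(1) using v(4-6) z by (simp add: I M1_def numeral_2_eq_2 numeral_3_eq_3 algebra_simps)
  then have "m 2 [m 2 [a, b], c] + sc ((-1) ^ (d + 1)) (m 2 [a, m 2 [b, c]]) = M1 (- m 3 [a, b, c])"
    by (simp add: M1_minus eq_neg_iff_add_eq_0)
  moreover have "m 3 [a, b, c] \<in> G (Suc (d + e + f))"
    using m_deg[of ?xs] v by (simp add: numeral_3_eq_3 add.assoc)
  ultimately show ?thesis unfolding Bd_def using G_minus by blast
qed

lemma m0_cases: "m0 m n as = (if n = 2 then m 2 as else 0)"
  by (simp add: m0_def)

lemma Zc_G: "a \<in> Zc d \<Longrightarrow> a \<in> G d"
  by (simp add: Zc_def)

lemma valid_Zc_G: "valid Zc xs \<Longrightarrow> valid G xs"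
  by (auto simp: valid_def Zc_def)

lemma Zc_zero: "0 \<in> Zc d" and Bd_zero: "0 \<in> Bd d"
  using G_zero by (auto simp: Zc_def Bd_def image_iff intro!: bexI[of _ 0])

lemma length_2: "length bs = 2 \<longleftrightarrow> (\<exists>p q. bs = [p, q])"
  by (auto simp: numeral_2_eq_2 length_Suc_conv)

lemma m2_Zc: "a \<in> Zc d \<Longrightarrow> b \<in> Zc e \<Longrightarrow> m 2 [a, b] \<in> Zc (d + e)"
  using leibniz[of a d b e] m2_in[of a d b e] by (simp add: Zc_def m2_zero)

lemma m2_Bd:
  assumes "a \<in> Zc d" "b \<in> Zc e" "a \<in> Bd d \<or> b \<in> Bd e"
  shows "m 2 [a, b] \<in> Bd (d + e)"
  using assms(3)
proof
  assume "a \<in> Bd d"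
  then obtain c where c: "c \<in> G (Suc d)" "a = M1 c" by (auto simp: Bd_def)
  have "m 2 [a, b] = M1 (- m 2 [c, b])"
    using leibniz[of c "Suc d" b e] c assms by (simp add: Zc_def m2_zero M1_minus eq_neg_iff_add_eq_0 add.commute)
  then show ?thesis using m2_in[OF c(1), of b e] assms unfolding Bd_def Zc_def
    by (auto intro!: imageI G_minus)
next
  assume "b \<in> Bd e"
  then obtain c where c: "c \<in> G (Suc e)" "b = M1 c" by (auto simp: Bd_def)
  have e: "M1 (m 2 [a, c]) + sc ((-1) ^ (d + 1)) (m 2 [a, b]) = 0"
    using leibniz[of a d c "Suc e"] c assms by (simp add: Zc_def m2_zero)
  have "m 2 [a, b] = sc ((-1) ^ (d + 1)) (sc ((-1) ^ (d + 1)) (m 2 [a, b]))"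
    by (simp flip: power_mult_distrib)
  also have "sc ((-1) ^ (d + 1)) (m 2 [a, b]) = - M1 (m 2 [a, c])"
    using e by (simp add: eq_neg_iff_add_eq_0 add.commute)
  finally have "m 2 [a, b] = M1 (sc ((-1) ^ (d + 1)) (- m 2 [a, c]))"
    by (simp only: M1_scale M1_minus)
  then show ?thesis using m2_in[of a d c "Suc e"] c assms unfolding Bd_def Zc_def
    by (auto intro!: imageI G_minus G_scale)
qed

text \<open>\<open>W2\<close> presents the tensor powers of \<open>H(A)\<close> with \<open>m\<^sub>2\<close>, and \<open>W3\<close> below those of \<open>H\<^sub>0(A)\<close>.\<close>

sublocale W2: ainf_presentation sc Zc Bd "m0 m"
proof
  fix a b c d
  show "0 \<in> Zc d" by (rule Zc_zero)
  show "a \<in> Zc d \<Longrightarrow> b \<in> Zc d \<Longrightarrow> a + b \<in> Zc d" by (simp add: Zc_def G_add M1_add)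
  show "a \<in> Zc d \<Longrightarrow> sc c a \<in> Zc d" by (simp add: Zc_def G_scale M1_scale)
next
  fix xs ys :: "'a list" and n c a b
  assume "length xs + length ys + 1 = n"
  then show "m0 m n (xs @ (sc c a + b) # ys) = sc c (m0 m n (xs @ a # ys)) + m0 m n (xs @ b # ys)"
    using m_lin by (simp add: m0_cases)
next
  fix bs assume *: "valid Zc bs" "bs \<noteq> []" "2 \<le> sdeg bs"
  show "m0 m (length bs) (map snd bs) \<in> Zc (sdeg bs - 2)"
  proof (cases "length bs = 2")
    case True
    then obtain d a e b where "bs = [(d, a), (e, b)]" unfolding length_2 by (metis surj_pair)
    then show ?thesis using * m2_Zc[of a d b e] by (simp add: m0_cases valid_def)
  qed (simp add: m0_cases Zc_zero)
next
  fix bs assume "valid Zc bs" "bs \<noteq> []" "sdeg bs < 2"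
  then show "m0 m (length bs) (map snd bs) = 0" by (simp add: m0_cases sdeg_eq)
next
  fix us vs d a
  assume *: "valid Zc us" "valid Zc vs" "a \<in> Zc d" "a \<in> Bd d"
  show "m0 m (length us + length vs + 1) (map snd us @ a # map snd vs) \<in> Bd (sdeg (us @ (d, a) # vs) - 2)"
  proof (cases "length us + length vs + 1 = 2")
    case True
    then have "(\<exists>e b. us = [] \<and> vs = [(e, b)]) \<or> (\<exists>e b. us = [(e, b)] \<and> vs = [])"
      by (cases us; cases vs) auto
    then consider e b where "us = []" "vs = [(e, b)]" | e b where "us = [(e, b)]" "vs = []" by blast
    then show ?thesis
    proof cases
      case 1
      then show ?thesis using * m2_Bd[of a d b e] by (simp add: m0_cases valid_def numeral_2_eq_2[symmetric])
    next
      case 2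
      then show ?thesis using * m2_Bd[of b e a d] by (simp add: m0_cases valid_def numeral_2_eq_2[symmetric])
    qed
  qed (simp add: m0_cases Bd_zero)
next
  fix xs assume v: "valid Zc xs" "xs \<noteq> []" "3 \<le> sdeg xs"
  let ?t = "\<lambda>i j. m0 m (length xs - j + 1) (map snd (take i xs) @ m0 m j (map snd (take j (drop i xs))) # map snd (drop (i + j) xs))"
  have z: "?t i j = 0" if ij: "i < length xs" "j \<in> {1..length xs - i}" and "j \<noteq> 2 \<or> length xs \<noteq> 3" for i j
  proof (cases "j = 2")
    case True
    then have "length xs - j + 1 \<noteq> 2" using that by auto
    then show ?thesis by (simp add: m0_cases)
  next
    case False
    have "length (map snd (take i xs)) + length (map snd (drop (i + j) xs)) + 1 = length xs - j + 1"
      using ij by auto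
    from m_zero[OF this] show ?thesis using False by (auto simp: m0_cases numeral_2_eq_2)
  qed
  show "(\<Sum>i<length xs. \<Sum>j\<in>{1..length xs - i}. sc ((-1) ^ sdeg (take i xs)) (?t i j)) \<in> Bd (sdeg xs - 3)"
  proof (cases "length xs = 3")
    case False
    have "(\<Sum>i<length xs. \<Sum>j\<in>{1..length xs - i}. sc ((-1) ^ sdeg (take i xs)) (?t i j)) = 0"
      by (intro sum.neutral ballI) (use z False in auto)
    then show ?thesis using Bd_zero by simp
  next
    case True
    then obtain d a e b f c where xs: "xs = [(d, a), (e, b), (f, c)]"
      by (auto simp: numeral_3_eq_3 length_Suc_conv)
    have I: "{..<3::nat} = {0, 1, 2}" "{1..3::nat} = {1, 2, 3}" "{1..2::nat} = {1, 2}" by auto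
    have "(\<Sum>i<length xs. \<Sum>j\<in>{1..length xs - i}. sc ((-1) ^ sdeg (take i xs)) (?t i j)) =
       (\<Sum>i<3. \<Sum>j\<in>{1..3 - i}. sc ((-1) ^ sdeg (take i xs)) (?t i j))"
      by (simp only: True)
    also have "\<dots> = (\<Sum>i<3. \<Sum>j\<in>{1..3 - i}. if j = 2 then sc ((-1) ^ sdeg (take i xs)) (?t i 2) else 0)"
      by (intro sum.cong refl) (use z True in auto)
    also have "\<dots> = sc ((-1) ^ sdeg (take 0 xs)) (?t 0 2) + sc ((-1) ^ sdeg (take 1 xs)) (?t 1 2)"
      unfolding I(1) by (simp add: I)
    also have "\<dots> = m 2 [m 2 [a, b], c] + sc ((-1) ^ (d + 1)) (m 2 [a, m 2 [b, c]])"
      by (simp add: xs m0_cases numeral_2_eq_2)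
    also have "\<dots> \<in> Bd (sdeg xs - 3)"
      using assoc[of a d b e c f] v(1) by (simp add: xs valid_def add.assoc)
    finally show ?thesis .
  qed
qed

lemma W2_mu: "j \<noteq> 2 \<Longrightarrow> W2.mu j x = 0"
proof (rule W2.wop_eqI[OF W2.wop_mu W2.wop_0])
  fix xs assume j: "j \<noteq> 2" and v: "W2.vl xs"
  show "W2.mu j (gn xs) = 0"
  proof (cases "1 \<le> j \<and> j \<le> length xs")
    case True
    then have l: "length (take j xs) = j" "take j xs \<noteq> []" by auto
    have "W2.mu j (gn xs) = W2.Q (gn (Defs.mapp (m0 m) (take j xs) # drop j xs))"
      using W2.mu_gn[of "take j xs" "drop j xs"] l v by simp
    moreover have "snd (Defs.mapp (m0 m) (take j xs)) = 0"
      unfolding mapp_eq l(1) using j by (simp add: m0_cases)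
    ultimately show ?thesis using W2.Q_zero[of "[]" "drop j xs" "fst (Defs.mapp (m0 m) (take j xs))"] v W2.vt(2)[of xs j]
      by (cases "Defs.mapp (m0 m) (take j xs)") (simp add: W2.vl_def)
  next
    case False
    then consider "j = 0" | "length xs < j" by linarith
    then show ?thesis using W2.mu_0 W2.mu_short[OF v] by cases auto
  qed
qed

sublocale W3: operations sc "G0 G" "\<lambda>_. N0 m G" "m0 m"
proof
  fix a b c d
  show "0 \<in> G0 G d" by (simp add: G0_def G_zero)
  show "a \<in> G0 G d \<Longrightarrow> b \<in> G0 G d \<Longrightarrow> a + b \<in> G0 G d" by (auto simp: G0_def G_add split: if_splits)
  show "a \<in> G0 G d \<Longrightarrow> sc c a \<in> G0 G d" by (auto simp: G0_def G_scale split: if_splits)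
next
  fix xs ys :: "'a list" and n c a b
  assume "length xs + length ys + 1 = n"
  then show "m0 m n (xs @ (sc c a + b) # ys) = sc c (m0 m n (xs @ a # ys)) + m0 m n (xs @ b # ys)"
    using m_lin by (simp add: m0_cases)
next
  fix bs assume *: "valid (G0 G) bs" "bs \<noteq> []" "2 \<le> sdeg bs"
  show "m0 m (length bs) (map snd bs) \<in> G0 G (sdeg bs - 2)"
  proof (cases "length bs = 2")
    case True
    then obtain d a e b where "bs = [(d, a), (e, b)]" unfolding length_2 by (metis surj_pair)
    then show ?thesis using * m2_in[of a d b e] 
      by (auto simp: m0_cases valid_def G0_def m2_zero G_zero split: if_splits)
  qed (simp add: m0_cases G0_def G_zero)
next
  fix bs assume "valid (G0 G) bs" "bs \<noteq> []" "sdeg bs < 2"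
  then show "m0 m (length bs) (map snd bs) = 0" by (simp add: m0_cases sdeg_eq)
next
  fix us vs d a
  assume *: "valid (G0 G) us" "valid (G0 G) vs" "a \<in> G0 G d" "a \<in> N0 m G"
  have N: "N0 m G = Bd 0" by (simp add: N0_def Bd_def M1_def)
  have G0: "G 0 = Zc 0" by (auto simp: Zc_def M1_G0)
  show "m0 m (length us + length vs + 1) (map snd us @ a # map snd vs) \<in> N0 m G"
  proof (cases "length us + length vs + 1 = 2")
    case True
    then have "(\<exists>e b. us = [] \<and> vs = [(e, b)]) \<or> (\<exists>e b. us = [(e, b)] \<and> vs = [])"
      by (cases us; cases vs) auto
    then show ?thesis
      using * m2_Bd[of a 0 _ 0] m2_Bd[of _ 0 a 0] unfolding N
      by (auto simp: m0_cases valid_def numeral_2_eq_2[symmetric] G0_def G0 m2_zero Bd_zero split: if_splits)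
  qed (simp add: m0_cases N Bd_zero)
qed

text \<open>A linear section of \<open>m\<^sub>1\<close> over the boundaries, available over a
  field. It is defined on all of \<open>A\<close>, with values in degree \<open>d + 1\<close>
  whatever its argument.\<close>

definition sH :: "nat \<Rightarrow> 'a \<Rightarrow> 'a" where
  "sH d = (SOME s. (\<forall>c a b. s (sc c a + b) = sc c (s a) + s b) \<and> range s \<subseteq> G (Suc d) \<and> (\<forall>c\<in>G (Suc d). M1 (s (M1 c)) = M1 c))"

lemma sH_spec: "(\<forall>c a b. sH d (sc c a + b) = sc c (sH d a) + sH d b) \<and> range (sH d) \<subseteq> G (Suc d) \<and> (\<forall>c\<in>G (Suc d). M1 (sH d (M1 c)) = M1 c)"
proof -
  interpret pr: vector_space_pair sc sc ..
  have l: "Vector_Spaces.linear sc sc M1"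
    by (simp add: Vector_Spaces.linear_iff M1_add M1_scale scv.vector_space_axioms)
  have S: "scv.subspace (G (Suc d))"
    by (rule scv.subspaceI) (auto simp: G_zero G_add G_scale)
  obtain g where g: "range g \<subseteq> G (Suc d)" "Vector_Spaces.linear sc sc g" "\<forall>v\<in>M1 ` G (Suc d). M1 (g v) = v"
    using pr.linear_exists_right_inverse_on[OF l S] by auto
  have "g (sc c a + b) = sc c (g a) + g b" for c a b
    using g(2) by (simp add: Vector_Spaces.linear_iff)
  then have "\<exists>s. (\<forall>c a b. s (sc c a + b) = sc c (s a) + s b) \<and> range s \<subseteq> G (Suc d) \<and> (\<forall>c\<in>G (Suc d). M1 (s (M1 c)) = M1 c)"
    using g by blast
  then show ?thesis unfolding sH_def by (rule someI_ex)
qed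

lemma sH_lin: "sH d (sc c a + b) = sc c (sH d a) + sH d b"
  and sH_in: "sH d a \<in> G (Suc d)"
  and M1_sH_M1: "e \<in> G (Suc d) \<Longrightarrow> M1 (sH d (M1 e)) = M1 e"
  using sH_spec[of d] by auto

lemma sH_zero [simp]: "sH d 0 = 0"
  using sH_lin[of d 1 0 0] by simp

text \<open>A chain map homotopic to the identity, with values in the cycles and vanishing on the boundaries.\<close>

definition P :: "nat \<Rightarrow> 'a \<Rightarrow> 'a" where
  "P d a = a - M1 (sH d a) - sH (d - 1) (M1 a)"

lemma P_lin: "P d (sc c a + b) = sc c (P d a) + P d b"
  by (simp add: P_def sH_lin M1_lin scv.scale_right_diff_distrib)

lemma P_zero [simp]: "P d 0 = 0" by (simp add: P_def)

lemma P_Zc: 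
  assumes "a \<in> G d" 
  shows "P d a \<in> Zc d"
proof (cases d)
  case 0
  then show ?thesis using assms M1_in[OF sH_in[of d a]]
    by (simp add: P_def Zc_def M1_G0 G_diff)
next
  case (Suc e)
  have "M1 (P d a) = 0"
    using assms M1_M1[OF sH_in[of d a]] M1_sH_M1[of a e] Suc by (simp add: P_def M1_diff)
  then show ?thesis using assms M1_in[OF sH_in[of d a]] sH_in[of e] Suc
    by (simp add: Zc_def P_def G_diff)
qed

lemma P_M1: "c \<in> G (Suc d) \<Longrightarrow> P d (M1 c) = 0"
  by (simp add: P_def M1_M1 M1_sH_M1)

lemma P_decomp: "a \<in> G d \<Longrightarrow> a = M1 (sH d a) + sH (d - 1) (M1 a) + P d a"
  by (simp add: P_def)

definition PP :: "nat \<times> 'a \<Rightarrow> nat \<times> 'a" where "PP p = (fst p, P (fst p) (snd p))"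

lemma map_fst_PP [simp]: "map fst (map PP xs) = map fst xs"
  by (simp add: PP_def comp_def)

lemma valid_PP: "valid G xs \<Longrightarrow> valid Zc (map PP xs)"
  by (induction xs) (auto simp: PP_def P_Zc)

end

declare One_nat_def [simp del]

section \<open>The tensor homotopy, computed modulo multilinearity\<close>

definition cns :: "nat \<times> 'a \<Rightarrow> ('k::field,'a) ev \<Rightarrow> ('k,'a) ev" where
  "cns p = ext (\<lambda>ys. gn (p # ys))"

lemma lop_cns: "lop (cns p)" unfolding cns_def by (rule lop_ext)

lemmas cns_simps = lop_simps[OF lop_cns]

lemma cns_gn [simp]: "cns p (gn ys) = gn (p # ys)" by (simp add: cns_def)

context ainf_algebra
begin

abbreviation R1 :: "('k,'a) ev set" where "R1 \<equiv> ev.span (RL \<union> RN)"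

lemma R1_Q: "u \<in> R1 \<Longrightarrow> Q u = 0"
  using span_V Q_eq_0 by blast

lemma R1_rel:
  assumes "valid G xs" "valid G ys" "a \<in> G d" "b \<in> G d"
  shows "gn (xs @ (d, sc c a + b) # ys) - scal c (gn (xs @ (d, a) # ys)) - gn (xs @ (d, b) # ys) \<in> R1"
  unfolding RL_def using assms by (intro ev.span_base UnI1 CollectI) blast

lemma R1_zero: "valid G xs \<Longrightarrow> valid G ys \<Longrightarrow> gn (xs @ (d, 0) # ys) \<in> R1"
  unfolding RN_def using G_zero by (intro ev.span_base UnI2 CollectI) blast

lemma R1_cns:
  assumes p: "snd p \<in> G (fst p)" and u: "u \<in> R1"
  shows "cns p u \<in> R1"
proof (rule lop_span[OF lop_cns _ _ u])
  fix x assume "x \<in> RL \<union> RN"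
  then consider (L) xs ys d a b c where "x = gn (xs @ (d, sc c a + b) # ys) - scal c (gn (xs @ (d, a) # ys)) - gn (xs @ (d, b) # ys)"
      "valid G xs" "valid G ys" "a \<in> G d" "b \<in> G d"
    | (N) xs ys d where "x = gn (xs @ (d, 0) # ys)" "valid G xs" "valid G ys"
    unfolding RL_def RN_def by blast
  then show "cns p x \<in> R1"
  proof cases
    case L
    then show ?thesis using R1_rel[of "p # xs" ys a d b c] p
      by (simp add: cns_simps)
  next
    case N
    then show ?thesis using R1_zero[of "p # xs" ys d] p by simp
  qed
qed (rule ev.subspace_span)

lemma vlk_cns: "snd p \<in> G (fst p) \<Longrightarrow> vlk u \<Longrightarrow> vlk (cns p u)"
  unfolding cns_def by (rule vlk_ext) (auto intro!: vlk_gn simp: vl_def)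

lemma R1_cns_zero: "vlk u \<Longrightarrow> cns (d, 0) u \<in> R1"
  by (rule lop_in_subspace[OF lop_cns ev.subspace_span])
    (use R1_zero[of "[]"] in \<open>auto simp: vlk_def vl_def\<close>)

lemma R1_cns_lin:
  assumes "vlk u" "a \<in> G d" "b \<in> G d"
  shows "cns (d, sc c a + b) u - scal c (cns (d, a) u) - cns (d, b) u \<in> R1"
  by (rule lop_in_subspace[OF lop_sub[OF lop_sub[OF lop_cns lop_smult[OF lop_cns]] lop_cns] ev.subspace_span])
    (use R1_rel[of "[]" _ a d b c] assms in \<open>auto simp: vlk_def vl_def\<close>)

text \<open>The tensor homotopy \<open>\<Sum> P \<otimes> \<dots> \<otimes> P \<otimes> s \<otimes> 1 \<otimes> \<dots> \<otimes> 1\<close> between \<open>P \<otimes> \<dots> \<otimes> P\<close> and the identity.\<close>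

primrec sr :: "'a hlist \<Rightarrow> ('k,'a) ev" where
  "sr [] = 0"
| "sr (p # xs) = gn ((Suc (fst p), sH (fst p) (snd p)) # xs) + scal ((-1) ^ Suc (fst p)) (cns (PP p) (sr xs))"

text \<open>The \<open>m\<^sub>1\<close> part of \<open>b'\<close> as a recursion along the list,
  the form in which it can be compared with \<open>sr\<close>. Degree \<open>0\<close> is set apart
  because the label \<open>fst p - 1\<close> would be truncated.\<close>

primrec d1r :: "'a hlist \<Rightarrow> ('k,'a) ev" where
  "d1r [] = 0"
| "d1r (p # xs) = (if fst p = 0 then 0 else gn ((fst p - 1, M1 (snd p)) # xs)) + scal ((-1) ^ Suc (fst p)) (cns p (d1r xs))"

lemma P_in: "a \<in> G d \<Longrightarrow> P d a \<in> G d"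
  using P_Zc Zc_G by blast

lemma M1_in': "a \<in> G d \<Longrightarrow> d \<noteq> 0 \<Longrightarrow> M1 a \<in> G (d - 1)"
  using M1_in[of a "d - 1"] by simp

lemma vlk_sr: "valid G xs \<Longrightarrow> vlk (sr xs)"
  by (induction xs) (auto simp: vlk_0 PP_def P_in sH_in vl_def intro!: vlk_add vlk_gn vlk_scal vlk_cns vlk_minus vlk_diff)

lemma vlk_d1r: "valid G xs \<Longrightarrow> vlk (d1r xs)"
  by (induction xs) (auto simp: vlk_0 M1_in' vl_def intro!: vlk_add vlk_gn vlk_scal vlk_cns vlk_minus vlk_diff)

lemma ext_d1r_cns:
  "ext d1r (cns p u) = (if fst p = 0 then 0 else cns (fst p - 1, M1 (snd p)) u) + scal ((-1) ^ Suc (fst p)) (cns p (ext d1r u))"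
proof (cases "fst p = 0")
  case True
  have "ext d1r (cns p u) = scal ((-1) ^ Suc (fst p)) (cns p (ext d1r u))"
    by (rule lop_eqI[OF lop_comp[OF lop_ext lop_cns] lop_smult[OF lop_comp[OF lop_cns lop_ext]]]) (simp add: True)
  then show ?thesis using True by simp
next
  case False
  have "ext d1r (cns p u) = cns (fst p - 1, M1 (snd p)) u + scal ((-1) ^ Suc (fst p)) (cns p (ext d1r u))"
    by (rule lop_eqI[OF lop_comp[OF lop_ext lop_cns] lop_plus[OF lop_cns lop_smult[OF lop_comp[OF lop_cns lop_ext]]]])
      (simp add: False)
  then show ?thesis using False by simp
qed

lemma ext_sr_cns:
  "ext sr (cns p u) = cns (Suc (fst p), sH (fst p) (snd p)) u + scal ((-1) ^ Suc (fst p)) (cns (PP p) (ext sr u))"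
  by (rule lop_eqI[OF lop_comp[OF lop_ext lop_cns] lop_plus[OF lop_cns lop_smult[OF lop_comp[OF lop_cns lop_ext]]]]) simp

lemma neg1_sq: "scal ((-1) ^ n) (scal ((-1) ^ n) x) = x"
  by (simp flip: power_mult_distrib)

text \<open>By induction the homotopy for the tail is tensored with \<open>P\<close> of the first
  entry. Terms with \<open>sH\<close> in front and \<open>d1r\<close> behind cancel by sign; terms
  with both \<open>P\<close> and \<open>m\<^sub>1\<close> in front have first entry zero. What is
  left is \<open>P_decomp\<close> in the first slot.\<close>

lemma sr_homotopy: "valid G xs \<Longrightarrow> ext d1r (sr xs) + ext sr (d1r xs) - gn xs + gn (map PP xs) \<in> R1"
proof (induction xs)
  case Nil
  show ?case by (simp add: ext_simps ev.span_zero)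
next
  case (Cons p ys)
  obtain d a where p: "p = (d, a)" by (cases p)
  have v: "a \<in> G d" "valid G ys" using Cons.prems p by auto
  define H where "H = ext d1r (sr ys) + ext sr (d1r ys) - gn ys + gn (map PP ys)"
  have H: "H \<in> R1" using Cons.IH v by (simp add: H_def)
  let ?pa = "(d, P d a)"
  have 1: "cns ?pa H \<in> R1" by (rule R1_cns[OF _ H]) (simp add: P_in v)
  have cH: "cns ?pa H = cns ?pa (ext d1r (sr ys)) + cns ?pa (ext sr (d1r ys)) - gn (?pa # ys) + gn (?pa # map PP ys)"
    by (simp add: H_def cns_simps)
  have MP: "M1 (P d a) = 0" using P_Zc[OF v(1)] by (simp add: Zc_def)
  have rel: "gn ((d, x + y) # ys) - gn ((d, x) # ys) - gn ((d, y) # ys) \<in> R1" if "x \<in> G d" "y \<in> G d" for x y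
    using R1_rel[of "[]" ys x d y 1] that v by simp
  have s1: "M1 (sH d a) \<in> G d" by (rule M1_in[OF sH_in])
  have PPa: "PP (e, b) = (e, P e b)" for e b by (simp add: PP_def)
  let ?s = "(-1::'k) ^ Suc d"
  show ?case
  proof (cases d)
    case 0
    have "gn ((d, a) # ys) - gn ((d, M1 (sH d a)) # ys) - gn ((d, P d a) # ys) \<in> R1"
      using rel[OF s1 P_in[OF v(1)]] P_decomp[OF v(1)] M1_G0[of a] v 0 by simp
    then have main: "cns ?pa H - (gn ((d, a) # ys) - gn ((d, M1 (sH d a)) # ys) - gn ((d, P d a) # ys)) \<in> R1"
      by (rule ev.span_diff[OF 1])
    have e1: "ext d1r (sr (p # ys)) = gn ((d, M1 (sH d a)) # ys) + scal (- ?s) (cns (Suc d, sH d a) (d1r ys))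
        + cns ?pa (ext d1r (sr ys))"
      using 0 by (simp add: p PPa ext_simps ext_d1r_cns
          ev.scale_right_distrib neg1_sq)
    have e2: "ext sr (d1r (p # ys)) = scal ?s (cns (Suc d, sH d a) (d1r ys)) + cns ?pa (ext sr (d1r ys))"
      using 0 by (simp add: p PPa ext_simps ext_sr_cns
          ev.scale_right_distrib neg1_sq)
    show ?thesis using main unfolding cH e1 e2
      by (simp add: p PPa algebra_simps)
  next
    case (Suc e)
    have s2: "sH e (M1 a) \<in> G d" using sH_in Suc by simp
    have Pa: "a = M1 (sH d a) + sH e (M1 a) + P d a" using P_decomp[OF v(1)] Suc by simp
    have "gn ((d, a) # ys) - gn ((d, M1 (sH d a) + sH e (M1 a)) # ys) - gn ((d, P d a) # ys) \<in> R1"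
      using rel[OF G_add[OF s1 s2] P_in[OF v(1)]] Pa by simp
    from ev.span_add[OF this rel[OF s1 s2]]
    have 2: "gn ((d, a) # ys) - gn ((d, M1 (sH d a)) # ys) - gn ((d, sH e (M1 a)) # ys) - gn ((d, P d a) # ys) \<in> R1"
      by (simp add: algebra_simps)
    have 3: "cns (e, 0) (sr ys) \<in> R1" by (rule R1_cns_zero[OF vlk_sr[OF v(2)]])
    have PM: "P e (M1 a) = 0" using P_M1 v Suc by simp
    have main: "cns ?pa H - (gn ((d, a) # ys) - gn ((d, M1 (sH d a)) # ys) - gn ((d, sH e (M1 a)) # ys) - gn ((d, P d a) # ys))
       + scal ?s (cns (e, 0) (sr ys)) + scal (- ?s) (cns (e, 0) (sr ys)) \<in> R1"
      by (intro ev.span_add ev.span_diff ev.span_scale 1 2 3)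
    have e1: "ext d1r (sr (p # ys)) = gn ((d, M1 (sH d a)) # ys) + scal (- ?s) (cns (Suc d, sH d a) (d1r ys))
        + scal ?s (cns (e, 0) (sr ys)) + cns ?pa (ext d1r (sr ys))"
      using Suc MP by (simp add: p PPa ext_simps ext_d1r_cns
          ev.scale_right_distrib neg1_sq algebra_simps)
    have e2: "ext sr (d1r (p # ys)) = gn ((d, sH e (M1 a)) # ys) + scal (- ?s) (cns (e, 0) (sr ys))
        + scal ?s (cns (Suc d, sH d a) (d1r ys)) + cns ?pa (ext sr (d1r ys))"
      using Suc PM by (simp add: p PPa ext_simps ext_sr_cns
          ev.scale_right_distrib neg1_sq algebra_simps)
    show ?thesis using main unfolding cH e1 e2
      by (simp add: p PPa algebra_simps)
  qed
qed

lemma sr_lin: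
  assumes "valid G xs" "valid G ys" "a \<in> G d" "b \<in> G d"
  shows "sr (xs @ (d, sc c a + b) # ys) - scal c (sr (xs @ (d, a) # ys)) - sr (xs @ (d, b) # ys) \<in> R1"
  using assms(1)
proof (induction xs)
  case Nil
  have 1: "gn ((Suc d, sc c (sH d a) + sH d b) # ys) - scal c (gn ((Suc d, sH d a) # ys)) - gn ((Suc d, sH d b) # ys) \<in> R1"
    using R1_rel[of "[]" ys "sH d a" "Suc d" "sH d b" c] assms(2) sH_in by simp
  have 2: "cns (d, sc c (P d a) + P d b) (sr ys) - scal c (cns (d, P d a) (sr ys)) - cns (d, P d b) (sr ys) \<in> R1"
    by (rule R1_cns_lin[OF vlk_sr[OF assms(2)]]) (use assms P_in in auto)
  have e: "sr ((d, sc c a + b) # ys) = gn ((Suc d, sc c (sH d a) + sH d b) # ys) + scal ((-1) ^ Suc d) (cns (d, sc c (P d a) + P d b) (sr ys))"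
    by (simp add: PP_def sH_lin P_lin)
  show ?case unfolding append_Nil e
    using ev.span_add[OF 1 ev.span_scale[OF 2, of "(-1) ^ Suc d"]]
    by (simp add: PP_def ev.scale_right_distrib ev.scale_right_diff_distrib mult.commute algebra_simps)
next
  case (Cons p xs)
  have v: "snd p \<in> G (fst p)" "valid G xs" using Cons.prems by auto
  let ?q = "(Suc (fst p), sH (fst p) (snd p))"
  have 1: "gn (?q # xs @ (d, sc c a + b) # ys) - scal c (gn (?q # xs @ (d, a) # ys)) - gn (?q # xs @ (d, b) # ys) \<in> R1"
    using R1_rel[of "?q # xs" ys a d b c] assms v sH_in by simp
  have 2: "cns (PP p) (sr (xs @ (d, sc c a + b) # ys) - scal c (sr (xs @ (d, a) # ys)) - sr (xs @ (d, b) # ys)) \<in> R1"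
    by (rule R1_cns[OF _ Cons.IH[OF v(2)]]) (simp add: PP_def P_in v)
  from ev.span_add[OF 1 ev.span_scale[OF 2, of "(-1) ^ Suc (fst p)"]]
  show ?case
    by (simp add: ev.scale_right_distrib ev.scale_right_diff_distrib mult.commute
        cns_simps algebra_simps)
qed

definition S1 :: "('k,'a) ev \<Rightarrow> ('k,'a) ev" where "S1 = opr sr"

lemma wop_S1: "wop S1"
  unfolding S1_def
proof (rule wop_opr)
  fix xs ys d a b c assume "valid G xs" "valid G ys" "a \<in> G d" "b \<in> G d"
  from R1_Q[OF sr_lin[OF this]]
  show "Q (sr (xs @ (d, sc c a + b) # ys)) = scal c (Q (sr (xs @ (d, a) # ys))) + Q (sr (xs @ (d, b) # ys))"
    by (simp add: Qs algebra_simps)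
next
  fix xs ys d a assume "valid G xs" "valid G ys" "a \<in> G d" "a \<in> {0::'a}"
  then show "Q (sr (xs @ (d, a) # ys)) = 0"
    using R1_Q[OF sr_lin[of xs ys 0 d 0 1]] by (simp add: Qs)
qed

definition P1 :: "('k,'a) ev \<Rightarrow> ('k,'a) ev" where "P1 = opr (\<lambda>xs. gn (map PP xs))"

lemma wop_P1: "wop P1"
  unfolding P1_def
proof (rule wop_opr)
  fix xs ys d a b c assume "valid G xs" "valid G ys" "a \<in> G d" "b \<in> G d"
  then show "Q (gn (map PP (xs @ (d, sc c a + b) # ys))) =
      scal c (Q (gn (map PP (xs @ (d, a) # ys)))) + Q (gn (map PP (xs @ (d, b) # ys)))"
    using Q_lin[of "map PP xs" "map PP ys" "P d a" d "P d b" c]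
    by (simp add: PP_def[of "(d, _)"] P_lin P_in valid_Zc_G valid_PP)
next
  fix xs ys d a assume "valid G xs" "valid G ys" "a \<in> G d" "a \<in> {0::'a}"
  then show "Q (gn (map PP (xs @ (d, a) # ys))) = 0"
    using Q_zero[of "map PP xs" "map PP ys" d] by (simp add: PP_def[of "(d, _)"] valid_Zc_G valid_PP)
qed

lemmas lop_S1 = wop_lop[OF wop_S1]
lemmas lop_P1 = wop_lop[OF wop_P1]
lemmas P1_simps = lop_simps[OF lop_P1]

definition pre :: "'a hlist \<Rightarrow> ('k,'a) ev \<Rightarrow> ('k,'a) ev" where
  "pre us = ext (\<lambda>ys. gn (us @ ys))"

lemma lop_pre: "lop (pre us)" unfolding pre_def by (rule lop_ext)

lemmas pre_simps = lop_simps[OF lop_pre]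

lemma pre_cns: "pre us (cns p u) = pre (us @ [p]) u"
  by (rule lop_eqI[OF lop_comp[OF lop_pre lop_cns] lop_pre]) (simp add: pre_def)

lemma ins_1:
  assumes "valid G us" "valid G ys" "a \<in> G d"
  shows "ins (int (length us)) 1 (gn (us @ (d, a) # ys)) = scal ((-1) ^ sdeg us) (Q (gn (us @ (d - 1, M1 a) # ys)))"
  using ins_gn[of us "[(d, a)]" ys] assms by (simp add: vl_def mapp_1 One_nat_def)

lemma sum_ins_1:
  assumes "valid G us" "valid G xs"
  shows "(\<Sum>i<length xs. ins (int (length us + i)) 1 (gn (us @ xs))) = scal ((-1) ^ sdeg us) (Q (pre us (d1r xs)))"
  using assms
proof (induction xs arbitrary: us)
  case Nil
  then show ?case by (simp add: pre_simps Qs)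
next
  case (Cons p ys)
  obtain d a where p: "p = (d, a)" by (cases p)
  have v: "a \<in> G d" "valid G ys" "valid G (us @ [p])" using Cons.prems p by auto
  have 1: "ins (int (length us)) 1 (gn (us @ p # ys)) = scal ((-1) ^ sdeg us) (Q (pre us (if d = 0 then 0 else gn ((d - 1, M1 a) # ys))))"
    using ins_1[OF Cons.prems(1) v(2,1)] v M1_G0[of a] Q_zero[OF Cons.prems(1) v(2)]
    by (auto simp: p pre_def ext_simps Qs)
  have "(\<Sum>i<length (p # ys). ins (int (length us + i)) 1 (gn (us @ p # ys))) =
     ins (int (length us)) 1 (gn (us @ p # ys)) + (\<Sum>i<length ys. ins (int (length (us @ [p]) + i)) 1 (gn ((us @ [p]) @ ys)))"
    by (simp add: sum.lessThan_Suc_shift add.assoc add.left_commute del: sum.lessThan_Suc)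
  also have "(\<Sum>i<length ys. ins (int (length (us @ [p]) + i)) 1 (gn ((us @ [p]) @ ys))) =
      scal ((-1) ^ sdeg (us @ [p])) (Q (pre (us @ [p]) (d1r ys)))"
    by (rule Cons.IH[OF v(3,2)])
  also have "\<dots> = scal ((-1) ^ sdeg us) (Q (pre us (scal ((-1) ^ Suc d) (cns p (d1r ys)))))"
    by (simp add: p pre_cns pre_simps Qs power_add)
  finally show ?case unfolding 1
    by (simp add: p pre_simps Qs
        ev.scale_right_distrib ev.scale_right_diff_distrib)
qed

lemma pre_Nil: "pre [] u = u"
  by (rule lop_eqI[OF lop_pre lop_id]) (simp add: pre_def)

lemma bp1_gn: "vl xs \<Longrightarrow> bp 1 (gn xs) = Q (d1r xs)"
  using sum_ins_1[of "[]" xs] by (simp add: bp_gn vl_def pre_Nil)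

lemma bp1_vlk: "vlk u \<Longrightarrow> bp 1 u = Q (ext d1r u)"
  by (rule lop_eqI[OF lop_bp lop_comp[OF lop_Q lop_ext]]) (simp add: vlk_def bp1_gn)

lemma S1_vlk: "vlk u \<Longrightarrow> S1 u = Q (ext sr u)"
  by (rule lop_eqI[OF lop_S1 lop_comp[OF lop_Q lop_ext]]) (simp add: vlk_def S1_def opr_gn)

lemma P1_vlk: "vlk u \<Longrightarrow> P1 u = Q (ext (\<lambda>xs. gn (map PP xs)) u)"
  by (rule lop_eqI[OF lop_P1 lop_comp[OF lop_Q lop_ext]]) (simp add: vlk_def P1_def opr_gn)

lemma homotopy: "Q x = P1 x + bp 1 (S1 x) + S1 (bp 1 x)"
proof (rule wop_eqI[OF wop_id wop_plus[OF wop_plus[OF wop_P1 wop_comp[OF wop_bp wop_S1]] wop_comp[OF wop_S1 wop_bp]]])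
  fix xs assume v: "vl xs"
  then have va: "valid G xs" by (simp add: vl_def)
  have "bp 1 (S1 (gn xs)) = Q (ext d1r (sr xs))"
    using bp1_vlk[OF vlk_sr[OF va]] v by (simp add: S1_def opr_gn wop_Q[OF wop_bp])
  moreover have "S1 (bp 1 (gn xs)) = Q (ext sr (d1r xs))"
    using S1_vlk[OF vlk_d1r[OF va]] bp1_gn[OF v] by (simp add: wop_Q[OF wop_S1])
  moreover have "P1 (gn xs) = Q (gn (map PP xs))" using v by (simp add: P1_def opr_gn)
  ultimately show "Q (gn xs) = P1 (gn xs) + bp 1 (S1 (gn xs)) + S1 (bp 1 (gn xs))"
    using R1_Q[OF sr_homotopy[OF va]] by (simp add: Qs algebra_simps)
qed

text \<open>Every entry other than \<open>c\<close> is killed by \<open>m\<^sub>1\<close>. This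
  exhibits a tensor of cycles with one boundary entry as an \<open>m\<^sub>1\<close>
  boundary.\<close>

lemma bp1_cycles:
  assumes "valid Zc xs" "valid Zc ys" "c \<in> G d"
  shows "bp 1 (gn (xs @ (d, c) # ys)) = scal ((-1) ^ sdeg xs) (Q (gn (xs @ (d - 1, M1 c) # ys)))"
proof -
  let ?zs = "xs @ (d, c) # ys"
  have v: "vl ?zs" "valid G ?zs" using assms by (simp_all add: vl_def valid_Zc_G)
  have z: "ins (int i) 1 (gn ?zs) = 0" if i: "i < length ?zs" "i \<noteq> length xs" for i
  proof -
    obtain e b where b: "?zs ! i = (e, b)" by (metis surj_pair)
    have "(e, b) \<in> set xs \<union> set ys"
      using i b[symmetric] by (auto simp: nth_append nth_Cons split: nat.splits if_splits)
    then have b0: "M1 b = 0" "b \<in> G e" using assms by (auto simp: valid_def Zc_def)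
    note zs = id_take_nth_drop[OF i(1), unfolded b]
    have va: "valid G (take i ?zs)" "valid G (drop (Suc i) ?zs)" by (rule vt[OF v(2)])+
    have len: "length (take i ?zs) = i" using i by simp
    then have "ins (int i) 1 (gn (take i ?zs @ (e, b) # drop (Suc i) ?zs)) = 0"
      using ins_1[OF va b0(2)] by (simp only: len b0(1) Q_zero[OF va] ev.scale_zero_right)
    then show ?thesis unfolding zs[symmetric] .
  qed
  have "bp 1 (gn ?zs) = (\<Sum>i<length ?zs. ins (int i) 1 (gn ?zs))" using bp_gn[OF v(1), of 1] by (simp only: add_diff_cancel_right')
  also have "\<dots> = (\<Sum>i\<in>{length xs}. ins (int i) 1 (gn ?zs))"
    by (rule sum.mono_neutral_right) (use z in auto)
  also have "\<dots> = scal ((-1) ^ sdeg xs) (Q (gn (xs @ (d - 1, M1 c) # ys)))"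
    using ins_1[of xs ys c d] assms by (simp add: valid_Zc_G)
  finally show ?thesis .
qed

section \<open>Comparison of tensors over \<open>A\<close>, over its cycles and over
  \<open>H(A)\<close>\<close>

lemma bp1_W2: "W2.vl xs \<Longrightarrow> bp 1 (gn xs) = 0"
proof -
  assume v: "W2.vl xs"
  then obtain d c ys where xs: "xs = (d, c) # ys" by (cases xs) (auto simp: W2.vl_def)
  then have "bp 1 (gn ([] @ (d, c) # ys)) = scal ((-1) ^ sdeg []) (Q (gn ([] @ (d - 1, M1 c) # ys)))"
    using v bp1_cycles[of "[]" ys c d] by (auto simp: W2.vl_def Zc_G)
  moreover have "M1 c = 0" using v xs by (simp add: W2.vl_def Zc_def)
  ultimately show ?thesis using v xs Q_zero[of "[]" ys "d - 1"] by (simp add: W2.vl_def valid_Zc_G)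
qed

lemma bp1_W2k: "W2.vlk u \<Longrightarrow> bp 1 u = 0"
  by (rule lop_eqI[OF lop_bp lop_0]) (simp add: W2.vlk_def bp1_W2)

lemma W2_vl: "W2.vl xs \<Longrightarrow> vl xs"
  by (simp add: W2.vl_def vl_def valid_Zc_G)

lemma W2_vlk: "W2.vlk u \<Longrightarrow> vlk u"
  by (simp add: W2.vlk_def vlk_def W2_vl)

lemma W2_vlk_P: "vlk u \<Longrightarrow> W2.vlk (ext (\<lambda>xs. gn (map PP xs)) u)"
  unfolding W2.vlk_def
proof
  fix g assume u: "vlk u" and g: "g \<in> keys (ext (\<lambda>xs. gn (map PP xs)) u)"
  obtain h where "h \<in> keys u" "g \<in> keys (gn (map PP h) :: ('k,'a) ev)" using g keys_ext by blast
  then show "W2.vl g" using u valid_PP[of h] by (auto simp: gn_def vlk_def vl_def W2.vl_def)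
qed

lemma bp1_P1: "bp 1 (P1 x) = 0"
proof (rule wop_eqI[OF wop_comp[OF wop_bp wop_P1] wop_0])
  fix xs assume v: "vl xs"
  then have "W2.vl (map PP xs)" using valid_PP[of xs] by (simp add: vl_def W2.vl_def)
  then show "bp 1 (P1 (gn xs)) = 0"
    using v bp1_W2 by (simp add: P1_def opr_gn wop_Q[OF wop_bp])
qed

lemma bp1_bp1: "bp 1 (bp 1 x) = 0"
  using bp_bp[of 1 x] by (simp add: One_nat_def)

text \<open>The homotopy formula at \<open>bp 1 x\<close> contains \<open>P1 (bp 1 x)\<close>, while
  \<open>bp 1\<close> applied to the formula at \<open>x\<close> gives the same equation without
  that term, since \<open>P1\<close> takes values in cycles.\<close>

lemma P1_bp1: "P1 (bp 1 x) = 0"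
proof -
  have "bp 1 x = P1 (bp 1 x) + bp 1 (S1 (bp 1 x))"
    using homotopy[of "bp 1 x"] by (simp add: bp1_bp1 Q_wop[OF wop_bp] lop_zero[OF lop_S1])
  moreover have "bp 1 x = bp 1 (S1 (bp 1 x))"
    using arg_cong[OF homotopy[of x], of "bp 1"]
    by (simp add: bp1_bp1 bp1_P1 bp_simps wop_Q[OF wop_bp])
  ultimately show ?thesis by (metis add_cancel_left_left)
qed

text \<open>Killing boundaries in tensor powers of cycles amounts to working modulo the image of \<open>m\<^sub>1\<close>.\<close>

lemma W2_kernel:
  assumes "W2.vlk u" "W2.Q u = 0"
  shows "\<exists>t. Q u = bp 1 t"
proof -
  let ?S = "{u. \<exists>t. Q u = bp 1 t}"
  have S: "ev.subspace ?S"
  proof (rule ev.subspaceI)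
    show "0 \<in> ?S" by (auto intro!: exI[of _ 0] simp: Qs bp_simps)
  next
    fix x y assume "x \<in> ?S" "y \<in> ?S"
    then obtain t s where "Q x = bp 1 t" "Q y = bp 1 s" by blast
    then show "x + y \<in> ?S" by (auto intro!: exI[of _ "t + s"] simp: Qs bp_simps)
  next
    fix c x assume "x \<in> ?S"
    then obtain t where "Q x = bp 1 t" by blast
    then show "scal c x \<in> ?S" by (auto intro!: exI[of _ "scal c t"] simp: Qs bp_simps)
  qed
  have "u \<in> ev.span (W2.RL \<union> W2.RN)"
    using assms W2.Q_eq_0_supp[of u] by (auto simp: W2.vlk_def)
  then have "u \<in> ?S"
  proof (rule lop_span[OF lop_id S, rotated])
    fix x assume "x \<in> W2.RL \<union> W2.RN"
    then consider (L) xs ys d a b c where "x = gn (xs @ (d, sc c a + b) # ys) - scal c (gn (xs @ (d, a) # ys)) - gn (xs @ (d, b) # ys)"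
        "valid Zc xs" "valid Zc ys" "a \<in> Zc d" "b \<in> Zc d"
      | (N) xs ys d a where "x = gn (xs @ (d, a) # ys)" "valid Zc xs" "valid Zc ys" "a \<in> Bd d"
      unfolding W2.RL_def W2.RN_def by blast
    then show "x \<in> ?S"
    proof cases
      case L
      then have "Q x = 0" using Q_lin[of xs ys a d b c] by (simp add: Qs valid_Zc_G Zc_G)
      then show ?thesis using lop_zero[OF lop_bp] by (auto intro: exI[of _ 0])
    next
      case N
      then obtain c where c: "c \<in> G (Suc d)" "a = M1 c" by (auto simp: Bd_def)
      have "Q x = bp 1 (scal ((-1) ^ sdeg xs) (gn (xs @ (Suc d, c) # ys)))"
        using bp1_cycles[of xs ys c "Suc d"] N c by (simp add: bp_simps neg1_sq)
      then show ?thesis by blast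
    qed
  qed
  then show ?thesis by simp
qed

text \<open>On a cycle \<open>P\<close> differs from the identity by a boundary, which is null over
  \<open>H(A)\<close>; the entries are replaced one at a time.\<close>

lemma W2_Q_P_gn: 
  "valid Zc us \<Longrightarrow> valid Zc xs \<Longrightarrow> W2.Q (gn (us @ map PP xs)) = W2.Q (gn (us @ xs))"
proof (induction xs arbitrary: us)
  case (Cons p xs)
  obtain d a where p: "p = (d, a)" by (cases p)
  have v: "a \<in> Zc d" "valid Zc xs" using Cons.prems p by auto
  have b: "M1 (sH d a) \<in> Bd d" "M1 (sH d a) \<in> Zc d"
    using sH_in[of d a] M1_in[OF sH_in] M1_M1[OF sH_in] by (auto simp: Bd_def Zc_def)
  have Pa: "P d a + M1 (sH d a) = a" using v by (simp add: P_def Zc_def)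
  have PZ: "P d a \<in> Zc d" using P_Zc Zc_G v by blast
  have "W2.Q (gn (us @ map PP (p # xs))) = W2.Q (gn ((us @ [(d, P d a)]) @ map PP xs))"
    by (simp add: p PP_def)
  also have "\<dots> = W2.Q (gn ((us @ [(d, P d a)]) @ xs))"
    by (rule Cons.IH) (use Cons.prems PZ v in auto)
  also have "\<dots> = W2.Q (gn (us @ (d, P d a) # xs)) + W2.Q (gn (us @ (d, M1 (sH d a)) # xs))"
    using W2.Q_N[of us xs "M1 (sH d a)" d] Cons.prems v b by simp
  also have "\<dots> = W2.Q (gn (us @ p # xs))"
    using W2.Q_add[of us xs "P d a" d "M1 (sH d a)"] Cons.prems v b PZ by (simp add: Pa p)
  finally show ?case .
qed simp

lemma W2_Q_P: "W2.vlk u \<Longrightarrow> W2.Q (ext (\<lambda>xs. gn (map PP xs)) u) = W2.Q u"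
  by (rule lop_eqI[OF lop_comp[OF W2.lop_Q lop_ext] W2.lop_Q])
    (use W2_Q_P_gn[of "[]"] in \<open>auto simp: W2.vlk_def W2.vl_def\<close>)

text \<open>Injectivity in the Kuenneth comparison. The hypothesis makes the entrywise image of
  \<open>u\<close> under \<open>P\<close> a combination of relations of \<open>A\<close>; a second
  application of \<open>P\<close> turns these into relations among cycles, and over
  \<open>H(A)\<close> neither application changes the class.\<close>

lemma W2_zero_of_P1:
  assumes u: "W2.vlk u" and 0: "P1 u = 0"
  shows "W2.Q u = 0"
proof -
  let ?P = "ext (\<lambda>xs. gn (map PP xs)) :: ('k,'a) ev \<Rightarrow> _"
  have "Q (?P u) = 0" using 0 P1_vlk[OF W2_vlk[OF u]] by simp
  moreover have k: "W2.vlk (?P u)" by (rule W2_vlk_P[OF W2_vlk[OF u]])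
  ultimately have "?P u \<in> R1" using Q_eq_0_supp[of "?P u"] W2_vlk[OF k] by (auto simp: vlk_def)
  then have "W2.Q (?P (?P u)) \<in> {0}"
  proof (rule lop_span[OF lop_comp[OF W2.lop_Q lop_ext], rotated 2])
    fix x assume "x \<in> RL \<union> RN"
    then consider (L) xs ys d a b c where "x = gn (xs @ (d, sc c a + b) # ys) - scal c (gn (xs @ (d, a) # ys)) - gn (xs @ (d, b) # ys)"
        "valid G xs" "valid G ys" "a \<in> G d" "b \<in> G d"
      | (N) xs ys d where "x = gn (xs @ (d, 0) # ys)" "valid G xs" "valid G ys"
      unfolding RL_def RN_def by blast
    then show "W2.Q (?P x) \<in> {0}"
    proof cases
      case L
      then show ?thesis
        using W2.Q_lin[of "map PP xs" "map PP ys" "P d a" d "P d b" c]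
        by (simp add: PP_def[of "(d, _)"] P_lin valid_PP P_Zc ext_simps W2.Qs)
    next
      case N
      then show ?thesis using W2.Q_zero[of "map PP xs" "map PP ys" d]
        by (simp add: PP_def[of "(d, _)"] valid_PP)
    qed
  qed auto
  then show ?thesis using W2_Q_P[OF k] W2_Q_P[OF u] by simp
qed

end

section \<open>Acyclicity\<close>

context ainf_algebra
begin

text \<open>The part of the total differential that lowers the weight by one. The horizontal maps
  preserve the weight, so only the vertical sign is left.\<close>

definition del :: "(int \<Rightarrow> ('k,'a) ev) \<Rightarrow> int \<Rightarrow> ('k,'a) ev" where
  "del v p = (if even p then bp 1 (v p) else - bp 1 (v p))"

lemma del_sign: "del (\<lambda>p. if even p then v p else - v p) p = bp 1 (v p)"
  by (simp add: del_def bp_simps)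

lemma d0_add: "d0 (\<lambda>p. u p + v p) p = d0 u p + d0 v p"
  unfolding d0_def by (simp add: bb_simps bp_simps la_simps N_simps)

lemma del_diff: "del (\<lambda>p. u p - v p) p = del u p - del v p"
  unfolding del_def by (simp add: bp_simps)

lemma bb_anticomm: "bb 2 (bp 1 x) + bp 1 (bb 2 x) = 0" "bp 2 (bp 1 x) + bp 1 (bp 2 x) = 0"
proof -
  have I: "{1..2::nat} = {1, 2}" by auto
  show "bb 2 (bp 1 x) + bp 1 (bb 2 x) = 0" using bb_bb[of 2 x] unfolding I by (simp add: One_nat_def bb_1[unfolded One_nat_def])
  show "bp 2 (bp 1 x) + bp 1 (bp 2 x) = 0" using bp_bp[of 2 x] unfolding I by (simp add: One_nat_def)
qed

lemma bp1_la: "bp 1 (la x) = la (bp 1 x)"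
  using bb_la[of 1 x] by (simp add: bb_1)

lemma bp1_N: "bp 1 (N x) = N (bp 1 x)"
  using N_bb[of 1 x] by (simp add: bb_1)

lemma d0_del: "d0 (del v) p = - del (d0 v) p"
  using bb_anticomm[of "v p"]
  by (auto simp: d0_def del_def bp_simps la_simps
      N_simps bb_simps bp1_la bp1_N eq_neg_iff_add_eq_0 algebra_simps)

text \<open>For a chain starting in weight \<open>k\<close> these are the lowest components of its
  differential: the first page differential \<open>del\<close>, and the expression whose vanishing
  says that the leading term survives to a cycle of the second page.\<close>

lemma dar_low:
  assumes low: "\<And>p f. f < int k \<Longrightarrow> w p f = 0"
  shows "f < int k - 1 \<Longrightarrow> dar w p f = 0"
    and "dar w p (int k - 1) = del (\<lambda>p. w p (int k)) p"
    and "dar w p (int k) = d0 (\<lambda>p. w p (int k)) p + del (\<lambda>p. w p (int k + 1)) p"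
proof -
  show "dar w p f = 0" if "f < int k - 1"
  proof -
    have "w p (f + 2 - int j) = 0" if "j \<in> {1..nat (f + 2)}" for j
      using low \<open>f < int k - 1\<close> that by simp
    then show ?thesis using that low[of f "p + 1"]
      by (simp add: dar_def bb_simps bp_simps la_simps N_simps)
  qed
  have z1: "w p (int k - 1 + 2 - int j) = 0" if "j \<in> {1..nat (int k - 1 + 2)} - {1}" for j
    using that by (intro low) auto
  have 1: "(\<Sum>j\<in>{1..nat (int k - 1 + 2)}. A j (w p (int k - 1 + 2 - int j))) = A 1 (w p (int k))"
    if "\<And>j. lop (A j)" for A :: "nat \<Rightarrow> _ \<Rightarrow> ('k,'a) ev"
  proof -
    have "(\<Sum>j\<in>{1..nat (int k - 1 + 2)}. A j (w p (int k - 1 + 2 - int j))) = (\<Sum>j\<in>{1}. A j (w p (int k - 1 + 2 - int j)))"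
      by (rule sum.mono_neutral_right) (use z1 lop_zero[OF that] in auto)
    then show ?thesis by simp
  qed
  show "dar w p (int k - 1) = del (\<lambda>p. w p (int k)) p"
    unfolding dar_def del_def 1[OF lop_bb] 1[OF lop_bp]
    using low[of "int k - 1" "p + 1"] by (simp add: bb_1 la_simps N_simps)
  have z2: "w p (int k + 2 - int j) = 0" if "j \<in> {1..nat (int k + 2)} - {1, 2}" for j
    using that by (intro low) auto
  have 2: "(\<Sum>j\<in>{1..nat (int k + 2)}. A j (w p (int k + 2 - int j))) = A 1 (w p (int k + 1)) + A 2 (w p (int k))"
    if "\<And>j. lop (A j)" for A :: "nat \<Rightarrow> _ \<Rightarrow> ('k,'a) ev"
  proof -
    have "(\<Sum>j\<in>{1..nat (int k + 2)}. A j (w p (int k + 2 - int j))) = (\<Sum>j\<in>{1, 2}. A j (w p (int k + 2 - int j)))"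
      by (rule sum.mono_neutral_right) (use z2 lop_zero[OF that] in auto)
    then show ?thesis by (simp add: add.commute)
  qed
  show "dar w p (int k) = d0 (\<lambda>p. w p (int k)) p + del (\<lambda>p. w p (int k + 1)) p"
    unfolding dar_def del_def d0_def 2[OF lop_bb] 2[OF lop_bp] by (simp add: bb_1 algebra_simps)
qed

lemma W2_Q_DE: "(\<And>p. W2.vlk (X p)) \<Longrightarrow> W2.Q (DE (m0 m) X p) = W2.d0 (\<lambda>p. W2.Q (X p)) p"
  by (subst W2.Q_DE_only2)
    (auto simp: m0_cases W2.vlk_def W2.d0_def W2.wop_Q[OF W2.wop_bb] W2.wop_Q[OF W2.wop_bp]
      W2.wop_Q[OF W2.wop_la] W2.wop_Q[OF W2.wop_N])

lemma Q_DE_m0: "(\<And>p. vlk (X p)) \<Longrightarrow> Q (DE (m0 m) X p) = d0 (\<lambda>p. Q (X p)) p"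
  by (subst Q_DE_only2)
    (auto simp: m0_cases vlk_def d0_def wop_Q[OF wop_bb] wop_Q[OF wop_bp] wop_Q[OF wop_la] wop_Q[OF wop_N])

lemma pj_d0: "pj l f (d0 x p) = d0 (\<lambda>q. pj (l + p - q + 1) f (x q)) p"
  unfolding d0_def
  by (simp add: pj_simps pj_bb pj_bp pj_la pj_N algebra_simps)

lemma pj_bp1: "pj l f (bp 1 x) = bp 1 (pj l (f + 1) x)"
  by (simp add: pj_bp algebra_simps)

text \<open>The second page of the spectral sequence of the filtration by degree vanishes in positive weight.\<close>

lemma page2:
  assumes u: "\<And>p. pj (n - p - int k) (int k) (u p) = u p"
    and d1: "\<And>p. bp 1 (u p) = 0"
    and d2: "\<And>p. d0 u p + del v p = 0"
    and k0: "k = 0 \<Longrightarrow> \<forall>p. P1 (u p) = 0"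
  shows "\<exists>w t. (\<forall>p. pj (n + 1 - p - int k) (int k) (w p) = w p \<and> bp 1 (w p) = 0 \<and>
      pj (n - p - int k) (int k + 1) (t p) = t p \<and> d0 w p = P1 (u p) + bp 1 (t p)) \<and> (k = 0 \<longrightarrow> (\<forall>p. w p = 0))"
proof (cases "k = 0")
  case True
  show ?thesis
    by (rule exI[of _ "\<lambda>_. 0"], rule exI[of _ "\<lambda>_. 0"])
      (use True k0 in \<open>simp add: d0_def pj_simps bp_simps bb_simps la_simps N_simps\<close>)
next
  case False
  let ?P = "ext (\<lambda>xs. gn (map PP xs)) :: ('k,'a) ev \<Rightarrow> _"
  \<comment> \<open>Representatives on valid lists are chosen so that \<open>P\<close>, applied to
    every entry, gives a chain of cycles that can be read both over \<open>A\<close> and over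
    \<open>H(A)\<close>.\<close>
  define uh where "uh p = rpj (n - p - int k) (int k) (u p)" for p
  have Quh: "Q (uh p) = u p" for p unfolding uh_def Q_rpj by (rule u)
  have uhk: "vlk (uh p)" for p using keys_rpj by (auto simp: uh_def vlk_def)
  define yh where "yh p = ?P (uh p)" for p
  have yk: "W2.vlk (yh p)" for p unfolding yh_def by (rule W2_vlk_P[OF uhk])
  have y_keys: "W2.vl g \<and> int (length g) = n - p - int k \<and> int (sum_list (map fst g)) = int k" if g: "g \<in> keys (yh p)" for g p
  proof -
    obtain h where h: "h \<in> keys (uh p)" "g \<in> keys (gn (map PP h) :: ('k,'a) ev)"
      using g keys_ext unfolding yh_def by blast
    then have "g = map PP h" by (simp add: gn_def)
    then show ?thesis using keys_rpj[OF h(1)[unfolded uh_def]] W2.vlkD[OF yk g] by (simp del: map_map)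
  qed
  have Qy: "Q (yh p) = P1 (u p)" for p
    using P1_vlk[OF uhk[of p]] wop_Q[OF wop_P1, of "uh p"] by (simp add: yh_def Quh)
  have hu: "u p = P1 (u p) + bp 1 (S1 (u p))" for p
    using homotopy[of "u p"] pj_Q[OF u[of p]] by (simp add: d1 lop_zero[OF lop_S1])
  \<comment> \<open>Passing from \<open>u\<close> to \<open>P1 u\<close> changes \<open>d0 u\<close>
    by a \<open>del\<close> term, as \<open>d0\<close> and \<open>del\<close> anticommute. Hence
    \<open>d0\<close> of \<open>P1 u\<close> is an \<open>m\<^sub>1\<close> boundary, which
    \<open>P1\<close> kills.\<close>
  define T where "T p = (if even p then S1 (u p) else - S1 (u p))" for p
  have dT: "del T p = bp 1 (S1 (u p))" for p unfolding T_def by (rule del_sign)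
  have "d0 u p = d0 (\<lambda>p. P1 (u p)) p + d0 (del T) p" for p
    unfolding d0_add[symmetric] dT using hu by simp
  then have A: "d0 (\<lambda>p. P1 (u p)) p = d0 u p + del (d0 T) p" for p
    by (simp add: d0_del)
  have "d0 u p = - del v p" for p using d2[of p] by (simp add: eq_neg_iff_add_eq_0)
  then have "d0 (\<lambda>p. P1 (u p)) p = del (\<lambda>p. d0 T p - v p) p" for p
    unfolding del_diff A by simp
  then have "P1 (d0 (\<lambda>p. P1 (u p)) p) = 0" for p
    by (simp add: del_def P1_bp1 P1_simps)
  then have P0: "P1 (DE (m0 m) yh p) = 0" for p
    using Q_DE_m0[of yh p, OF W2_vlk[OF yk]] wop_Q[OF wop_P1, of "DE (m0 m) yh p"] by (simp add: Qy)
  have "W2.Q (DE (m0 m) yh p) = 0" for p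
    by (rule W2_zero_of_P1[OF W2.vlk_DE[OF yk] P0])
  then have cyc: "W2.d0 (\<lambda>p. W2.Q (yh p)) p = 0" for p
    using W2_Q_DE[OF yk] by simp
  have "W2.pj (n - p - int k) (int k) (W2.Q (yh p)) = W2.Q (yh p)" for p
    using W2.pj_keys[of "yh p", OF y_keys] by (simp add: W2.wop_Q[OF W2.wop_pj])
  from W2.goodwillie[OF W2_mu _ this cyc] False obtain w2
    where w2: "\<And>p. W2.pj (n + 1 - p - int k) (int k) (w2 p) = w2 p" "\<And>p. W2.d0 w2 p = W2.Q (yh p)"
    by force
  define wh where "wh p = W2.rpj (n + 1 - p - int k) (int k) (w2 p)" for p
  have Qwh: "W2.Q (wh p) = w2 p" for p unfolding wh_def W2.Q_rpj by (rule w2)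
  have wk: "W2.vlk (wh p)" for p using W2.keys_rpj by (auto simp: wh_def W2.vlk_def)
  have wpj: "pj (n + 1 - p - int k) (int k) (Q (wh p)) = Q (wh p)" for p
    using pj_keys[of "wh p"] W2.keys_rpj[of _ "n + 1 - p - int k" "int k" "w2 p"] W2_vl
    by (simp add: wop_Q[OF wop_pj] wh_def)
  \<comment> \<open>The equation solved over \<open>H(A)\<close> holds over \<open>A\<close> only up
    to tensors that are null over \<open>H(A)\<close>; these are the values of \<open>bp 1\<close>
    collected in \<open>t\<close>.\<close>
  define z where "z p = DE (m0 m) wh p - yh p" for p
  have "W2.vlk (z p)" for p unfolding z_def by (rule W2.vlk_diff[OF W2.vlk_DE[OF wk] yk])
  moreover have "W2.Q (z p) = 0" for p
    unfolding z_def using W2_Q_DE[of wh p, OF wk] by (simp add: W2.Qs Qwh w2)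
  ultimately have "\<exists>t. Q (z p) = bp 1 t" for p by (rule W2_kernel)
  then obtain t where t: "\<And>p. Q (z p) = bp 1 (t p)" by metis
  define w where "w p = Q (wh p)" for p
  have dw: "d0 w p = P1 (u p) + bp 1 (t p)" for p
    using t[of p] Q_DE_m0[of wh p, OF W2_vlk[OF wk]] by (simp add: z_def Qs Qy w_def[abs_def] algebra_simps)
  have pP: "pj (n - p - int k) (int k) (P1 (u p)) = P1 (u p)" for p
    unfolding Qy[symmetric] using pj_keys[of "yh p"] y_keys W2_vl by (simp add: wop_Q[OF wop_pj])
  have "pj (n - p - int k) (int k) (d0 w p) = d0 w p" for p
  proof -
    have "pj (n - p - int k + p - q + 1) (int k) (w q) = w q" for q
      using wpj[of q] by (simp add: w_def algebra_simps)
    then show ?thesis by (simp only: pj_d0)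
  qed
  then have D: "pj (n - p - int k) (int k) (d0 w p) = d0 w p" for p .
  have "bp 1 (pj (n - p - int k) (int k + 1) (t p)) = bp 1 (t p)" for p
  proof -
    have "P1 (u p) + pj (n - p - int k) (int k) (bp 1 (t p)) = P1 (u p) + bp 1 (t p)"
      using D[of p] by (simp only: dw lop_add[OF lop_pj] pP)
    then show ?thesis by (simp add: pj_bp1)
  qed
  then have "pj (n + 1 - p - int k) (int k) (w p) = w p \<and> bp 1 (w p) = 0 \<and>
      pj (n - p - int k) (int k + 1) (pj (n - p - int k) (int k + 1) (t p)) = pj (n - p - int k) (int k + 1) (t p) \<and>
      d0 w p = P1 (u p) + bp 1 (pj (n - p - int k) (int k + 1) (t p))" for p
    using dw wpj bp1_W2k[OF wk] by (simp add: w_def wop_Q[OF wop_bp] pj_pj)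
  then show ?thesis using False
    by (intro exI[of _ w] exI[of _ "\<lambda>p. pj (n - p - int k) (int k + 1) (t p)"]) blast
qed

text \<open>\<open>w\<close> in weight \<open>k\<close> accounts for the leading term up to
  \<open>m\<^sub>1\<close> boundaries, and a further component \<open>s\<close> in weight
  \<open>k + 1\<close> accounts for those. As \<open>bp 1\<close> kills \<open>w\<close>, nothing
  appears in weight \<open>k - 1\<close>.\<close>

lemma step:
  assumes hom: "hom n e" and cyc: "\<And>p f. dar e p f = 0"
    and low: "\<And>p f. f < int k \<Longrightarrow> e p f = 0"
    and k0: "k = 0 \<Longrightarrow> \<forall>p. P1 (e p 0) = 0"
  shows "\<exists>w. hom (n + 1) w \<and> (\<forall>p f. f < int k \<or> f = 0 \<longrightarrow> w p f = 0) \<and>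
    (\<forall>p f. f \<le> int k \<longrightarrow> dar w p f = e p f)"
proof -
  define u where "u p = e p (int k)" for p
  have u: "pj (n - p - int k) (int k) (u p) = u p" for p using hom by (simp add: hom_def u_def)
  have d1: "bp 1 (u p) = 0" for p
    using dar_low(2)[of k e p, OF low] cyc by (auto simp: del_def u_def split: if_splits)
  have d2: "d0 u p + del (\<lambda>p. e p (int k + 1)) p = 0" for p
    using dar_low(3)[of k e p, OF low] cyc by (simp add: u_def[abs_def])
  have "k = 0 \<Longrightarrow> \<forall>p. P1 (u p) = 0" using k0 by (simp add: u_def)
  from page2[OF u d1 d2 this] obtain w t where w: "\<And>p. pj (n + 1 - p - int k) (int k) (w p) = w p"
      "\<And>p. bp 1 (w p) = 0" "\<And>p. pj (n - p - int k) (int k + 1) (t p) = t p"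
      "\<And>p. d0 w p = P1 (u p) + bp 1 (t p)" "k = 0 \<Longrightarrow> \<forall>p. w p = 0" by blast
  define s where "s p = pj (n - p - int k) (int k + 1) (S1 (u p)) - t p" for p
  have "bp 1 (S1 (u p)) = u p - P1 (u p)" for p
  proof -
    have "u p = P1 (u p) + bp 1 (S1 (u p))"
      using homotopy[of "u p"] pj_Q[OF u[of p]] by (simp add: d1 lop_zero[OF lop_S1])
    then show ?thesis by (metis add_diff_cancel_left')
  qed
  moreover have "pj (n - p - int k) (int k) (P1 (u p)) = P1 (u p)" for p
  proof -
    have "pj (n - p - int k + p - q + 1) (int k) (w q) = w q" for q
      using w(1)[of q] by (simp add: algebra_simps)
    then have "pj (n - p - int k) (int k) (d0 w p) = d0 w p" by (simp only: pj_d0)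
    then show ?thesis using arg_cong[OF w(3)[of p], of "bp 1"] unfolding w(4) pj_bp1[symmetric]
      by (simp add: pj_simps)
  qed
  ultimately have bs: "bp 1 (s p) = u p - P1 (u p) - bp 1 (t p)" for p
    using u[of p] by (simp add: s_def bp_simps pj_bp1[symmetric] pj_simps)
  \<comment> \<open>The sign in odd columns compensates that of the vertical differential
    there.\<close>
  define W where "W p f = (if f = int k then w p else if f = int k + 1 then if even p then s p else - s p else 0)" for p f
  have low': "f < int k \<Longrightarrow> W p f = 0" for p f by (simp add: W_def)
  have "hom (n + 1) W"
    unfolding hom_def
  proof (intro allI)
    fix p f
    have "n + 1 - p - (int k + 1) = n - p - int k" by simp
    then have "pj (n + 1 - p - (int k + 1)) (int k + 1) (s p) = s p"
      by (simp only: s_def lop_diff[OF lop_pj] pj_pj w(3)) simp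
    then show "pj (n + 1 - p - f) f (W p f) = W p f"
      by (auto simp: W_def w(1) pj_simps)
  qed
  moreover have "W p f = 0" if "f < int k \<or> f = 0" for p f
    using that w(5) by (auto simp: W_def)
  moreover have "dar W p f = e p f" if f: "f \<le> int k" for p f
  proof -
    consider "f < int k - 1" | "f = int k - 1" | "f = int k" using f by linarith
    then show ?thesis
    proof cases
      case 1
      then show ?thesis using dar_low(1)[of k W f p, OF low'] low by simp
    next
      case 2
      then show ?thesis using dar_low(2)[of k W p, OF low'] low[of f p] by (simp add: del_def W_def w(2))
    next
      case 3
      have "del (\<lambda>p. W p (int k + 1)) p = bp 1 (s p)"
        by (simp add: W_def del_sign)
      then show ?thesis using dar_low(3)[of k W p, OF low'] 3
        by (simp add: W_def[of _ "int k"] w(4) bs u_def)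
    qed
  qed
  ultimately show ?thesis by blast
qed

text \<open>The approximations \<open>S k\<close> solve the equation below weight \<open>k\<close>,
  and later ones agree with them there. Their weight \<open>0\<close> part stays zero, so the
  solution is invisible to the projection onto \<open>H\<^sub>0(A)\<close>.\<close>

lemma acyclic:
  assumes hom: "hom n e" and cyc: "\<And>p f. dar e p f = 0" and P0: "\<And>p. P1 (e p 0) = 0"
  shows "\<exists>w. hom (n + 1) w \<and> (\<forall>p. w p 0 = 0) \<and> (\<forall>p f. dar w p f = e p f)"
proof -
  let ?R = "\<lambda>k w. hom (n + 1) w \<and> (\<forall>p f. f \<le> 0 \<longrightarrow> w p f = 0) \<and> (\<forall>p f. f < int k \<longrightarrow> dar w p f = e p f)"
  have zero: "hom (n + 1) (\<lambda>p f. 0)" "\<And>p f. dar (\<lambda>p f. 0) p f = 0"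
    by (simp_all add: hom_def dar_def pj_simps bb_simps bp_simps la_simps N_simps)
  have "\<exists>S. \<forall>k. ?R k (S k) \<and> (\<forall>p f. f < int k \<longrightarrow> S (Suc k) p f = S k p f)"
  proof (rule dependent_nat_choice)
    show "\<exists>w. ?R 0 w"
      by (rule exI[of _ "\<lambda>p f. 0"]) (use zero hom_neg[OF hom] in auto)
  next
    fix w k assume w: "?R k w"
    define e' where "e' p f = e p f - dar w p f" for p f
    have hw: "hom n (dar w)" using hom_dar[of "n + 1" w] w by simp
    have h': "hom n e'" unfolding e'_def[abs_def] by (rule hom_diff[OF hom hw])
    have c': "dar e' p f = 0" for p f
      unfolding e'_def[abs_def] dar_diff using cyc dar_dar[of "n + 1" w] w by simp
    have l': "f < int k \<Longrightarrow> e' p f = 0" for p f using w by (simp add: e'_def)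
    have k': "k = 0 \<Longrightarrow> \<forall>p. P1 (e' p 0) = 0"
    proof
      fix p
      \<comment> \<open>As \<open>w\<close> has no weight \<open>0\<close> part, only
        \<open>m\<^sub>1\<close> reaches weight \<open>0\<close>, and \<open>P1\<close> kills what
        it brings; so the condition on weight \<open>0\<close> survives the subtraction.\<close>
      have "dar w p 0 = bp 1 (w p 1) \<or> dar w p 0 = - bp 1 (w p 1)"
        using dar_low(3)[of 0 w p] w
        by (simp add: d0_def del_def bb_simps bp_simps la_simps N_simps)
      then have "P1 (dar w p 0) = 0" by (auto simp: P1_bp1 P1_simps)
      then show "P1 (e' p 0) = 0" using P0 by (simp add: e'_def P1_simps)
    qed
    obtain v where v: "hom (n + 1) v" "\<And>p f. f < int k \<or> f = 0 \<Longrightarrow> v p f = 0" "\<And>p f. f \<le> int k \<Longrightarrow> dar v p f = e' p f"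
      using step[OF h' c' l' k'] by blast
    show "\<exists>w'. ?R (Suc k) w' \<and> (\<forall>p f. f < int k \<longrightarrow> w' p f = w p f)"
    proof (intro exI[of _ "\<lambda>p f. w p f + v p f"] conjI allI impI)
      show "hom (n + 1) (\<lambda>p f. w p f + v p f)" using w v by (intro hom_add) auto
      show "w p f + v p f = 0" if "f \<le> 0" for p f
        using w v(2)[of f p] hom_neg[OF v(1), of f p] that by (cases "f = 0") auto
      show "dar (\<lambda>p f. w p f + v p f) p f = e p f" if "f < int (Suc k)" for p f
        using v(3)[of f p] that by (simp add: dar_add e'_def)
      show "w p f + v p f = w p f" if "f < int k" for p f using v(2) that by simp
    qed
  qed
  then obtain S where S: "\<And>k. ?R k (S k)" "\<And>k p f. f < int k \<Longrightarrow> S (Suc k) p f = S k p f" by blast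
  have stab: "S (k + j) p f = S k p f" if "f < int k" for k j p f
    using that by (induction j) (auto simp: S(2))
  define W where "W p f = S (nat (f + 1)) p f" for p f
  have WS: "W p f = S k p f" if "f < int k" for p f k
  proof (cases "f < 0")
    case True
    then show ?thesis using S(1) by (simp add: W_def)
  next
    case False
    then have "k = nat (f + 1) + (k - nat (f + 1))" using that by simp
    then show ?thesis unfolding W_def using stab[of f "nat (f + 1)" "k - nat (f + 1)" p] False by simp
  qed
  have "hom (n + 1) W" using S(1) unfolding hom_def W_def by blast
  moreover have "W p 0 = 0" for p using S(1) by (simp add: W_def)
  moreover have "dar W p f = e p f" for p f
  proof -
    \<comment> \<open>Weight \<open>f\<close> of the differential reads weights up to
      \<open>f + 1\<close>, all of which are stable from index \<open>f + 2\<close> on.\<close>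
    have "dar W p f = dar (S (nat (f + 2))) p f"
      by (rule dar_cong) (use WS in auto)
    also have "\<dots> = e p f"
    proof (cases "f < 0")
      case True
      then show ?thesis using hom_neg[OF hom_dar, of "n + 1" "S (nat (f + 2))" f p] S(1) hom_neg[OF hom, of f p] by simp
    next
      case False
      then show ?thesis using S(1)[of "nat (f + 2)"] by simp
    qed
    finally show ?thesis .
  qed
  ultimately show ?thesis by blast
qed

end

section \<open>The comparison with degree zero\<close>

lemma DE_diff: "DE m (\<lambda>p. X p - Y p) p = DE m X p - DE m Y p"
  unfolding DE_def by (simp add: ext_simps algebra_simps)

lemma DE_add: "DE m (\<lambda>p. X p + Y p) p = DE m X p + DE m Y p"
  unfolding DE_def by (simp add: ext_simps algebra_simps)

lemma DE_zero: "DE m (\<lambda>p. 0) p = 0"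
  unfolding DE_def by (simp add: ext_simps)

definition piE :: "('k::field,'a) ev \<Rightarrow> ('k,'a) ev" where
  "piE = ext (\<lambda>xs. if \<forall>p\<in>set xs. fst p = 0 then gn xs else 0)"

lemma lop_piE: "lop piE" unfolding piE_def by (rule lop_ext)

lemmas piE_simps = lop_simps[OF lop_piE]

lemma piE_gn: "piE (gn xs) = (if \<forall>p\<in>set xs. fst p = 0 then gn xs else 0)"
  by (simp add: piE_def)

lemma lookup_piE: "lookup (piE u) = lin pigen (lookup u)"
  unfolding piE_def lookup_ext
  by (intro arg_cong2[where f=lin] ext refl) (simp add: fun_eq_iff pigen_def lookup_fun_simps zero_fun_def)

lemma keys_piE:
  fixes u :: "('a::field,'b) ev"
  shows "g \<in> keys (piE u) \<Longrightarrow> g \<in> keys u \<and> (\<forall>p\<in>set g. fst p = 0)"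
proof -
  assume "g \<in> keys (piE u)"
  then obtain h where "h \<in> keys u" "g \<in> keys (if \<forall>p\<in>set h. fst p = 0 then gn h else 0 :: ('a,'b) ev)"
    unfolding piE_def using keys_ext by blast
  then show ?thesis by (cases "\<forall>p\<in>set h. fst p = 0") (auto simp: gn_def)
qed

lemma sum_fst_eq_0: "sum_list (map fst g) = 0 \<longleftrightarrow> (\<forall>p\<in>set g. fst p = (0::nat))"
  by (auto simp: sum_list_eq_0_iff)

context graded_presentation
begin

lemma ks_add: "ks D u \<Longrightarrow> ks D v \<Longrightarrow> ks D (u + v)"
  unfolding ks_def using keys_add[of u v] by blast

lemma ks_minus: "ks D u \<Longrightarrow> ks D (- u)"
  by (simp add: ks_def)

lemma ks_diff: "ks D u \<Longrightarrow> ks D v \<Longrightarrow> ks D (u - v)"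
  using ks_add[of D u "- v"] ks_minus[of D v] by simp

lemma ks_0: "ks D 0" by (simp add: ks_def)

lemma ks_sum: "(\<And>i. i \<in> I \<Longrightarrow> ks D (f i)) \<Longrightarrow> ks D (\<Sum>i\<in>I. f i)"
  by (induction I rule: infinite_finite_induct) (auto simp: ks_0 ks_add)

lemma ks_rpj: "l + f = D \<Longrightarrow> ks D (rpj l f x)"
  using keys_rpj by (auto simp: ks_def sdeg_eq)

lemma ks_vlk: "ks D u \<Longrightarrow> vlk u"
  by (simp add: ks_def vlk_def)

lemma tot_lookup: "(\<And>p. ks (n - p) (X p)) \<Longrightarrow> tot G n (\<lambda>p. lookup (X p))"
  by (auto simp: tot_def fsupp_lookup ks_def vl_def)

lemma tot_obtain:
  assumes "tot G n x"
  obtains X where "x = (\<lambda>p. lookup (X p))" "\<And>p. ks (n - p) (X p)"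
proof -
  have "\<exists>u. x p = lookup u" for p using assms exists_lookup by (auto simp: tot_def)
  then obtain X where X: "\<And>p. x p = lookup (X p)" by metis
  moreover have "ks (n - p) (X p)" for p
    using assms unfolding tot_def X ks_def fsupp_lookup vl_def by blast
  ultimately show ?thesis using that by blast
qed

lemma lookup_modeq:
  assumes "Nd = (\<lambda>_. B)" "\<And>p. vlk (X p - Y p)"
  shows "modeq (relgens sc G B) (\<lambda>p. lookup (X p)) (\<lambda>p. lookup (Y p)) \<longleftrightarrow> (\<forall>p. Q (X p) = Q (Y p))"
proof -
  have "lookup (X p) - lookup (Y p) \<in> fspan (relgens sc G B) \<longleftrightarrow> Q (X p) = Q (Y p)" for p
    using lookup_in_fspan[OF assms(1), of "X p - Y p"] assms(2)[of p]
    by (simp add: vlk_def lookup_fun_simps Qs)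
  then show ?thesis by (simp add: modeq_def)
qed

end

context ainf_algebra
begin

text \<open>Degree labels are truncated differences, so \<open>DE m X\<close> may contain lists of
  the wrong degree that are zero modulo the relations, for instance from \<open>m\<^sub>1\<close> on
  degree \<open>0\<close>. An equivalent chain of the correct degree is needed before the
  differential can be treated as a chain again.\<close>

lemma clean_DE:
  assumes X: "\<And>p. ks (n - p) (X p)"
  obtains Y where "\<And>p. ks (n - 1 - p) (Y p)" "\<And>p. Q (Y p) = Q (DE m X p)" "\<And>p. Q (DE m Y p) = 0"
proof -
  let ?x = "\<lambda>p f. pj (n - p - f) f (X p)"
  have hx: "hom n ?x" by (simp add: hom_def pj_pj)
  define Y where "Y p = (\<Sum>f\<in>{0..n - 1 - p}. rpj (n - 1 - p - f) f (dar ?x p f))" for p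
  have 1: "ks (n - 1 - p) (Y p)" for p
    unfolding Y_def by (intro ks_sum ks_rpj) simp
  have 2: "Q (Y p) = Q (DE m X p)" for p
    unfolding Q_DE_decomp[OF X] Y_def Qs Q_rpj
    by (intro sum.cong refl) (use hom_dar[OF hx] in \<open>simp add: hom_def\<close>)
  have "pj (n - 1 - p - f) f (Y p) = dar ?x p f" for p f
    using Q_DE_comp[OF X, of p f] wop_Q[OF wop_pj, of "n - 1 - p - f" f "Y p"] 2[of p] by simp
  then have "Q (DE m Y p) = 0" for p
    using Q_DE_decomp[of "n - 1" Y, OF 1] dar_dar[OF hx] by simp
  with 1 2 that show ?thesis by blast
qed

lemma acyclic_DE:
  assumes E: "\<And>p. ks (n - p) (E p)" and cyc: "\<And>p. Q (DE m E p) = 0"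
    and P0: "\<And>p. P1 (pj (n - p) 0 (E p)) = 0"
  obtains W where "\<And>p. ks (n + 1 - p) (W p)" "\<And>p. piE (W p) = 0" "\<And>p. Q (DE m W p) = Q (E p)"
proof -
  let ?e = "\<lambda>p f. pj (n - p - f) f (E p)"
  have he: "hom n ?e" by (simp add: hom_def pj_pj)
  have "dar ?e p f = 0" for p f using Q_DE_comp[OF E, of p f] by (simp add: cyc pj_simps)
  with acyclic[OF he] P0 obtain w where w: "hom (n + 1) w" "\<And>p. w p 0 = 0" "\<And>p f. dar w p f = ?e p f"
    by auto
  define W where "W p = (\<Sum>f\<in>{1..n + 1 - p}. rpj (n + 1 - p - f) f (w p f))" for p
  have 1: "ks (n + 1 - p) (W p)" for p
    unfolding W_def by (intro ks_sum ks_rpj) simp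
  have "piE (rpj l f x) = 0" if "f \<noteq> 0" for l f x
  proof (rule lop_eqI[OF lop_piE lop_0])
    fix g assume "g \<in> keys (rpj l f x)"
    then have "int (sum_list (map fst g)) = f" using keys_rpj by blast
    then have "sum_list (map fst g) \<noteq> 0" using that by auto
    then show "piE (gn g) = 0" unfolding sum_fst_eq_0 piE_gn by auto
  qed
  then have 2: "piE (W p) = 0" for p
    unfolding W_def lop_sum[OF lop_piE] by (intro sum.neutral) auto
  have "pj (n + 1 - p - f) f (W p) = w p f" for p f
  proof -
    have "pj (n + 1 - p - f) f (W p) = (\<Sum>g\<in>{1..n + 1 - p}. pj (n + 1 - p - f) f (pj (n + 1 - p - g) g (w p g)))"
      unfolding W_def lop_sum[OF lop_pj]
      by (intro sum.cong refl) (metis Q_rpj wop_Q[OF wop_pj])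
    also have "\<dots> = (\<Sum>g\<in>{1..n + 1 - p}. if g = f then w p f else 0)"
      unfolding pj_pj using w(1)[unfolded hom_def] by (intro sum.cong refl) auto
    also have "\<dots> = w p f"
    proof (cases "f \<in> {1..n + 1 - p}")
      case False
      then have "f < 0 \<or> f = 0 \<or> n + 1 - p \<le> f" by auto
      then have "w p f = 0" using hom_neg[OF w(1)] w(2) hom_short[OF w(1)] by blast
      then show ?thesis by simp
    qed simp
    finally show ?thesis .
  qed
  then have "(\<lambda>p f. pj (n + 1 - p - f) f (W p)) = w" by (intro ext)
  then have "Q (DE m W p) = Q (E p)" for p
    using Q_DE_decomp[of "n + 1" W p, OF 1] Q_decomp[OF E[of p]] by (simp add: w(3))
  with 1 2 that show ?thesis by blast
qed

lemma G0_mem: "a \<in> G0 G d \<longleftrightarrow> (if d = 0 then a \<in> G 0 else a = 0)"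
  by (simp add: G0_def)

lemma G0_G: "valid (G0 G) us \<Longrightarrow> valid G us"
  by (induction us) (auto simp: G0_mem G_zero split: if_splits)

lemma W3_vl: "W3.vl xs \<Longrightarrow> vl xs"
  by (simp add: W3.vl_def vl_def G0_G)

lemma W3_zero_entry:
  assumes "W3.vl xs" "\<not> (\<forall>p\<in>set xs. fst p = 0)"
  obtains us d vs where "xs = us @ (d, 0) # vs" "valid (G0 G) us" "valid (G0 G) vs"
proof -
  obtain p where p: "p \<in> set xs" "fst p \<noteq> 0" using assms(2) by blast
  then obtain us vs where xs: "xs = us @ p # vs" by (meson split_list)
  have "snd p = 0" using assms(1) p by (auto simp: W3.vl_def xs G0_mem split: if_splits)
  then have "xs = us @ (fst p, 0) # vs" using xs by (metis prod.collapse)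
  then show ?thesis using that[of us "fst p" vs] assms(1) by (simp add: W3.vl_def)
qed

lemma Q_piE:
  assumes "W3.vlk u"
  shows "Q (piE u) = Q u" "W3.Q (piE u) = W3.Q u"
proof -
  have g: "Q (piE (gn g)) = Q (gn g) \<and> W3.Q (piE (gn g)) = W3.Q (gn g)" if v: "W3.vl g" for g
  proof (cases "\<forall>p\<in>set g. fst p = 0")
    case False
    obtain us d vs where "g = us @ (d, 0) # vs" "valid (G0 G) us" "valid (G0 G) vs"
      by (rule W3_zero_entry[OF v False])
    then have "Q (gn g) = 0" "W3.Q (gn g) = 0" using Q_zero W3.Q_zero G0_G by blast+
    moreover have "piE (gn g :: ('k,'a) ev) = 0" unfolding piE_gn using False by (rule if_not_P)
    ultimately show ?thesis by (simp add: lop_zero[OF lop_Q] lop_zero[OF W3.lop_Q])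
  qed (simp add: piE_gn)
  show "Q (piE u) = Q u"
    by (rule lop_eqI[OF lop_comp[OF lop_Q lop_piE] lop_Q]) (use g W3.vlkD[OF assms] in blast)
  show "W3.Q (piE u) = W3.Q u"
    by (rule lop_eqI[OF lop_comp[OF W3.lop_Q lop_piE] W3.lop_Q]) (use g W3.vlkD[OF assms] in blast)
qed

lemma piE_W3: "ks D u \<Longrightarrow> W3.ks D (piE u)"
  unfolding ks_def W3.ks_def
proof
  fix g assume u: "\<forall>g\<in>keys u. vl g \<and> int (sdeg g) = D" and "g \<in> keys (piE u)"
  then have g: "vl g" "int (sdeg g) = D" "\<forall>p\<in>set g. fst p = 0" using keys_piE by blast+
  then have "valid (G0 G) g" unfolding valid_def vl_def by (fastforce simp: G0_mem)
  then show "W3.vl g \<and> int (sdeg g) = D" using g by (simp add: W3.vl_def vl_def)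
qed

lemma W3_piE: "W3.ks D u \<Longrightarrow> ks D (piE u)"
  unfolding ks_def W3.ks_def using W3_vl keys_piE by blast

lemma piE_piE: "piE (piE u) = piE u"
  by (rule lop_eqI[OF lop_comp[OF lop_piE lop_piE] lop_piE]) (simp add: piE_gn piE_simps)

lemma pj_piE: "ks D u \<Longrightarrow> pj D 0 u = Q (piE u)"
proof (rule lop_eqI[OF lop_pj lop_comp[OF lop_Q lop_piE]])
  fix g assume "ks D u" "g \<in> keys u"
  then have "vl g" "int (sdeg g) = D" by (auto simp: ks_def)
  then show "pj D 0 (gn g) = Q (piE (gn g))"
    unfolding piE_gn sum_fst_eq_0[symmetric] by (auto simp: pj_gn sdeg_eq Qs simp del: sum_list_eq_0_iff)
qed

lemma pj_1_piE: "pj l 1 (piE u) = 0"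
proof (rule lop_eqI[OF lop_comp[OF lop_pj lop_piE] lop_0])
  fix g :: "'a hlist"
  show "pj l 1 (piE (gn g)) = 0"
    unfolding piE_gn sum_fst_eq_0[symmetric]
    by (cases "vl g") (auto simp: pj_gn sdeg_eq pj_simps wop_invalid[OF wop_pj] simp del: sum_list_eq_0_iff)
qed

lemma W3_Q_DE: "(\<And>p. W3.vlk (X p)) \<Longrightarrow> W3.Q (DE (m0 m) (\<lambda>p. piE (X p)) p) = W3.Q (DE (m0 m) X p)"
proof -
  assume X: "\<And>p. W3.vlk (X p)"
  have X': "W3.vlk (piE (X p))" for p using X[of p] keys_piE[of _ "X p"] by (auto simp: W3.vlk_def)
  have e: "W3.Q (piE (X p)) = W3.Q (X p)" for p by (rule Q_piE(2)[OF X])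
  have A: "A (piE (X p)) = A (X p)" if "W3.wop A" for A p
    using W3.wop_Q[OF that] e by metis
  show ?thesis
    by (subst (1 2) W3.Q_DE_only2)
      (use X X' in \<open>auto simp: m0_cases W3.vlk_def e A[OF W3.wop_bb] A[OF W3.wop_bp] A[OF W3.wop_la] A[OF W3.wop_N]\<close>)
qed

text \<open>\<open>P\<close> kills boundaries, so \<open>P1\<close> respects the relations of
  \<open>H\<^sub>0(A)\<close>. This converts an equation in the target complex into the weight
  \<open>0\<close> condition of \<open>acyclic\<close>.\<close>

lemma P1_W3:
  assumes "W3.vlk v" "W3.Q v = 0"
  shows "P1 v = 0"
proof -
  have "v \<in> ev.span (W3.RL \<union> W3.RN)" using assms W3.Q_eq_0_supp[of v] by (auto simp: W3.vlk_def)
  then have "P1 v \<in> {0}"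
  proof (rule lop_span[OF lop_P1, rotated 2])
    fix x assume "x \<in> W3.RL \<union> W3.RN"
    then consider (L) xs ys d a b c where "x = gn (xs @ (d, sc c a + b) # ys) - scal c (gn (xs @ (d, a) # ys)) - gn (xs @ (d, b) # ys)"
        "valid (G0 G) xs" "valid (G0 G) ys" "a \<in> G0 G d" "b \<in> G0 G d"
      | (N) xs ys d a where "x = gn (xs @ (d, a) # ys)" "valid (G0 G) xs" "valid (G0 G) ys" "a \<in> G0 G d" "a \<in> N0 m G"
      unfolding W3.RL_def W3.RN_def by blast
    then show "P1 x \<in> {0}"
    proof cases
      case L
      then have "a \<in> G d" "b \<in> G d" by (auto simp: G0_mem G_zero split: if_splits)
      then have "Q x = 0" using Q_lin[of xs ys a d b c] L by (simp add: Qs G0_G)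
      then show ?thesis using wop_Q[OF wop_P1, of x] by (simp add: P1_simps)
    next
      case N
      then have a: "a \<in> G d" by (auto simp: G0_mem G_zero split: if_splits)
      have "P d a = 0"
      proof (cases "d = 0")
        case True
        then show ?thesis using N(5) P_M1 by (auto simp: N0_def M1_def One_nat_def)
      next
        case False
        then show ?thesis using N(4) by (simp add: G0_mem)
      qed
      then show ?thesis using Q_zero[of "map PP xs" "map PP ys" d] N a
        by (simp add: P1_def opr_gn vl_split G0_G valid_PP valid_Zc_G PP_def[of "(d, _)"])
    qed
  qed auto
  then show ?thesis by simp
qed

text \<open>A chain fixed by \<open>piE\<close> lives in weight \<open>0\<close>, so
  \<open>m\<^sub>1\<close> finds nothing in weight \<open>1\<close> to bring down and only
  \<open>m\<^sub>2\<close> and the horizontal maps contribute.\<close>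

lemma P1_level0:
  assumes Z: "\<And>p. ks (n + 1 - p) (Z p)" and Z0: "\<And>p. piE (Z p) = Z p" and Y: "\<And>p. Q (Y p) = Q (DE m Z p)"
  shows "pj (n - p) 0 (Y p) = Q (DE (m0 m) Z p)"
proof -
  let ?z = "\<lambda>p f. pj (n + 1 - p - f) f (Z p)"
  have hz: "hom (n + 1) ?z" by (simp add: hom_def pj_pj)
  have low: "f < int 0 \<Longrightarrow> ?z p f = 0" for p f by (simp add: pj_zero)
  have z0: "?z p 0 = Q (Z p)" for p using pj_piE[OF Z] by (simp add: Z0)
  have z1: "?z p 1 = 0" for p using pj_1_piE[of "n + 1 - p - 1" "Z p"] by (simp only: Z0)
  have "pj (n - p) 0 (Y p) = pj (n + 1 - 1 - p - 0) 0 (Q (DE m Z p))"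
    using wop_Q[OF wop_pj, of "n - p" 0 "Y p"] Y by simp
  also have "\<dots> = dar ?z p (int 0)" using Q_DE_comp[of "n + 1" Z, OF Z, of p 0] by simp
  also have "\<dots> = d0 (\<lambda>p. Q (Z p)) p"
    using dar_low(3)[of 0 ?z p, OF low] by (simp add: z0[simplified] z1[simplified] del_def bp_simps)
  also have "\<dots> = Q (DE (m0 m) Z p)" using Q_DE_m0[of Z p] ks_vlk[OF Z] by simp
  finally show ?thesis .
qed

theorem HP_proj_iso: "HP_proj_iso sc G m"
  unfolding HP_proj_iso_def quasi_iso_def
proof (intro allI conjI impI)
  fix n y
  assume y: "tot (G0 G) n y \<and> modeq (relgens sc (G0 G) (N0 m G)) (Dtot (m0 m) y) 0"
  obtain Y where Y: "y = (\<lambda>p. lookup (Y p))" "\<And>p. W3.ks (n - p) (Y p)"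
    using W3.tot_obtain y by blast
  have Yc: "W3.Q (DE (m0 m) Y p) = 0" for p
    using y W3.lookup_in_fspanD[OF refl, of "DE (m0 m) Y p"] by (simp add: modeq_def Y(1) lookup_DE)
  \<comment> \<open>Surjectivity: the same lists are read over \<open>A\<close>. The differential of
    \<open>Y0\<close> is a cycle whose weight \<open>0\<close> part is killed by \<open>P1\<close>,
    hence the boundary of some \<open>W\<close> with zero projection, and \<open>Y0 - W\<close> is a
    cycle lifting \<open>Y\<close>.\<close>
  define Y0 where "Y0 p = piE (Y p)" for p
  have Y0: "ks (n - p) (Y0 p)" "piE (Y0 p) = Y0 p" for p
    using W3_piE[OF Y(2)] by (simp_all add: Y0_def piE_piE)
  have W3Y0: "W3.vlk (Y0 p)" for p using W3.ks_vlk[OF piE_W3[OF Y0(1)]] Y0(2) by metis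
  obtain E where E: "\<And>p. ks (n - 1 - p) (E p)" "\<And>p. Q (E p) = Q (DE m Y0 p)" "\<And>p. Q (DE m E p) = 0"
    using clean_DE[of n Y0, OF Y0(1)] by blast
  have "P1 (DE (m0 m) Y0 p) = 0" for p
    using W3.vlk_DE[of Y0 p, OF W3Y0] W3_Q_DE[of Y p] W3.ks_vlk[OF Y(2)] Yc
    by (intro P1_W3) (simp_all add: Y0_def[abs_def])
  then have "P1 (pj (n - 1 - p) 0 (E p)) = 0" for p
    using P1_level0[of "n - 1" Y0 E p] Y0 E(2) wop_Q[OF wop_P1] by simp
  from acyclic_DE[of "n - 1" E, OF E(1,3) this] obtain W
    where W: "\<And>p. ks (n - p) (W p)" "\<And>p. piE (W p) = 0" "\<And>p. Q (DE m W p) = Q (E p)"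
    by auto
  define X where "X p = Y0 p - W p" for p
  have X: "ks (n - p) (X p)" for p unfolding X_def by (rule ks_diff[OF Y0(1) W(1)])
  have DX: "Q (DE m X p) = 0" for p
    unfolding X_def[abs_def] DE_diff by (simp add: Qs W(3) E(2))
  let ?x = "\<lambda>p. lookup (X p)"
  have "modeq (relgens sc G {0}) (Dtot m ?x) 0"
    unfolding modeq_def
  proof
    fix p
    show "Dtot m ?x p - 0 p \<in> fspan (relgens sc G {0})"
      using lookup_in_fspan[OF refl, of "DE m X p"] vlk_DE[of X p, OF ks_vlk[OF X]] DX
      by (simp add: lookup_DE vlk_def)
  qed
  moreover have "tot G n ?x" by (rule tot_lookup[OF X])
  moreover have "tot (G0 G) (n + 1) (\<lambda>p. lookup (0 :: ('k,'a) ev))" by (rule W3.tot_lookup[of "n + 1" "\<lambda>_. 0", OF W3.ks_0])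
  moreover have "modeq (relgens sc (G0 G) (N0 m G)) (pitot ?x - y) (Dtot (m0 m) (\<lambda>p. lookup (0 :: ('k,'a) ev)))"
    unfolding modeq_def
  proof
    fix p
    have "piE (X p) = Y0 p" by (simp add: X_def piE_simps Y0(2) W(2))
    moreover have "Dtot (m0 m) (\<lambda>p. lookup (0 :: ('k,'a) ev)) p = lookup (0 :: ('k,'a) ev)"
      unfolding lookup_DE[symmetric] DE_zero ..
    ultimately have "(pitot ?x - y) p - Dtot (m0 m) (\<lambda>p. lookup (0 :: ('k,'a) ev)) p = lookup (Y0 p - Y p)"
      by (simp only: pitot_def Y(1) lookup_piE[symmetric] minus_apply lookup_fun_simps diff_zero)
    moreover have "W3.Q (Y0 p - Y p) = 0"
      using Q_piE(2)[OF W3.ks_vlk[OF Y(2)]] by (simp add: Y0_def W3.Qs)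
    ultimately show "(pitot ?x - y) p - Dtot (m0 m) (\<lambda>p. lookup (0 :: ('k,'a) ev)) p \<in> fspan (relgens sc (G0 G) (N0 m G))"
      using W3.lookup_in_fspan[OF refl, of "Y0 p - Y p"] W3.vlk_diff[OF W3Y0 W3.ks_vlk[OF Y(2)]]
      by (simp add: W3.vlk_def)
  qed
  ultimately show "\<exists>x z. tot G n x \<and> modeq (relgens sc G {0}) (Dtot m x) 0 \<and> tot (G0 G) (n + 1) z \<and>
      modeq (relgens sc (G0 G) (N0 m G)) (pitot x - y) (Dtot (m0 m) z)" by blast
next
  fix n x
  assume x: "tot G n x \<and> modeq (relgens sc G {0}) (Dtot m x) 0 \<and>
    (\<exists>z. tot (G0 G) (n + 1) z \<and> modeq (relgens sc (G0 G) (N0 m G)) (pitot x) (Dtot (m0 m) z))"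
  then obtain z where z: "tot (G0 G) (n + 1) z" "modeq (relgens sc (G0 G) (N0 m G)) (pitot x) (Dtot (m0 m) z)" by blast
  obtain X where X: "x = (\<lambda>p. lookup (X p))" "\<And>p. ks (n - p) (X p)"
    using tot_obtain x by blast
  obtain Z where Z: "z = (\<lambda>p. lookup (Z p))" "\<And>p. W3.ks (n + 1 - p) (Z p)"
    using W3.tot_obtain z(1) by blast
  have Xc: "Q (DE m X p) = 0" for p
    using x lookup_in_fspanD[OF refl, of "DE m X p"] by (simp add: modeq_def X(1) lookup_DE)
  have XZ: "W3.Q (piE (X p)) = W3.Q (DE (m0 m) Z p)" for p
    using z(2) W3.lookup_in_fspanD[OF refl, of "piE (X p) - DE (m0 m) Z p"]
    by (simp add: modeq_def X(1) Z(1) lookup_DE lookup_piE pitot_def lookup_fun_simps W3.Qs)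
  \<comment> \<open>Injectivity: the bounding chain is read over \<open>A\<close> in the same way.
    Subtracting its boundary from \<open>X\<close> leaves a cycle whose weight \<open>0\<close> part
    is killed by \<open>P1\<close>, hence the boundary of some \<open>W\<close>; so
    \<open>W + Z0\<close> bounds \<open>X\<close>.\<close>
  define Z0 where "Z0 p = piE (Z p)" for p
  have Z0: "ks (n + 1 - p) (Z0 p)" "piE (Z0 p) = Z0 p" for p
    using W3_piE[OF Z(2)] by (simp_all add: Z0_def piE_piE)
  have W3Z0: "W3.vlk (Z0 p)" for p using W3.ks_vlk[OF piE_W3[OF Z0(1)]] Z0(2) by metis
  obtain Y where Y: "\<And>p. ks (n - p) (Y p)" "\<And>p. Q (Y p) = Q (DE m Z0 p)" "\<And>p. Q (DE m Y p) = 0"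
    using clean_DE[of "n + 1" Z0, OF Z0(1)] by auto
  define E where "E p = X p - Y p" for p
  have E: "ks (n - p) (E p)" for p unfolding E_def by (rule ks_diff[OF X(2) Y(1)])
  have Ec: "Q (DE m E p) = 0" for p
    unfolding E_def[abs_def] DE_diff by (simp add: Qs Xc Y(3))
  have "P1 (piE (X p) - DE (m0 m) Z0 p) = 0" for p
  proof (rule P1_W3)
    show "W3.vlk (piE (X p) - DE (m0 m) Z0 p)"
      by (rule W3.vlk_diff[OF W3.ks_vlk[OF piE_W3[OF X(2)]] W3.vlk_DE[of Z0, OF W3Z0]])
    show "W3.Q (piE (X p) - DE (m0 m) Z0 p) = 0"
      using W3_Q_DE[of Z p] W3.ks_vlk[OF Z(2)] XZ[of p] by (simp add: W3.Qs Z0_def[abs_def])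
  qed
  then have E0: "P1 (pj (n - p) 0 (E p)) = 0" for p
    using P1_level0[of n Z0 Y p, OF Z0 Y(2)] pj_piE[OF X(2)] wop_Q[OF wop_P1]
    by (simp add: E_def pj_simps P1_simps)
  obtain W where W: "\<And>p. ks (n + 1 - p) (W p)" "\<And>p. piE (W p) = 0" "\<And>p. Q (DE m W p) = Q (E p)"
    by (rule acyclic_DE[of n E, OF E Ec E0]) (rule that)
  define V where "V p = W p + Z0 p" for p
  have V: "ks (n + 1 - p) (V p)" for p unfolding V_def by (rule ks_add[OF W(1) Z0(1)])
  have "Q (X p) = Q (DE m V p)" for p
    unfolding V_def[abs_def] DE_add by (simp add: Qs W(3) E_def Y(2))
  moreover have "vlk (X p - DE m V p)" for p
    by (rule vlk_diff[OF ks_vlk[OF X(2)] vlk_DE[of V, OF ks_vlk[OF V]]])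
  ultimately have "modeq (relgens sc G {0}) (\<lambda>p. lookup (X p)) (\<lambda>p. lookup (DE m V p))"
    using lookup_modeq[OF refl, of X "DE m V"] by simp
  then have "modeq (relgens sc G {0}) x (Dtot m (\<lambda>p. lookup (V p)))"
    unfolding X(1) lookup_DE .
  then show "\<exists>w. tot G (n + 1) w \<and> modeq (relgens sc G {0}) x (Dtot m w)"
    using tot_lookup[OF V] by blast
qed

end

theorem theorem4p5:
  fixes sc :: "'k::field_char_0 \<Rightarrow> 'a::ab_group_add \<Rightarrow> 'a"
    and G :: "nat \<Rightarrow> 'a set"
    and m :: "nat \<Rightarrow> 'a list \<Rightarrow> 'a"
  assumes "ainf_alg sc G m"
  shows "HP_proj_iso sc G m"
proof -
  interpret ainf_presentation sc G "\<lambda>_. {0}" m by (rule ainf_alg_presentation[OF assms])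
  interpret ainf_algebra sc G m ..
  show ?thesis by (rule HP_proj_iso)
qed

end
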